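(* For every $u\equiv 2,4\pmod 6$ and every positive integer $n$, there exists a 2-D $(u\times 2^n,4,2)$-OOC with exactly $J^*(u\times 2^n)$ codewords.
   Context: A 2-D $(u\times v,4,2)$-OOC is a family $\mathcal C$ of $u\times v$ $(0,1)$-matrices of Hamming weight $4$ such that for all $A=(a_{ij}),B=(b_{ij})\in\mathcal C$ and integers $r$ with $A\ne B$ or $r\not\equiv0\pmod v$, $\sum_{i,j}a_{ij}b_{i,j+r}\le 2$ (column indices mod $v$). Write $N=\lfloor\frac{uv-1}{3}\lfloor\frac{uv-2}{2}\rfloor\rfloor$. Let $A=\{(u,v):u\equiv0\ (\mathrm{mod}\ 12),\ v\equiv2,4\ (\mathrm{mod}\ 6)\}$ and $B=\{(u,v):uv\equiv0\ (\mathrm{mod}\ 12),\ v\equiv0\ (\mathrm{mod}\ 6)\}$. Define $J^*(u\times v)$ as: $\lfloor\frac{u}{4}N\rfloor-1$ if $u\equiv7,11\pmod{12}$ and $v=2$; $\lfloor\frac{u}{4}(N-1)\rfloor$ if either ($uv\equiv0\pmod 6$ and $(u,v)\notin A\cup B$) or ($uv\equiv4,8\pmod{12}$ and $v$ even); $\lfloor\frac{u}{4}(N-1)\rfloor-1$ if $(u,v)\in A$; $\lfloor\frac{u}{4}(N-2)\rfloor$ if $(u,v)\in B$; and $\lfloor\frac{u}{4}N\rfloor$ otherwise. *)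

theory Defs
  imports Complex_Main
begin

text \<open>A u x v (0,1)-matrix is represented by its support: the set of positions (i,j)
  with i < u, j < v carrying a 1.  Hamming weight = cardinality of the support.\<close>

definition is_2D_OOC :: "nat \<Rightarrow> nat \<Rightarrow> (nat \<times> nat) set set \<Rightarrow> bool" where
  "is_2D_OOC u v C \<longleftrightarrow>
     finite C \<and>
     (\<forall>A\<in>C. A \<subseteq> {..<u} \<times> {..<v} \<and> card A = 4) \<and>
     (\<forall>A\<in>C. \<forall>B\<in>C. \<forall>r::int. (A \<noteq> B \<or> \<not> (int v dvd r)) \<longrightarrow>
        card {(i, j). (i, j) \<in> A \<and> (i, nat ((int j + r) mod int v)) \<in> B} \<le> 2)"

definition N_bound :: "nat \<Rightarrow> nat \<Rightarrow> int" where
  "N_bound u v = \<lfloor>(real (u * v) - 1) / 3 * real_of_int \<lfloor>(real (u * v) - 2) / 2\<rfloor>\<rfloor>"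

definition in_A :: "nat \<Rightarrow> nat \<Rightarrow> bool" where
  "in_A u v \<longleftrightarrow> u mod 12 = 0 \<and> (v mod 6 = 2 \<or> v mod 6 = 4)"

definition in_B :: "nat \<Rightarrow> nat \<Rightarrow> bool" where
  "in_B u v \<longleftrightarrow> (u * v) mod 12 = 0 \<and> v mod 6 = 0"

definition J_star :: "nat \<Rightarrow> nat \<Rightarrow> int" where
  "J_star u v =
    (let N = N_bound u v in
     if (u mod 12 = 7 \<or> u mod 12 = 11) \<and> v = 2 then \<lfloor>real u / 4 * real_of_int N\<rfloor> - 1
     else if ((u * v) mod 6 = 0 \<and> \<not> in_A u v \<and> \<not> in_B u v)
          \<or> (((u * v) mod 12 = 4 \<or> (u * v) mod 12 = 8) \<and> even v)
       then \<lfloor>real u / 4 * real_of_int (N - 1)\<rfloor>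
     else if in_A u v then \<lfloor>real u / 4 * real_of_int (N - 1)\<rfloor> - 1
     else if in_B u v then \<lfloor>real u / 4 * real_of_int (N - 2)\<rfloor>
     else \<lfloor>real u / 4 * real_of_int N\<rfloor>)"

end

theory Submission
  imports Defs "HOL-Library.FuncSet" "HOL-Library.Disjoint_Sets"
begin

text \<open>Put \<open>w = u * 2 ^ n\<close>. Any three points of a Steiner quadruple system lie in one block, so blocks of a
  shift-invariant system on the \<open>u \<times> 2 ^ n\<close> grid, taken one from each orbit of full length, form a code. The
  number \<open>J_star\<close> is attained if exactly \<open>w / 4\<close> blocks are fixed by the shift of order two. Such systems arise
  from a Steiner quadruple system of order \<open>u\<close> by repeated doubling along one-factorizations of the grid that are
  compatible with the shift. Systems of order \<open>u\<close> exist by Hanani's theorem, which is proved by induction on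
  the order: the points of a smaller system are replaced by groups, and the resulting blocks of groups are filled
  with designs that cover the triples meeting several groups.\<close>

text \<open>A system on the grid has \<open>w * (w - 1) * (w - 2) / 24\<close> blocks. Here
  \<open>w\<close> is even and not divisible by 3, so both floors in \<open>N_bound\<close> are
  exact, its value is \<open>N = (w - 1) * (w - 2) / 6\<close>, and there are
  \<open>w * N / 4\<close> blocks. Since \<open>J_star\<close> equals
  \<open>u * (N - 1) / 4\<close>, exactly \<open>w / 4\<close> blocks have to be left out. The
  obstacle is the group. A cyclic group of order \<open>2 * v\<close> with \<open>v\<close> even is
  not a product of groups of orders \<open>v\<close> and 2, so in the doubled grid the shift by one
  exchanges the even and the odd columns, and only its square acts on each half as the old shift. A
  mixed block joins a pair of each half, with colours that correspond under a permutation. Its image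
  is again a block if this permutation, then the action of the shift on colours, then the
  permutation again, give the identity. Moreover no mixed block may be fixed by the shift of order
  two; then the number of fixed blocks doubles together with the grid. The right number itself is
  created once, at two columns.\<close>

section \<open>Exact coverings of families of triples by blocks of size four\<close>

definition triples :: "'a set \<Rightarrow> 'a set set" where
  "triples X = {T. T \<subseteq> X \<and> card T = 3}"

text \<open>A family of triples takes the place of a point set, so that a system can be assembled
  from designs for the parts of a partition of its triples. Since all triples of a block have to
  belong to the family, such unions cover nothing twice.\<close>

definition quadruple_design :: "'a set set \<Rightarrow> 'a set set \<Rightarrow> bool" where
  "quadruple_design \<T> B \<longleftrightarrow>
     (\<forall>T\<in>\<T>. card T = 3) \<and>
     (\<forall>b\<in>B. card b = 4 \<and> triples b \<subseteq> \<T>) \<and>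
     (\<forall>T\<in>\<T>. \<exists>!b. b \<in> B \<and> T \<subseteq> b)"

abbreviation sqs :: "'a set \<Rightarrow> 'a set set \<Rightarrow> bool" where
  "sqs X \<equiv> quadruple_design (triples X)"

definition sqs_order :: "nat \<Rightarrow> bool" where
  "sqs_order n \<longleftrightarrow> (\<exists>B. sqs {..<n} B)"

lemma quadruple_designI:
  assumes "\<And>T. T \<in> \<T> \<Longrightarrow> card T = 3"
    and "\<And>b. b \<in> B \<Longrightarrow> card b = 4"
    and "\<And>b T. b \<in> B \<Longrightarrow> T \<subseteq> b \<Longrightarrow> card T = 3 \<Longrightarrow> T \<in> \<T>"
    and "\<And>T. T \<in> \<T> \<Longrightarrow> \<exists>b\<in>B. T \<subseteq> b"
    and "\<And>T b b'. T \<in> \<T> \<Longrightarrow> b \<in> B \<Longrightarrow> b' \<in> B \<Longrightarrow> T \<subseteq> b \<Longrightarrow> T \<subseteq> b' \<Longrightarrow> b = b'"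
  shows "quadruple_design \<T> B"
  unfolding quadruple_design_def triples_def
proof (intro conjI ballI)
  show "\<exists>!b. b \<in> B \<and> T \<subseteq> b" if "T \<in> \<T>" for T
    using assms(4)[OF that] assms(5)[OF that] by blast
qed (use assms(1-3) in auto)

lemma quadruple_designI':
  assumes "\<And>T. T \<in> \<T> \<Longrightarrow> card T = 3"
    and "\<And>b. b \<in> B \<Longrightarrow> card b = 4"
    and "\<And>b T. b \<in> B \<Longrightarrow> T \<subseteq> b \<Longrightarrow> card T = 3 \<Longrightarrow> T \<in> \<T>"
    and main: "\<And>T. T \<in> \<T> \<Longrightarrow> \<exists>b\<in>B. T \<subseteq> b \<and> (\<forall>b'\<in>B. T \<subseteq> b' \<longrightarrow> b' = b)"
  shows "quadruple_design \<T> B"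
proof (rule quadruple_designI)
  show "b = b'" if "T \<in> \<T>" "b \<in> B" "b' \<in> B" "T \<subseteq> b" "T \<subseteq> b'" for T b b'
    using main[OF that(1)] that(2-5) by metis
  show "\<exists>b\<in>B. T \<subseteq> b" if "T \<in> \<T>" for T using main[OF that] by blast
qed (use assms in auto)

lemma quadruple_designD:
  assumes "quadruple_design \<T> B"
  shows "T \<in> \<T> \<Longrightarrow> card T = 3"
    and "b \<in> B \<Longrightarrow> card b = 4"
    and "b \<in> B \<Longrightarrow> T \<subseteq> b \<Longrightarrow> card T = 3 \<Longrightarrow> T \<in> \<T>"
    and "T \<in> \<T> \<Longrightarrow> \<exists>b\<in>B. T \<subseteq> b"
    and "b \<in> B \<Longrightarrow> b' \<in> B \<Longrightarrow> T \<subseteq> b \<Longrightarrow> T \<subseteq> b' \<Longrightarrow> card T = 3 \<Longrightarrow> b = b'"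
proof -
  show "T \<in> \<T> \<Longrightarrow> card T = 3" "b \<in> B \<Longrightarrow> card b = 4"
    using assms by (auto simp: quadruple_design_def)
  show *: "b \<in> B \<Longrightarrow> T \<subseteq> b \<Longrightarrow> card T = 3 \<Longrightarrow> T \<in> \<T>" for b
    using assms by (auto simp: quadruple_design_def triples_def)
  show "T \<in> \<T> \<Longrightarrow> \<exists>b\<in>B. T \<subseteq> b"
    using assms unfolding quadruple_design_def by blast
  show "b \<in> B \<Longrightarrow> b' \<in> B \<Longrightarrow> T \<subseteq> b \<Longrightarrow> T \<subseteq> b' \<Longrightarrow> card T = 3 \<Longrightarrow> b = b'"
    using assms *[of b] unfolding quadruple_design_def by blast
qed

lemma card3_in_card4:
  assumes "card b = 4" "x \<in> b"
  obtains T where "T \<subseteq> b" "card T = 3" "x \<in> T"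
proof -
  have "finite b" using assms(1) card.infinite by fastforce
  then have "card (b - {x}) = 3" using assms by simp
  then obtain S where S: "S \<subseteq> b - {x}" "card S = 2"
    using obtain_subset_with_card_n[of 2 "b - {x}"] by auto
  have "finite S" using S(2) card.infinite by fastforce
  then have "card (insert x S) = 3" using S by (subst card_insert_disjoint) auto
  then show ?thesis using that[of "insert x S"] S assms by blast
qed

lemma sqs_block_subset:
  assumes "sqs X B" "b \<in> B"
  shows "b \<subseteq> X"
proof
  fix x assume "x \<in> b"
  then obtain T where "T \<subseteq> b" "card T = 3" "x \<in> T"
    using card3_in_card4 quadruple_designD(2)[OF assms] by metis
  then show "x \<in> X" using quadruple_designD(3)[OF assms] by (auto simp: triples_def)
qed

text \<open>A triple in a block of index \<open>i\<close> belongs to \<open>\<T> i\<close>. Hence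
  two blocks that share a triple have the same index, and uniqueness within that index
  applies.\<close>

lemma quadruple_design_UN:
  assumes "\<And>i. i \<in> I \<Longrightarrow> quadruple_design (\<T> i) (B i)"
    and "\<And>i j T. i \<in> I \<Longrightarrow> j \<in> I \<Longrightarrow> T \<in> \<T> i \<Longrightarrow> T \<in> \<T> j \<Longrightarrow> i = j"
  shows "quadruple_design (\<Union>i\<in>I. \<T> i) (\<Union>i\<in>I. B i)"
proof (rule quadruple_designI)
  show "card T = 3" if "T \<in> (\<Union>i\<in>I. \<T> i)" for T
    using that assms(1) quadruple_designD(1) by blast
  show "card b = 4" if "b \<in> (\<Union>i\<in>I. B i)" for b
    using that assms(1) quadruple_designD(2) by blast
  show "T \<in> (\<Union>i\<in>I. \<T> i)" if b: "b \<in> (\<Union>i\<in>I. B i)" "T \<subseteq> b" "card T = 3" for b T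
  proof -
    from b obtain i where i: "i \<in> I" "b \<in> B i" by blast
    then show ?thesis using quadruple_designD(3)[OF assms(1)[OF i(1)] i(2) b(2,3)] by blast
  qed
  show "\<exists>b\<in>(\<Union>i\<in>I. B i). T \<subseteq> b" if T: "T \<in> (\<Union>i\<in>I. \<T> i)" for T
  proof -
    from T obtain i where i: "i \<in> I" "T \<in> \<T> i" by blast
    then show ?thesis using quadruple_designD(4)[OF assms(1)[OF i(1)] i(2)] by blast
  qed
  show "b = b'" if T: "T \<in> (\<Union>i\<in>I. \<T> i)" and b: "b \<in> (\<Union>i\<in>I. B i)" "b' \<in> (\<Union>i\<in>I. B i)"
      "T \<subseteq> b" "T \<subseteq> b'" for T b b'
  proof -
    from b obtain i j where ij: "i \<in> I" "b \<in> B i" "j \<in> I" "b' \<in> B j" by blast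
    have c: "card T = 3" using T assms(1) quadruple_designD(1) by blast
    have "T \<in> \<T> i" "T \<in> \<T> j"
      using quadruple_designD(3)[OF assms(1)] ij b c by metis+
    then have "i = j" using assms(2) ij by blast
    then show ?thesis using quadruple_designD(5)[OF assms(1)] ij b c by metis
  qed
qed

lemma quadruple_design_Un:
  assumes "quadruple_design \<T>\<^sub>1 B\<^sub>1" "quadruple_design \<T>\<^sub>2 B\<^sub>2" "\<T>\<^sub>1 \<inter> \<T>\<^sub>2 = {}"
  shows "quadruple_design (\<T>\<^sub>1 \<union> \<T>\<^sub>2) (B\<^sub>1 \<union> B\<^sub>2)"
proof -
  have "quadruple_design (\<Union>i\<in>{True, False}. if i then \<T>\<^sub>1 else \<T>\<^sub>2) (\<Union>i\<in>{True, False}. if i then B\<^sub>1 else B\<^sub>2)"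
    using assms by (intro quadruple_design_UN) (auto split: if_splits)
  then show ?thesis by (simp add: Un_commute)
qed

lemma quadruple_design_image:
  assumes "quadruple_design \<T> B" "inj_on f X" "\<And>T. T \<in> \<T> \<Longrightarrow> T \<subseteq> X"
  shows "quadruple_design ((`) f ` \<T>) ((`) f ` B)"
proof -
  have bX: "b \<subseteq> X" if b: "b \<in> B" for b
  proof
    fix x assume "x \<in> b"
    then obtain T where "T \<subseteq> b" "card T = 3" "x \<in> T"
      using card3_in_card4 quadruple_designD(2)[OF assms(1) b] by metis
    then show "x \<in> X" using quadruple_designD(3)[OF assms(1) b] assms(3) by blast
  qed
  have cardf: "card (f ` S) = card S" if "S \<subseteq> X" for S
    using assms(2) that by (meson card_image inj_on_subset)
  have sub: "S \<subseteq> S'" if "f ` S \<subseteq> f ` S'" "S \<subseteq> X" "S' \<subseteq> X" for S S'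
    using that assms(2) by (auto simp: inj_on_def) blast
  show ?thesis
  proof (rule quadruple_designI)
    show "card T = 3" if "T \<in> (`) f ` \<T>" for T
      using that cardf assms(3) quadruple_designD(1)[OF assms(1)] by auto
    show "card b = 4" if "b \<in> (`) f ` B" for b
      using that cardf bX quadruple_designD(2)[OF assms(1)] by auto
    show "T \<in> (`) f ` \<T>" if b: "b \<in> (`) f ` B" and T: "T \<subseteq> b" "card T = 3" for b T
    proof -
      from b obtain b0 where b0: "b0 \<in> B" "b = f ` b0" by blast
      then obtain S where S: "S \<subseteq> b0" "T = f ` S" using T(1) by (auto simp: subset_image_iff)
      then have "card S = 3" using cardf[of S] bX[OF b0(1)] T(2) by auto
      then have "S \<in> \<T>" using quadruple_designD(3)[OF assms(1) b0(1) S(1)] by simp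
      then show ?thesis using S by blast
    qed
    show "\<exists>b\<in>(`) f ` B. T \<subseteq> b" if "T \<in> (`) f ` \<T>" for T
    proof -
      from that obtain S where "S \<in> \<T>" "T = f ` S" by blast
      then show ?thesis using quadruple_designD(4)[OF assms(1)] by (metis image_eqI image_mono)
    qed
    show "b = b'" if T: "T \<in> (`) f ` \<T>" and b: "b \<in> (`) f ` B" "b' \<in> (`) f ` B" "T \<subseteq> b" "T \<subseteq> b'"
      for T b b'
    proof -
      from T obtain S where S: "S \<in> \<T>" "T = f ` S" by blast
      from b obtain c c' where c: "c \<in> B" "b = f ` c" "c' \<in> B" "b' = f ` c'" by blast
      have "S \<subseteq> c" "S \<subseteq> c'" using sub bX c b S assms(3) by metis+
      then show ?thesis
        using quadruple_designD(5)[OF assms(1) c(1) c(3)] quadruple_designD(1)[OF assms(1) S(1)] c by metis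
    qed
  qed
qed

lemma triples_image: "inj_on f X \<Longrightarrow> triples (f ` X) = (`) f ` triples X"
  unfolding triples_def
  by (auto simp: subset_image_iff image_iff card_image inj_on_subset)

lemma sqs_image: "sqs X B \<Longrightarrow> inj_on f X \<Longrightarrow> sqs (f ` X) ((`) f ` B)"
  by (subst triples_image) (auto intro: quadruple_design_image simp: triples_def)

lemma sqs_order_iff:
  assumes "finite X"
  shows "sqs_order (card X) \<longleftrightarrow> (\<exists>B. sqs X B)"
proof
  assume "sqs_order (card X)"
  then obtain B where B: "sqs {..<card X} B" by (auto simp: sqs_order_def)
  obtain f where f: "bij_betw f {..<card X} X"
    using ex_bij_betw_nat_finite[OF assms] by (auto simp: atLeast0LessThan)
  then show "\<exists>B. sqs X B"
    using sqs_image[OF B, of f] by (auto simp: bij_betw_def)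
next
  assume "\<exists>B. sqs X B"
  then obtain B where B: "sqs X B" by blast
  obtain f where f: "bij_betw f X {..<card X}"
    using ex_bij_betw_finite_nat[OF assms] by (auto simp: atLeast0LessThan)
  then show "sqs_order (card X)"
    using sqs_image[OF B, of f] by (auto simp: bij_betw_def sqs_order_def)
qed

lemma sqs_order_imp_sqs: "sqs_order n \<Longrightarrow> finite X \<Longrightarrow> card X = n \<Longrightarrow> \<exists>B. sqs X B"
  using sqs_order_iff by blast

lemma sqs_imp_sqs_order: "sqs X B \<Longrightarrow> finite X \<Longrightarrow> card X = n \<Longrightarrow> sqs_order n"
  using sqs_order_iff by blast

lemma sqs_order_le_2:
  assumes "n \<le> 2"
  shows "sqs_order n"
proof -
  have "card T \<noteq> 3" if "T \<subseteq> {..<n}" for T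
    using card_mono[OF _ that] assms by simp
  then have "triples {..<n} = {}" by (auto simp: triples_def)
  then have "sqs {..<n} {}" by (simp add: quadruple_design_def)
  then show ?thesis unfolding sqs_order_def by blast
qed

lemma sqs_single: "card X = 4 \<Longrightarrow> sqs X {X}"
  by (auto simp: quadruple_design_def triples_def)

lemma sqs_order_4: "sqs_order 4"
  using sqs_single[of "{..<4::nat}"] by (auto simp: sqs_order_def)

text \<open>Fixing the sum of the second coordinates makes three of them determine the fourth.\<close>

lemma transversal_design:
  fixes g :: int
  assumes b: "card b = 4" and g: "g > 0"
  shows "quadruple_design {T. T \<subseteq> b \<times> {0..<g} \<and> card T = 3 \<and> card (fst ` T) = 3}
     {c. c \<subseteq> b \<times> {0..<g} \<and> card c = 4 \<and> card (fst ` c) = 4 \<and> g dvd (\<Sum>p\<in>c. snd p)}"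
    (is "quadruple_design ?T ?B")
proof (rule quadruple_designI)
  have finb: "finite b" using b card.infinite by fastforce
  show "T \<in> ?T" if c: "c \<in> ?B" and T: "T \<subseteq> c" "card T = 3" for c T
  proof -
    have "finite c" using c card.infinite by fastforce
    then have "inj_on fst c" using c by (intro eq_card_imp_inj_on) auto
    then have "card (fst ` T) = 3" using T by (metis card_image inj_on_subset)
    then show ?thesis using c T by auto
  qed
  have ext: "\<exists>R\<in>b. b = insert R (fst ` T) \<and> R \<notin> fst ` T" if "T \<in> ?T" for T
  proof -
    have "fst ` T \<subseteq> b" "card (fst ` T) = 3" using that by auto
    then have "card (b - fst ` T) = 1" using finb b by (simp add: card_Diff_subset finite_subset)
    then obtain R where "b - fst ` T = {R}" using card_1_singletonE by blast
    then show ?thesis using \<open>fst ` T \<subseteq> b\<close> by blast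
  qed
  have finT: "finite T" if "T \<in> ?T" for T using that card.infinite by fastforce
  show "\<exists>c\<in>?B. T \<subseteq> c" if T: "T \<in> ?T" for T
  proof -
    obtain R where R: "R \<in> b" "b = insert R (fst ` T)" "R \<notin> fst ` T" using ext[OF T] by blast
    define y where "y = (- (\<Sum>p\<in>T. snd p)) mod g"
    have nin: "(R, y) \<notin> T" using R by force
    let ?c = "insert (R, y) T"
    have "y \<in> {0..<g}" using g by (auto simp: y_def)
    then have "?c \<subseteq> b \<times> {0..<g}" using R T by auto
    moreover have "card ?c = 4" using nin T finT[OF T] by simp
    moreover have "card (fst ` ?c) = 4" using R b by simp
    moreover have "g dvd (\<Sum>p\<in>?c. snd p)"
      using nin finT[OF T] by (simp add: y_def mod_0_imp_dvd mod_simps)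
    ultimately show ?thesis by (intro bexI[of _ ?c]) auto
  qed
  show "c = c'" if T: "T \<in> ?T" and c: "c \<in> ?B" "c' \<in> ?B" "T \<subseteq> c" "T \<subseteq> c'" for T c c'
  proof -
    obtain R where R: "R \<in> b" "b = insert R (fst ` T)" "R \<notin> fst ` T" using ext[OF T] by blast
    have *: "\<exists>y. 0 \<le> y \<and> y < g \<and> d = insert (R, y) T \<and> g dvd y + (\<Sum>p\<in>T. snd p)"
      if d: "d \<in> ?B" "T \<subseteq> d" for d
    proof -
      have "finite d" using d card.infinite by fastforce
      then have "inj_on fst d" using d by (intro eq_card_imp_inj_on) auto
      have "card (d - T) = 1" using d T finT[OF T] by (simp add: card_Diff_subset)
      then obtain p where p: "d - T = {p}" using card_1_singletonE by blast
      then have dp: "d = insert p T" "p \<notin> T" using d(2) by auto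
      have "fst p \<notin> fst ` T"
        using \<open>inj_on fst d\<close> dp by (auto simp: inj_on_def)
      moreover have "fst p \<in> b" using d dp by auto
      ultimately have "fst p = R" using R(2) by blast
      moreover have "snd p \<in> {0..<g}" using d dp by auto
      moreover have "g dvd snd p + (\<Sum>p\<in>T. snd p)" using d dp finT[OF T] by simp
      ultimately show ?thesis using dp by (intro exI[of _ "snd p"]) auto
    qed
    obtain y y' where y: "0 \<le> y" "y < g" "c = insert (R, y) T" "g dvd y + (\<Sum>p\<in>T. snd p)"
      "0 \<le> y'" "y' < g" "c' = insert (R, y') T" "g dvd y' + (\<Sum>p\<in>T. snd p)"
      using *[OF c(1,3)] *[OF c(2,4)] by blast
    have "g dvd y - y'" using dvd_diff[OF y(4) y(8)] by simp
    then have "y mod g = y' mod g" by (simp add: mod_eq_dvd_iff)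
    then show ?thesis using y by simp
  qed
qed auto

section \<open>Weighting: points of a system become groups, one of them the stem\<close>

text \<open>The group over \<alpha> has a size of its own because it is the stem, which is shared by
  the fillings of all other groups.\<close>

definition weighted :: "'p set \<Rightarrow> 'p \<Rightarrow> int \<Rightarrow> int \<Rightarrow> ('p \<times> int) set" where
  "weighted Z \<alpha> g k = (Z - {\<alpha>}) \<times> {0..<g} \<union> {\<alpha>} \<times> {0..<k}"

text \<open>The triples that are left out are those inside one group together with the stem; they
  are covered by filling each group with a smaller design.\<close>

definition cross_triples :: "'p \<Rightarrow> ('p \<times> int) set \<Rightarrow> ('p \<times> int) set set" where
  "cross_triples \<alpha> X = {T \<in> triples X. card (fst ` T - {\<alpha>}) \<ge> 2}"

lemma finite_weighted: "finite Z \<Longrightarrow> finite (weighted Z \<alpha> g k)"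
  by (simp add: weighted_def)

lemma card_weighted:
  assumes "finite Z" "\<alpha> \<in> Z" "g \<ge> 0" "k \<ge> 0"
  shows "int (card (weighted Z \<alpha> g k)) = (int (card Z) - 1) * g + k"
proof -
  have "card Z > 0" using assms by (auto simp: card_gt_0_iff)
  then have "card (weighted Z \<alpha> g k) = (card Z - 1) * nat g + nat k"
    unfolding weighted_def using assms
    by (subst card_Un_disjoint) (auto simp: card_cartesian_product)
  then show ?thesis using assms \<open>card Z > 0\<close> by (simp add: of_nat_diff)
qed

lemma triples_card3: "T \<in> triples X \<Longrightarrow> finite T \<and> card T = 3"
  by (auto simp: triples_def intro: card_ge_0_finite)

lemma cross_triples_image:
  assumes "inj_on h Z" "\<alpha> \<in> Z" "fst ` X \<subseteq> Z"
  shows "cross_triples (h \<alpha>) (map_prod h id ` X) = (`) (map_prod h id) ` cross_triples \<alpha> X"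
proof -
  have inj: "inj_on (map_prod h id) X"
    by (rule inj_on_subset[OF map_prod_inj_on[OF assms(1) inj_on_id[of UNIV]]]) (use assms(3) in force)
  have "card (fst ` (map_prod h id ` T) - {h \<alpha>}) = card (fst ` T - {\<alpha>})" if "T \<subseteq> X" for T
  proof -
    have "fst ` T \<subseteq> Z" using that assms(3) by blast
    have "fst ` (map_prod h id ` T) - {h \<alpha>} = h ` (fst ` T - {\<alpha>})"
      using \<open>fst ` T \<subseteq> Z\<close> assms(1,2) by (force simp: inj_on_def image_iff)
    then show ?thesis
      using \<open>fst ` T \<subseteq> Z\<close> assms(1) by (metis card_image inj_on_subset Diff_subset subset_trans)
  qed
  then have eq: "card (fst ` (map_prod h id ` T) - {h \<alpha>}) = card (fst ` T - {\<alpha>})" if "T \<in> triples X" for T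
    using that by (auto simp: triples_def)
  show ?thesis
    unfolding cross_triples_def triples_image[OF inj] by (auto simp del: image_image simp: eq)
qed

lemma map_prod_weighted:
  assumes "inj_on h Z" "\<alpha> \<in> Z"
  shows "map_prod h id ` weighted Z \<alpha> g k = weighted (h ` Z) (h \<alpha>) g k"
proof -
  have "h ` Z - {h \<alpha>} = h ` (Z - {\<alpha>})" using assms by (auto simp: inj_on_def)
  then show ?thesis
    unfolding weighted_def by (auto simp: image_Un map_prod_surj_on image_iff)
qed

lemma fst_weighted: "\<alpha> \<in> Z \<Longrightarrow> fst ` weighted Z \<alpha> g k \<subseteq> Z"
  by (auto simp: weighted_def)

text \<open>Assigns a cross triple to a single block of the base system. A triple with two points in
  one group and one in another has only two base points, and \<alpha> is taken as the third.\<close>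

definition base_triple :: "'p \<Rightarrow> ('p \<times> int) set \<Rightarrow> 'p set" where
  "base_triple \<alpha> T = (if card (fst ` T) = 3 then fst ` T else insert \<alpha> (fst ` T))"

text \<open>If the triple meets only two groups, neither of them is the stem, because two groups
  remain after \<alpha> is discarded. Inserting \<alpha> therefore adds a point.\<close>

lemma card_base_triple:
  assumes "T \<in> cross_triples \<alpha> X"
  shows "card (base_triple \<alpha> T) = 3"
proof -
  have T: "finite T" "card T = 3" "card (fst ` T - {\<alpha>}) \<ge> 2"
    using assms triples_card3 by (auto simp: cross_triples_def)
  then have le: "card (fst ` T) \<le> 3" using card_image_le[of T fst] by simp
  show ?thesis
  proof (cases "card (fst ` T) = 3")
    case False
    then have "card (fst ` T) \<le> 2" using le by simp
    moreover have "\<alpha> \<notin> fst ` T"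
    proof
      assume "\<alpha> \<in> fst ` T"
      then have "card (fst ` T - {\<alpha>}) = card (fst ` T) - 1" using T by simp
      then show False using T calculation by simp
    qed
    ultimately show ?thesis using T False by (simp add: base_triple_def)
  qed (simp add: base_triple_def)
qed

lemma ex_bij_betw_block:
  assumes "card b = 4" "\<alpha> \<in> b"
  obtains h :: "int \<Rightarrow> 'a" where "bij_betw h {0..<4} b" "h 3 = \<alpha>"
proof -
  have "finite b" using assms(1) card.infinite by fastforce
  then have "card (b - {\<alpha>}) = card {0..<3::int}" using assms by simp
  then obtain h where h: "bij_betw h {0..<3::int} (b - {\<alpha>})"
    using finite_same_card_bij \<open>finite b\<close> by (metis finite_Diff finite_atLeastLessThan_int)
  have "bij_betw (h(3 := \<alpha>)) (insert 3 {0..<3}) (insert \<alpha> (b - {\<alpha>}))"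
    by (rule bij_betw_combine[where A="{3}" and B="{\<alpha>}", simplified, rotated])
       (use h in \<open>auto simp: bij_betw_def inj_on_def\<close>)
  moreover have "insert 3 {0..<3} = {0..<4::int}" by auto
  moreover have "insert \<alpha> (b - {\<alpha>}) = b" using assms by auto
  ultimately show ?thesis using that[of "h(3 := \<alpha>)"] by simp
qed

text \<open>One explicit design over four labels serves all blocks through \<alpha>. Only the label
  3 has to be sent to \<alpha>, as the cross condition treats the other three groups alike.\<close>

lemma design_on_block:
  assumes D: "quadruple_design (cross_triples (3::int) (weighted {0..<4} 3 g k)) D"
    and b: "card b = 4" "\<alpha> \<in> b"
  shows "\<exists>B. quadruple_design (cross_triples \<alpha> (weighted b \<alpha> g k)) B"
proof -
  obtain h :: "int \<Rightarrow> 'a" where h: "bij_betw h {0..<4} b" "h 3 = \<alpha>"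
    using ex_bij_betw_block[OF b] by blast
  have inj: "inj_on h {0..<4}" and im: "h ` {0..<4} = b" using h by (auto simp: bij_betw_def)
  have "quadruple_design ((`) (map_prod h id) ` cross_triples 3 (weighted {0..<4} 3 g k)) ((`) (map_prod h id) ` D)"
    using D
  proof (rule quadruple_design_image)
    show "inj_on (map_prod h id) (weighted {0..<4} 3 g k)"
      by (rule inj_on_subset[OF map_prod_inj_on[OF inj inj_on_id[of UNIV]]]) (auto simp: weighted_def)
  qed (auto simp: cross_triples_def triples_def)
  moreover have "(`) (map_prod h id) ` cross_triples 3 (weighted {0..<4} 3 g k) = cross_triples \<alpha> (weighted b \<alpha> g k)"
    using cross_triples_image[OF inj, of 3 "weighted {0..<4} 3 g k"] map_prod_weighted[OF inj, of 3]
      fst_weighted[of "3::int" "{0..<4}" g k] im h(2) by simp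
  ultimately show ?thesis by auto
qed

lemma triples_subset: "T \<in> triples X \<Longrightarrow> T \<subseteq> X"
  by (simp add: triples_def)

text \<open>At most two points contain no triple, so the hole removes nothing and every system of
  order \<open>g + k\<close> serves.\<close>

lemma holed_le_2:
  assumes "sqs_order (nat (g + k))" "0 \<le> g" "0 \<le> k" "k \<le> 2"
  shows "\<exists>B. quadruple_design (triples (weighted {0, 1::nat} 0 g k) - triples ({0} \<times> {0..<k})) B"
proof -
  have "card T \<noteq> 3" if "T \<subseteq> {0::nat} \<times> {0..<k}" for T
    using card_mono[OF _ that] assms by (auto simp: card_cartesian_product)
  then have "triples ({0::nat} \<times> {0..<k}) = {}" by (auto simp: triples_def)
  moreover have "card (weighted {0, 1::nat} 0 g k) = nat (g + k)"
    using card_weighted[of "{0, 1::nat}" 0 g k] assms by simp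
  ultimately show ?thesis
    using sqs_order_imp_sqs[OF assms(1) finite_weighted[of "{0, 1::nat}" 0 g k]] by simp
qed

text \<open>Some block of a system of order \<open>g + 4\<close> is carried onto the stem and then
  deleted. This frees precisely the triples inside the stem, because distinct blocks share no
  triple.\<close>

lemma holed_4:
  assumes S: "sqs_order (nat (g + 4))" and g: "0 < g"
  shows "\<exists>B. quadruple_design (triples (weighted {0, 1::nat} 0 g 4) - triples ({0} \<times> {0..<4})) B"
proof -
  let ?W = "weighted {0, 1::nat} 0 g 4" and ?I = "{0::nat} \<times> {0..<4::int}"
  define n where "n = nat (g + 4)"
  obtain B where B: "sqs {..<n} B" using S by (auto simp: sqs_order_def n_def)
  have "{0, 1, 2} \<in> triples {..<n}" using g by (auto simp: triples_def n_def)
  then obtain b where b: "b \<in> B" using quadruple_designD(4)[OF B] by blast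
  have b4: "card b = 4" "b \<subseteq> {..<n}" using quadruple_designD(2)[OF B b] sqs_block_subset[OF B b] by auto
  have cW: "card ?W = n" using card_weighted[of "{0, 1::nat}" 0 g 4] g by (simp add: n_def)
  have finW: "finite ?W" by (simp add: finite_weighted)
  have IW: "?I \<subseteq> ?W" by (auto simp: weighted_def)
  have finb: "finite b" using b4(2) finite_subset by blast
  obtain f where f: "bij_betw f b ?I"
    using finite_same_card_bij[OF finb, of ?I] b4 by (auto simp: card_cartesian_product)
  have "card ({..<n} - b) = card (?W - ?I)"
    using b4 IW finW cW by (simp add: card_Diff_subset finb finite_subset card_cartesian_product)
  then obtain f' where f': "bij_betw f' ({..<n} - b) (?W - ?I)"
    using finite_same_card_bij finW by (metis finite_Diff finite_lessThan)
  define h where "h x = (if x \<in> b then f x else f' x)" for x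
  have "bij_betw h b ?I" using f by (rule bij_betw_cong[THEN iffD1, rotated]) (simp add: h_def)
  moreover have "bij_betw h ({..<n} - b) (?W - ?I)"
    using f' by (rule bij_betw_cong[THEN iffD1, rotated]) (simp add: h_def)
  ultimately have "bij_betw h (b \<union> ({..<n} - b)) (?I \<union> (?W - ?I))" by (rule bij_betw_combine) auto
  moreover have "b \<union> ({..<n} - b) = {..<n}" "?I \<union> (?W - ?I) = ?W" using b4 IW by auto
  ultimately have h: "bij_betw h {..<n} ?W" by simp
  have hb: "h ` b = ?I" using \<open>bij_betw h b ?I\<close> by (simp add: bij_betw_def)
  have S': "sqs ?W ((`) h ` B)" using sqs_image[OF B, of h] h by (simp add: bij_betw_def)
  have Ib: "?I \<in> (`) h ` B" using b hb by (metis imageI)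
  have "quadruple_design (triples ?W - triples ?I) ((`) h ` B - {?I})"
  proof (rule quadruple_designI)
    show "T \<in> triples ?W - triples ?I" if "c \<in> (`) h ` B - {?I}" "T \<subseteq> c" "card T = 3" for c T
      using quadruple_designD(3)[OF S', of c T] quadruple_designD(5)[OF S' _ Ib, of c T] that
      by (auto simp: triples_def)
    show "\<exists>c\<in>(`) h ` B - {?I}. T \<subseteq> c" if T: "T \<in> triples ?W - triples ?I" for T
    proof -
      obtain c where "c \<in> (`) h ` B" "T \<subseteq> c" using quadruple_designD(4)[OF S', of T] T by blast
      moreover have "c \<noteq> ?I" using T \<open>T \<subseteq> c\<close> by (auto simp: triples_def)
      ultimately show ?thesis by blast
    qed
    show "c = c'" if "T \<in> triples ?W - triples ?I" "c \<in> (`) h ` B - {?I}" "c' \<in> (`) h ` B - {?I}"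
      "T \<subseteq> c" "T \<subseteq> c'" for T c c'
      using quadruple_designD(5)[OF S', of c c' T] that by (auto simp: triples_def)
  qed (use quadruple_designD(2)[OF S'] in \<open>auto simp: triples_def\<close>)
  then show ?thesis by blast
qed

text \<open>The triples split into cross triples, triples inside the stem, and triples inside a
  group with the stem that are not inside the stem. The cross triples are split further by the base
  block that contains \<open>base_triple\<close>: a block through \<alpha> receives a copy of
  \<open>D\<close>, every other block a transversal design.\<close>

theorem sqs_order_weighting:
  assumes Z: "sqs_order n" and n: "n > 0"
    and D: "quadruple_design (cross_triples (3::int) (weighted {0..<4} 3 g k)) D"
    and gk: "g > 0" "0 \<le> k"
    and F: "\<exists>B. quadruple_design (triples (weighted {0, 1::nat} 0 g k) - triples ({0} \<times> {0..<k})) B"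
    and H: "sqs_order (nat k)"
  shows "sqs_order (nat ((int n - 1) * g + k))"
proof -
  obtain \<BB> where BB: "sqs {..<n} \<BB>" using Z by (auto simp: sqs_order_def)
  define \<alpha> :: nat where "\<alpha> = 0"
  have \<alpha>: "\<alpha> \<in> {..<n}" using n by (simp add: \<alpha>_def)
  define X where "X = weighted {..<n} \<alpha> g k"
  have fX: "fst ` X \<subseteq> {..<n}" unfolding X_def by (rule fst_weighted[OF \<alpha>])
  have bb: "card b = 4" "b \<subseteq> {..<n}" if "b \<in> \<BB>" for b
    using quadruple_designD(2)[OF BB that] sqs_block_subset[OF BB that] by auto
  define \<T> where "\<T> = (\<lambda>b. {T \<in> cross_triples \<alpha> X. base_triple \<alpha> T \<subseteq> b})"
  have base_triple_Z: "base_triple \<alpha> T \<in> triples {..<n}" if "T \<in> cross_triples \<alpha> X" for T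
    using card_base_triple[OF that] that fX \<alpha>
    by (fastforce simp: triples_def base_triple_def cross_triples_def)
  have "\<exists>B. quadruple_design (\<T> b) B" if b: "b \<in> \<BB>" for b
  proof (cases "\<alpha> \<in> b")
    case True
    have h1: "base_triple \<alpha> T \<subseteq> b \<longleftrightarrow> fst ` T \<subseteq> b" for T using True by (auto simp: base_triple_def)
    have h2: "T \<subseteq> X \<and> fst ` T \<subseteq> b \<longleftrightarrow> T \<subseteq> weighted b \<alpha> g k" for T
      using True bb(2)[OF b] \<alpha> by (fastforce simp: X_def weighted_def)
    have "\<T> b = cross_triples \<alpha> (weighted b \<alpha> g k)"
      by (intro set_eqI) (simp add: \<T>_def cross_triples_def triples_def h1 flip: h2, argo)
    then show ?thesis using design_on_block[OF D bb(1)[OF b] True] by simp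
  next
    case False
    \<comment> \<open>A base block without \<alpha> collects only triples over three base points,
      since otherwise \<open>base_triple\<close> would contain \<alpha>.\<close>
    have "\<T> b = {T. T \<subseteq> b \<times> {0..<g} \<and> card T = 3 \<and> card (fst ` T) = 3}" (is "_ = ?R")
    proof (intro set_eqI iffI)
      fix T assume T: "T \<in> \<T> b"
      then have "card (fst ` T) = 3" "fst ` T \<subseteq> b" "T \<subseteq> X" "card T = 3"
        using False by (auto simp: \<T>_def base_triple_def cross_triples_def triples_def split: if_splits)
      moreover have "T \<subseteq> b \<times> {0..<g}"
      proof
        fix p assume "p \<in> T"
        then have "p \<in> X" "fst p \<in> b" using calculation by auto
        then show "p \<in> b \<times> {0..<g}" using False by (auto simp: X_def weighted_def)
      qed
      ultimately show "T \<in> ?R" by simp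
    next
      fix T assume T: "T \<in> ?R"
      then have "fst ` T \<subseteq> b" by auto
      then have "fst ` T - {\<alpha>} = fst ` T" using False by auto
      moreover have "T \<subseteq> X" using T bb(2)[OF b] False by (force simp: X_def weighted_def)
      ultimately show "T \<in> \<T> b"
        using T \<open>fst ` T \<subseteq> b\<close> by (simp add: \<T>_def base_triple_def cross_triples_def triples_def)
    qed
    then show ?thesis using transversal_design[OF bb(1)[OF b] gk(1)] by auto
  qed
  then obtain B where B: "\<And>b. b \<in> \<BB> \<Longrightarrow> quadruple_design (\<T> b) (B b)" by metis
  have "quadruple_design (\<Union>b\<in>\<BB>. \<T> b) (\<Union>b\<in>\<BB>. B b)"
  proof (rule quadruple_design_UN[OF B])
    fix b b' T assume "b \<in> \<BB>" "b' \<in> \<BB>" "T \<in> \<T> b" "T \<in> \<T> b'"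
    then show "b = b'"
      using quadruple_designD(5)[OF BB, of b b' "base_triple \<alpha> T"] card_base_triple[of T \<alpha> X] by (auto simp: \<T>_def)
  qed
  moreover have "(\<Union>b\<in>\<BB>. \<T> b) = cross_triples \<alpha> X"
    using quadruple_designD(4)[OF BB base_triple_Z] by (fastforce simp: \<T>_def)
  ultimately have cross: "\<exists>B. quadruple_design (cross_triples \<alpha> X) B" by metis
  define Y where "Y = (\<lambda>P. weighted {\<alpha>, P} \<alpha> g k)"
  define I where "I = {\<alpha>} \<times> {0..<k}"
  have "\<exists>B. quadruple_design (triples (Y P) - triples I) B" if P: "P \<in> {..<n} - {\<alpha>}" for P
  proof -
    define h where "h = (\<lambda>i::nat. if i = 0 then \<alpha> else P)"
    obtain E where E: "quadruple_design (triples (weighted {0, 1::nat} 0 g k) - triples ({0} \<times> {0..<k})) E"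
      using F by blast
    let ?W = "weighted {0, 1::nat} 0 g k" and ?f = "map_prod h id :: nat \<times> int \<Rightarrow> nat \<times> int"
    have inj: "inj_on h {0, 1}" using P by (auto simp: h_def)
    have injf: "inj_on ?f ?W"
      by (rule inj_on_subset[OF map_prod_inj_on[OF inj inj_on_id[of UNIV]]]) (auto simp: weighted_def)
    have "h ` {0, 1} = {\<alpha>, P}" "h 0 = \<alpha>" by (auto simp: h_def)
    then have im: "?f ` ?W = Y P" using map_prod_weighted[OF inj, of 0] by (simp add: Y_def)
    have sub: "{0} \<times> {0..<k} \<subseteq> ?W" by (auto simp: weighted_def)
    have imI: "?f ` ({0} \<times> {0..<k}) = I" by (auto simp: I_def h_def map_prod_def image_iff)
    have "inj_on ((`) ?f) (Pow ?W)" using injf by (rule inj_on_image_Pow)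
    then have "(`) ?f ` (triples ?W - triples ({0} \<times> {0..<k})) =
        (`) ?f ` triples ?W - (`) ?f ` triples ({0} \<times> {0..<k})"
      by (rule inj_on_image_set_diff) (use sub in \<open>auto simp: triples_def\<close>)
    also have "\<dots> = triples (Y P) - triples I"
      using triples_image[OF injf] triples_image[OF inj_on_subset[OF injf sub]] im imI by simp
    finally show ?thesis
      using quadruple_design_image[OF E injf] by (metis DiffD1 triples_subset)
  qed
  then obtain E where E: "\<And>P. P \<in> {..<n} - {\<alpha>} \<Longrightarrow> quadruple_design (triples (Y P) - triples I) (E P)" by metis
  have IY: "I \<subseteq> Y P" for P by (auto simp: I_def Y_def weighted_def)
  have IX: "I \<subseteq> X" by (auto simp: I_def X_def weighted_def)
  have "quadruple_design (\<Union>P\<in>{..<n} - {\<alpha>}. triples (Y P) - triples I) (\<Union>P\<in>{..<n} - {\<alpha>}. E P)"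
  proof (rule quadruple_design_UN[OF E])
    fix P Q T assume PQ: "P \<in> {..<n} - {\<alpha>}" "Q \<in> {..<n} - {\<alpha>}" "T \<in> triples (Y P) - triples I" "T \<in> triples (Y Q) - triples I"
    show "P = Q"
    proof (rule ccontr)
      assume "P \<noteq> Q"
      then have "Y P \<inter> Y Q \<subseteq> I" using PQ(1,2) by (auto simp: Y_def I_def weighted_def)
      then have "T \<subseteq> I" using PQ(3,4) by (auto simp: triples_def)
      then show False using PQ(3) by (auto simp: triples_def)
    qed
  qed
  moreover obtain E0 where "sqs I E0"
    using sqs_order_imp_sqs[OF H, of I] gk by (auto simp: I_def card_cartesian_product)
  ultimately have "\<exists>E'. quadruple_design (triples I \<union> (\<Union>P\<in>{..<n} - {\<alpha>}. triples (Y P) - triples I)) E'"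
    using quadruple_design_Un[of "triples I" E0] by blast
  moreover have "triples I \<union> (\<Union>P\<in>{..<n} - {\<alpha>}. triples (Y P) - triples I) = triples X - cross_triples \<alpha> X"
  proof (intro set_eqI iffI)
    fix T assume T: "T \<in> triples I \<union> (\<Union>P\<in>{..<n} - {\<alpha>}. triples (Y P) - triples I)"
    obtain P where P: "P = \<alpha> \<or> P \<in> {..<n}" "T \<in> triples (Y P)"
      using T IY[of \<alpha>] by (auto simp: triples_def)
    have "Y P \<subseteq> X" using P(1) \<alpha> by (auto simp: X_def Y_def weighted_def)
    moreover have "card (fst ` T - {\<alpha>}) \<le> 1"
    proof -
      have "fst ` T - {\<alpha>} \<subseteq> {P}" using P(2) by (auto simp: triples_def Y_def weighted_def)
      then show ?thesis using card_mono[of "{P}"] by fastforce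
    qed
    ultimately show "T \<in> triples X - cross_triples \<alpha> X"
      using P(2) by (auto simp: triples_def cross_triples_def)
  next
    fix T assume T: "T \<in> triples X - cross_triples \<alpha> X"
    then have TX: "T \<in> triples X" by blast
    then have T': "T \<subseteq> X" "card T = 3" by (simp_all add: triples_def)
    have fin: "finite T" using triples_card3[OF TX] by simp
    have T'': "card (fst ` T - {\<alpha>}) \<le> 1" using T TX by (simp add: cross_triples_def not_le)
    show "T \<in> triples I \<union> (\<Union>P\<in>{..<n} - {\<alpha>}. triples (Y P) - triples I)"
    proof (cases "T \<subseteq> I")
      case False
      then obtain p where p: "p \<in> T" "p \<notin> I" by blast
      then have pa: "fst p \<noteq> \<alpha>" "fst p \<in> {..<n}" using T'(1) \<alpha> by (auto simp: I_def X_def weighted_def)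
      then have "fst p \<in> fst ` T - {\<alpha>}" using p by auto
      then have "fst ` T - {\<alpha>} = {fst p}"
        using T'' fin card_le_Suc0_iff_eq[of "fst ` T - {\<alpha>}"] by (intro set_eqI) (auto simp del: Diff_iff)
      then have fT: "fst x = \<alpha> \<or> fst x = fst p" if "x \<in> T" for x using that by auto
      have "T \<subseteq> Y (fst p)"
      proof
        fix x assume "x \<in> T"
        then have "x \<in> X" "fst x = \<alpha> \<or> fst x = fst p" using T'(1) fT by auto
        then show "x \<in> Y (fst p)" by (cases x) (auto simp: X_def Y_def weighted_def)
      qed
      then have "T \<in> triples (Y (fst p)) - triples I" using T'(2) False by (simp add: triples_def)
      then show ?thesis using pa by blast
    qed (use T'(2) in \<open>simp add: triples_def\<close>)
  qed
  ultimately obtain E' where "quadruple_design (triples X - cross_triples \<alpha> X) E'" by metis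
  with cross obtain B' where "quadruple_design (cross_triples \<alpha> X \<union> (triples X - cross_triples \<alpha> X)) B'"
    using quadruple_design_Un by (metis Diff_disjoint)
  moreover have "cross_triples \<alpha> X \<union> (triples X - cross_triples \<alpha> X) = triples X"
    by (auto simp: cross_triples_def)
  ultimately have "sqs X B'" by simp
  moreover have "card X = nat ((int n - 1) * g + k)"
    using card_weighted[of "{..<n}" \<alpha> g k] \<alpha> gk by (simp add: X_def)
  ultimately show ?thesis
    using sqs_imp_sqs_order finite_weighted[of "{..<n}"] by (metis X_def finite_lessThan)
qed

section \<open>Certificates: checking explicit lists of blocks by evaluation\<close>

fun strictly_increasing :: "int list \<Rightarrow> bool" where
  "strictly_increasing (x # y # zs) \<longleftrightarrow> x < y \<and> strictly_increasing (y # zs)"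
| "strictly_increasing _ \<longleftrightarrow> True"

lemma strictly_increasing_distinct: "strictly_increasing xs \<Longrightarrow> distinct xs"
proof -
  have "strictly_increasing xs \<Longrightarrow> sorted_wrt (<) xs"
    by (induction xs rule: strictly_increasing.induct) (auto simp: sorted_wrt2)
  then show "strictly_increasing xs \<Longrightarrow> distinct xs"
    by (simp add: strict_sorted_iff)
qed

fun merge :: "int list \<Rightarrow> int list \<Rightarrow> int list" where
  "merge [] ys = ys"
| "merge xs [] = xs"
| "merge (x # xs) (y # ys) = (if x \<le> y then x # merge xs (y # ys) else y # merge (x # xs) ys)"

fun merge_pairs :: "int list list \<Rightarrow> int list list" where
  "merge_pairs (xs # ys # zss) = merge xs ys # merge_pairs zss"
| "merge_pairs zss = zss"

lemma length_merge_pairs: "length (merge_pairs zss) \<le> length zss"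
  by (induction zss rule: merge_pairs.induct) auto

function merge_all :: "int list list \<Rightarrow> int list" where
  "merge_all [] = []"
| "merge_all [xs] = xs"
| "merge_all (xs # ys # zss) = merge_all (merge_pairs (xs # ys # zss))"
  by pat_completeness auto
termination
  by (relation "measure length") (auto simp: le_imp_less_Suc length_merge_pairs)

text \<open>Soundness rests on \<open>set_merge_sort\<close> alone; the order of the output is
  tested during evaluation by \<open>strictly_increasing\<close>.\<close>

definition merge_sort :: "int list \<Rightarrow> int list" where
  "merge_sort xs = merge_all (map (\<lambda>x. [x]) xs)"

lemma set_merge: "set (merge xs ys) = set xs \<union> set ys"
  by (induction xs ys rule: merge.induct) auto

lemma set_merge_pairs: "(\<Union>xs\<in>set (merge_pairs zss). set xs) = (\<Union>xs\<in>set zss. set xs)"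
  by (induction zss rule: merge_pairs.induct) (auto simp: set_merge)

lemma set_merge_sort: "set (merge_sort xs) = set xs"
proof -
  have "set (merge_all zss) = (\<Union>xs\<in>set zss. set xs)" for zss
  proof (induction zss rule: merge_all.induct)
    case (3 xs ys zss)
    then show ?case using set_merge_pairs[of "xs # ys # zss"] by simp
  qed auto
  then show ?thesis by (auto simp: merge_sort_def)
qed

text \<open>The quotient by \<open>N\<close> is the key of a triple. Strictly increasing keys give
  injectivity, and equality with the sorted targets says that exactly the wanted triples occur.
  \<open>remdups_adj\<close> tolerates repeated codes, which arise from base blocks with a
  nontrivial stabilizer.\<close>

definition codes_check :: "int \<Rightarrow> int list \<Rightarrow> int list \<Rightarrow> bool" where
  "codes_check N cs ts \<longleftrightarrow>
     (let M = map (\<lambda>k. k div N) (remdups_adj (merge_sort cs)) in M = merge_sort ts \<and> strictly_increasing M)"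

lemma codes_check_sound:
  assumes "codes_check N cs ts"
  shows "(\<lambda>k. k div N) ` set cs = set ts" "inj_on (\<lambda>k. k div N) (set cs)"
proof -
  define xs where "xs = remdups_adj (merge_sort cs)"
  have xs: "set xs = set cs" by (simp add: xs_def set_merge_sort)
  have M: "map (\<lambda>k. k div N) xs = merge_sort ts" "strictly_increasing (map (\<lambda>k. k div N) xs)"
    using assms unfolding codes_check_def Let_def xs_def by blast+
  show "inj_on (\<lambda>k. k div N) (set cs)"
    using strictly_increasing_distinct[OF M(2)] xs by (simp add: distinct_map)
  have "(\<lambda>k. k div N) ` set xs = set (merge_sort ts)" by (metis M(1) set_map)
  then show "(\<lambda>k. k div N) ` set cs = set ts" by (simp add: xs set_merge_sort)
qed

text \<open>A triple \<open>a < b < c\<close> inside a block with fourth point \<open>x\<close> is recorded as the number with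
  base-\<open>N\<close> digits \<open>a b c x\<close>; every triple then lies in exactly one block iff dropping the last digit
  is injective on these numbers.\<close>

fun block_codes :: "(int \<Rightarrow> int \<Rightarrow> int \<Rightarrow> int \<Rightarrow> int) \<Rightarrow> int list \<Rightarrow> int list" where
  "block_codes \<phi> [a, b, c, d] = [\<phi> a b c d, \<phi> a b d c, \<phi> a c d b, \<phi> b c d a]"
| "block_codes \<phi> _ = []"

fun block_ok :: "int \<Rightarrow> int list \<Rightarrow> bool" where
  "block_ok N [a, b, c, d] \<longleftrightarrow> 0 \<le> a \<and> a < b \<and> b < c \<and> c < d \<and> d < N"
| "block_ok N _ \<longleftrightarrow> False"

definition triple_codes :: "int \<Rightarrow> (int \<Rightarrow> int \<Rightarrow> int \<Rightarrow> bool) \<Rightarrow> int list" where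
  "triple_codes N V = concat (map (\<lambda>a. concat (map (\<lambda>b. map (\<lambda>c. (a * N + b) * N + c)
     (filter (V a b) [b + 1..N - 1])) [a + 1..N - 1])) [0..N - 1])"

definition design_check :: "int \<Rightarrow> (int \<Rightarrow> int \<Rightarrow> int \<Rightarrow> bool) \<Rightarrow> int list list \<Rightarrow> bool" where
  "design_check N V Bs \<longleftrightarrow>
     list_all (block_ok N) Bs \<and> codes_check N (concat (map (block_codes (\<lambda>a b c x. ((a * N + b) * N + c) * N + x)) Bs)) (triple_codes N V)"

lemma digits_unique:
  fixes N :: int
  assumes "a * N + b = a' * N + b'" "0 \<le> b" "b < N" "0 \<le> b'" "b' < N"
  shows "a = a' \<and> b = b'"
proof -
  have "(a * N + b) div N = a" "(a' * N + b') div N = a'" using assms(2-5) by auto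
  then have "a = a'" using assms(1) by metis
  then show ?thesis using assms(1) by simp
qed

lemma triple_codes_iff:
  "t \<in> set (triple_codes N V) \<longleftrightarrow>
     (\<exists>a b c. 0 \<le> a \<and> a < b \<and> b < c \<and> c < N \<and> V a b c \<and> t = (a * N + b) * N + c)"
proof -
  have "t \<in> set (triple_codes N V) \<longleftrightarrow>
      (\<exists>a\<in>{0..N - 1}. \<exists>b\<in>{a + 1..N - 1}. \<exists>c\<in>{b + 1..N - 1}. V a b c \<and> t = (a * N + b) * N + c)"
    unfolding triple_codes_def by (simp only: set_concat set_map image_image set_filter set_upto) blast
  also have "\<dots> \<longleftrightarrow> (\<exists>a b c. 0 \<le> a \<and> a < b \<and> b < c \<and> c < N \<and> V a b c \<and> t = (a * N + b) * N + c)"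
    (is "?L \<longleftrightarrow> ?R")
  proof
    assume ?R
    then obtain a b c where "0 \<le> a" "a < b" "b < c" "c < N" "V a b c" "t = (a * N + b) * N + c" by blast
    then show ?L by (intro bexI[of _ a] bexI[of _ b] bexI[of _ c]) auto
  next
    assume ?L
    then obtain a b c where "a \<in> {0..N - 1}" "b \<in> {a + 1..N - 1}" "c \<in> {b + 1..N - 1}" "V a b c"
      "t = (a * N + b) * N + c" by blast
    then show ?R by (intro exI[of _ a] exI[of _ b] exI[of _ c]) auto
  qed
  finally show ?thesis .
qed

lemma triple_code_unique:
  fixes N :: int
  assumes "(a * N + b) * N + c = (a' * N + b') * N + c'" "0 \<le> a" "a < b" "b < c" "c < N"
    "0 \<le> a'" "a' < b'" "b' < c'" "c' < N"
  shows "a = a' \<and> b = b' \<and> c = c'"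
  using digits_unique[OF assms(1)] digits_unique[of a N b a' b'] assms by auto

lemma sorted_triple_eq:
  fixes a b c :: int
  assumes "{a, b, c} = {p, q, r}" "a < b" "b < c" "p < q" "q < r"
  shows "a = p \<and> b = q \<and> c = r"
proof -
  have "a \<in> {p, q, r}" "b \<in> {p, q, r}" "c \<in> {p, q, r}" by (simp_all flip: assms(1))
  then show ?thesis using assms(2-5) by auto
qed

text \<open>The code function stays arbitrary because it is instantiated in three ways: with plain
  codes, with codes of normal forms under a group, and with an indicator that tests a predicate on
  all triples of a block.\<close>

lemma block_codes_iff:
  assumes "block_ok N bl"
  shows "k \<in> set (block_codes \<phi> bl) \<longleftrightarrow>
    (\<exists>a b c x. a < b \<and> b < c \<and> x \<notin> {a, b, c} \<and> set bl = {a, b, c, x} \<and> k = \<phi> a b c x)"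
    (is "_ \<longleftrightarrow> ?R")
proof -
  obtain p q r s where bl: "bl = [p, q, r, s]" "0 \<le> p" "p < q" "q < r" "r < s" "s < N"
    using assms by (cases "(N, bl)" rule: block_ok.cases) auto
  have "?R" if "k \<in> set (block_codes \<phi> bl)"
  proof -
    have "k = \<phi> p q r s \<or> k = \<phi> p q s r \<or>
      k = \<phi> p r s q \<or> k = \<phi> q r s p"
      using that bl by auto
    then show ?R
    proof (elim disjE)
      assume "k = \<phi> p q r s"
      then show ?R using bl by (intro exI[of _ p] exI[of _ q] exI[of _ r] exI[of _ s]) auto
    next
      assume "k = \<phi> p q s r"
      then show ?R using bl by (intro exI[of _ p] exI[of _ q] exI[of _ s] exI[of _ r]) auto
    next
      assume "k = \<phi> p r s q"
      then show ?R using bl by (intro exI[of _ p] exI[of _ r] exI[of _ s] exI[of _ q]) auto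
    next
      assume "k = \<phi> q r s p"
      then show ?R using bl by (intro exI[of _ q] exI[of _ r] exI[of _ s] exI[of _ p]) auto
    qed
  qed
  moreover have "k \<in> set (block_codes \<phi> bl)" if R: ?R
  proof -
    obtain a b c x where *: "a < b" "b < c" "x \<notin> {a, b, c}" "set bl = {a, b, c, x}"
      "k = \<phi> a b c x" using R by blast
    have eq: "{p, q, r, s} = {a, b, c, x}" using *(4) bl(1) by simp
    have abc: "{a, b, c} = {p, q, r, s} - {x}" using *(1-3) eq by auto
    have "x \<in> {p, q, r, s}" by (simp add: eq)
    then consider "x = p" | "x = q" | "x = r" | "x = s" by blast
    then have "(a, b, c, x) \<in> {(p, q, r, s), (p, q, s, r), (p, r, s, q), (q, r, s, p)}"
    proof cases
      case 1
      then have "{a, b, c} = {q, r, s}" unfolding abc using bl(3-5) by auto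
      then show ?thesis using sorted_triple_eq[of a b c q r s] 1 *(1,2) bl(3-5) by simp
    next
      case 2
      then have "{a, b, c} = {p, r, s}" unfolding abc using bl(3-5) by auto
      then show ?thesis using sorted_triple_eq[of a b c p r s] 2 *(1,2) bl(3-5) by simp
    next
      case 3
      then have "{a, b, c} = {p, q, s}" unfolding abc using bl(3-5) by auto
      then show ?thesis using sorted_triple_eq[of a b c p q s] 3 *(1,2) bl(3-5) by simp
    next
      case 4
      then have "{a, b, c} = {p, q, r}" unfolding abc using bl(3-5) by auto
      then show ?thesis using sorted_triple_eq[of a b c p q r] 4 *(1,2) bl(3-5) by simp
    qed
    then show ?thesis
      by (elim insertE emptyE Pair_inject)
        (simp_all only: *(5) bl(1) block_codes.simps list.set insert_iff simp_thms)
  qed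
  ultimately show ?thesis by blast
qed

lemma triple_sorted:
  fixes T :: "int set"
  assumes "card T = 3"
  obtains a b c where "T = {a, b, c}" "a < b" "b < c"
proof -
  obtain x y z where T: "T = {x, y, z}" "x \<noteq> y" "y \<noteq> z" "x \<noteq> z" using assms by (metis card_3_iff)
  consider "x < y \<and> y < z" | "x < z \<and> z < y" | "y < x \<and> x < z" | "y < z \<and> z < x"
    | "z < x \<and> x < y" | "z < y \<and> y < x" using T by linarith
  then show ?thesis
  proof cases
    case 1 then show ?thesis using that[of x y z] T by simp
  next
    case 2 then show ?thesis using that[of x z y] T by (simp add: insert_commute)
  next
    case 3 then show ?thesis using that[of y x z] T by (simp add: insert_commute)
  next
    case 4 then show ?thesis using that[of y z x] T by (simp add: insert_commute)
  next
    case 5 then show ?thesis using that[of z x y] T by (simp add: insert_commute)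
  next
    case 6 then show ?thesis using that[of z y x] T by (simp add: insert_commute)
  qed
qed

text \<open>The listed keys are those of the wanted triples: that all of them occur gives existence,
  and that no others occur keeps the blocks inside the family. Two blocks through a triple give
  codes with equal quotient, and injectivity makes their fourth points equal.\<close>

lemma design_check_sound:
  assumes "design_check N V Bs"
  shows "quadruple_design {{a, b, c} | a b c. 0 \<le> a \<and> a < b \<and> b < c \<and> c < N \<and> V a b c} (set ` set Bs)"
    (is "quadruple_design ?T ?B")
proof -
  let ?\<phi> = "\<lambda>a b c x. ((a * N + b) * N + c) * N + x"
  define K where "K = set (concat (map (block_codes ?\<phi>) Bs))"
  have ok: "block_ok N bl" if "bl \<in> set Bs" for bl
    using assms that by (simp add: design_check_def list_all_iff)
  have chk: "codes_check N (concat (map (block_codes ?\<phi>) Bs)) (triple_codes N V)"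
    using assms by (simp add: design_check_def)
  have inj: "inj_on (\<lambda>k. k div N) K" and im: "(\<lambda>k. k div N) ` K = set (triple_codes N V)"
    using codes_check_sound[OF chk] unfolding K_def by auto
  have K: "k \<in> K \<longleftrightarrow> (\<exists>bl\<in>set Bs. k \<in> set (block_codes ?\<phi> bl))" for k by (auto simp: K_def)
  have bnd: "set bl \<subseteq> {0..<N}" "card (set bl) = 4" if "bl \<in> set Bs" for bl
    using ok[OF that] by (cases "(N, bl)" rule: block_ok.cases; auto)+
  have code: "((a * N + b) * N + c) * N + x \<in> K" if "bl \<in> set Bs" "a < b" "b < c" "x \<notin> {a, b, c}"
    "set bl = {a, b, c, x}" for bl a b c x
    unfolding K using that(1) block_codes_iff[OF ok[OF that(1)], of "((a * N + b) * N + c) * N + x" ?\<phi>] that(2-)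
    by blast
  have split: "\<exists>x. x \<notin> {a, b, c} \<and> set bl = {a, b, c, x} \<and> 0 \<le> x \<and> x < N"
    if "bl \<in> set Bs" "{a, b, c} \<subseteq> set bl" "a < b" "b < c" for bl and a b c :: int
  proof -
    have "card (set bl - {a, b, c}) = 1" using bnd[OF that(1)] that by (subst card_Diff_subset) auto
    then obtain x where x: "set bl - {a, b, c} = {x}" using card_1_singletonE by blast
    then have "x \<in> set bl" "x \<notin> {a, b, c}" by blast+
    moreover have "set bl = {a, b, c, x}" using x that(2) by blast
    moreover have "0 \<le> x" "x < N" using calculation(1) bnd(1)[OF that(1)] by auto
    ultimately show ?thesis by blast
  qed
  show ?thesis
  proof (rule quadruple_designI)
    show "card T = 3" if "T \<in> ?T" for T using that by auto
    show "card b = 4" if "b \<in> ?B" for b using that bnd(2) by auto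
    show "T \<in> ?T" if b: "b \<in> ?B" and T: "T \<subseteq> b" "card T = 3" for b T
    proof -
      from b obtain bl where bl: "bl \<in> set Bs" "b = set bl" by blast
      obtain a1 a2 a3 where a: "T = {a1, a2, a3}" "a1 < a2" "a2 < a3" using triple_sorted[OF T(2)] .
      obtain x where x: "x \<notin> {a1, a2, a3}" "set bl = {a1, a2, a3, x}" "0 \<le> x" "x < N"
        using split[OF bl(1), of a1 a2 a3] T a bl by auto
      have "(((a1 * N + a2) * N + a3) * N + x) div N \<in> set (triple_codes N V)"
        using code[OF bl(1) a(2,3) x(1,2)] im by blast
      moreover have "(((a1 * N + a2) * N + a3) * N + x) div N = (a1 * N + a2) * N + a3"
        using x by auto
      ultimately obtain a' b' c' where c: "0 \<le> a'" "a' < b'" "b' < c'" "c' < N" "V a' b' c'"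
        "(a1 * N + a2) * N + a3 = (a' * N + b') * N + c'" using triple_codes_iff by metis
      have "0 \<le> a1" "a3 < N" using bnd(1)[OF bl(1)] x(2) by auto
      then have "a1 = a' \<and> a2 = b' \<and> a3 = c'" using triple_code_unique[OF c(6)] a c by blast
      then show ?thesis using a c by blast
    qed
    show "\<exists>b\<in>?B. T \<subseteq> b" if "T \<in> ?T" for T
    proof -
      from that obtain a b c where T: "T = {a, b, c}" "0 \<le> a" "a < b" "b < c" "c < N" "V a b c" by blast
      then have "(a * N + b) * N + c \<in> set (triple_codes N V)" using triple_codes_iff by blast
      then obtain k where k: "k \<in> K" "k div N = (a * N + b) * N + c" using im by (metis imageE)
      obtain bl where bl: "bl \<in> set Bs" "k \<in> set (block_codes ?\<phi> bl)" using k(1) K by blast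
      obtain a' b' c' x where c: "a' < b'" "b' < c'" "set bl = {a', b', c', x}"
        "k = ((a' * N + b') * N + c') * N + x" 
        using bl(2) block_codes_iff[OF ok[OF bl(1)], of k ?\<phi>] by blast
      have r: "0 \<le> a'" "c' < N" "0 \<le> x" "x < N" using bnd(1)[OF bl(1)] c(3) by auto
      then have "k div N = (a' * N + b') * N + c'" using c(4) by auto
      then have "a' = a \<and> b' = b \<and> c' = c"
        using triple_code_unique[of a' N b' c' a b c] k(2) r c T by auto
      then show ?thesis using bl c T by blast
    qed
    show "b = b'" if T: "T \<in> ?T" and b: "b \<in> ?B" "b' \<in> ?B" "T \<subseteq> b" "T \<subseteq> b'" for T b b'
    proof -
      from T obtain p q r where T: "T = {p, q, r}" "p < q" "q < r" by blast
      from b obtain bl bl' where bl: "bl \<in> set Bs" "b = set bl" "bl' \<in> set Bs" "b' = set bl'" by blast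
      obtain x where x: "x \<notin> {p, q, r}" "set bl = {p, q, r, x}" "0 \<le> x" "x < N"
        using split[OF bl(1), of p q r] T b bl by auto
      obtain y where y: "y \<notin> {p, q, r}" "set bl' = {p, q, r, y}" "0 \<le> y" "y < N"
        using split[OF bl(3), of p q r] T b bl by auto
      let ?t = "(p * N + q) * N + r"
      have "?t * N + x \<in> K" "?t * N + y \<in> K"
        using code[OF bl(1) T(2,3) x(1,2)] code[OF bl(3) T(2,3) y(1,2)] by auto
      moreover have "(?t * N + x) div N = (?t * N + y) div N" using x y by auto
      ultimately have "?t * N + x = ?t * N + y" using inj_onD[OF inj] by blast
      then show ?thesis using bl x y by auto
    qed
  qed
qed

lemma sqs_order_check:
  assumes "design_check N (\<lambda>_ _ _. True) Bs"
  shows "sqs_order (nat N)"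
proof -
  have "{{a, b, c} | a b c. 0 \<le> a \<and> a < b \<and> b < c \<and> c < N \<and> True} = triples {0..<N}" (is "?L = _")
  proof (intro set_eqI iffI)
    fix T assume "T \<in> triples {0..<N}"
    then have T: "T \<subseteq> {0..<N}" "card T = 3" by (auto simp: triples_def)
    obtain a b c where "T = {a, b, c}" "a < b" "b < c" using triple_sorted[OF T(2)] .
    then show "T \<in> ?L" using T(1) by auto
  qed (auto simp: triples_def)
  then have "sqs {0..<N} (set ` set Bs)" using design_check_sound[OF assms] by simp
  then show ?thesis by (rule sqs_imp_sqs_order) auto
qed

text \<open>For \<open>a < b < c\<close> the group indices increase weakly, so two distinct indices
  below the stem index 3 must occur at neighbouring positions.\<close>

definition cross_valid :: "int \<Rightarrow> int \<Rightarrow> int \<Rightarrow> int \<Rightarrow> bool" where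
  "cross_valid g a b c \<longleftrightarrow> (let d = a div g; e = b div g; f = c div g in d < e \<and> e < 3 \<or> e < f \<and> f < 3)"

definition split_point :: "int \<Rightarrow> int \<Rightarrow> int \<times> int" where
  "split_point g c = (c div g, c mod g)"

lemma split_point_inj: "inj (split_point g)"
  unfolding inj_def split_point_def by (metis prod.inject div_mult_mod_eq)

text \<open>Because of \<open>k \<le> g\<close> the stem fits into the interval of numbers with
  quotient 3, and the points of the weighted set are coded by an interval without gaps.\<close>

lemma split_point_image:
  assumes "g > 0" "0 \<le> k" "k \<le> g"
  shows "split_point g ` {0..<3 * g + k} = weighted {0..<4} (3::int) g k"
proof (intro set_eqI iffI)
  fix p assume "p \<in> weighted {0..<4} (3::int) g k"
  then have p: "0 \<le> snd p" "snd p < g" "0 \<le> fst p" "fst p < 3 \<or> fst p = 3 \<and> snd p < k"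
    using assms by (auto simp: weighted_def)
  have "split_point g (fst p * g + snd p) = p"
    using p by (auto simp: split_point_def prod_eq_iff)
  moreover have "fst p * g + snd p \<in> {0..<3 * g + k}"
  proof -
    have "fst p * g + snd p < 3 * g + k"
    proof (cases "fst p < 3")
      case True
      then have "fst p * g \<le> 2 * g" using assms by (intro mult_right_mono) auto
      then show ?thesis using p assms by linarith
    qed (use p in auto)
    then show ?thesis using p assms by auto
  qed
  ultimately show "p \<in> split_point g ` {0..<3 * g + k}" by (metis imageI)
next
  fix p assume "p \<in> split_point g ` {0..<3 * g + k}"
  then obtain c where c: "0 \<le> c" "c < 3 * g + k" "p = (c div g, c mod g)"
    by (auto simp: split_point_def)
  have cg: "c = c div g * g + c mod g" "0 \<le> c mod g" "c mod g < g" using assms by simp_all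
  have "0 \<le> c div g" using c assms by (simp add: pos_imp_zdiv_nonneg_iff)
  moreover have "c div g < 4"
  proof (rule ccontr)
    assume "\<not> c div g < 4"
    then have "4 * g \<le> c div g * g" using assms by (intro mult_right_mono) auto
    then show False using c cg assms by linarith
  qed
  moreover have "c mod g < k" if "c div g = 3" using cg c(2) that by simp
  ultimately show "p \<in> weighted {0..<4} (3::int) g k"
    using c cg by (auto simp: weighted_def)
qed

lemma card_ge_2_iff: "finite S \<Longrightarrow> 2 \<le> card S \<longleftrightarrow> (\<exists>x\<in>S. \<exists>y\<in>S. x \<noteq> y)"
  using card_le_Suc0_iff_eq[of S] by (auto simp: not_le[symmetric] numeral_2_eq_2 not_less_eq_eq)

lemma cross_valid_iff:
  assumes "g > 0" "0 \<le> a" "a < b" "b < c" "c < 4 * g"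
  shows "cross_valid g a b c \<longleftrightarrow> 2 \<le> card (fst ` split_point g ` {a, b, c} - {3})"
proof -
  have "a div g \<le> b div g" "b div g \<le> c div g" using assms by (auto intro: zdiv_mono1)
  moreover have "c div g \<le> 3"
  proof (rule ccontr)
    assume "\<not> c div g \<le> 3"
    then have "4 * g \<le> c div g * g" using assms by (intro mult_right_mono) auto
    moreover have "c = c div g * g + c mod g" "0 \<le> c mod g" using assms by simp_all
    ultimately show False using assms by linarith
  qed
  moreover have "(d < e \<and> e < 3 \<or> e < f \<and> f < 3) \<longleftrightarrow> (\<exists>x\<in>{d, e, f} - {3}. \<exists>y\<in>{d, e, f} - {3}. x \<noteq> y)"
    if "d \<le> e" "e \<le> f" "f \<le> 3" for d e f :: int
  proof
    assume "d < e \<and> e < 3 \<or> e < f \<and> f < 3"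
    then show "\<exists>x\<in>{d, e, f} - {3}. \<exists>y\<in>{d, e, f} - {3}. x \<noteq> y"
    proof
      assume "d < e \<and> e < 3"
      then show ?thesis by (intro bexI[of _ d] bexI[of _ e]) auto
    next
      assume "e < f \<and> f < 3"
      then show ?thesis by (intro bexI[of _ e] bexI[of _ f]) auto
    qed
  qed (use that in auto)
  ultimately show ?thesis
    by (simp add: card_ge_2_iff cross_valid_def Let_def split_point_def)
qed

lemma design_check_image:
  assumes "design_check (3 * g + k) V Bs" "g > 0" "0 \<le> k" "k \<le> g"
    and V: "\<And>a b c. 0 \<le> a \<Longrightarrow> a < b \<Longrightarrow> b < c \<Longrightarrow> c < 4 * g \<Longrightarrow> V a b c \<longleftrightarrow> P (split_point g ` {a, b, c})"
  shows "\<exists>D. quadruple_design {T \<in> triples (weighted {0..<4} (3::int) g k). P T} D"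
proof -
  let ?N = "3 * g + k" and ?f = "split_point g"
  let ?T = "{{a, b, c} | a b c. 0 \<le> a \<and> a < b \<and> b < c \<and> c < ?N \<and> V a b c}"
  have inj: "inj_on ?f {0..<?N}" using split_point_inj by (rule inj_on_subset) simp
  have "quadruple_design ((`) ?f ` ?T) ((`) ?f ` set ` set Bs)"
    by (rule quadruple_design_image[OF design_check_sound[OF assms(1)] inj]) auto
  moreover have "(`) ?f ` ?T = {T \<in> triples (weighted {0..<4} (3::int) g k). P T}"
  proof -
    have "?T = {T \<in> triples {0..<?N}. P (?f ` T)}"
    proof (intro set_eqI iffI)
      fix T assume "T \<in> ?T"
      then obtain a b c where T: "T = {a, b, c}" "0 \<le> a" "a < b" "b < c" "c < ?N" "V a b c" by blast
      then show "T \<in> {T \<in> triples {0..<?N}. P (?f ` T)}"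
        using V[of a b c] assms(2-4) by (auto simp: triples_def simp del: image_insert)
    next
      fix T assume "T \<in> {T \<in> triples {0..<?N}. P (?f ` T)}"
      then have T: "T \<subseteq> {0..<?N}" "card T = 3" "P (?f ` T)" by (auto simp: triples_def)
      obtain a b c where a: "T = {a, b, c}" "a < b" "b < c" using triple_sorted[OF T(2)] .
      then show "T \<in> ?T" using T V[of a b c] assms(2-4) by (auto simp del: image_insert)
    qed
    then show ?thesis
      unfolding split_point_image[OF assms(2-4), symmetric] triples_image[OF inj]
      by (auto simp del: image_insert image_image)
  qed
  ultimately show ?thesis by auto
qed

lemma cross_design_check:
  assumes "design_check (3 * g + k) (cross_valid g) Bs" "g > 0" "0 \<le> k" "k \<le> g"
  shows "\<exists>D. quadruple_design (cross_triples (3::int) (weighted {0..<4} 3 g k)) D"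
  unfolding cross_triples_def by (rule design_check_image[OF assms cross_valid_iff[OF assms(2)]])

section \<open>Explicit small designs\<close>

text \<open>The filling of a group of 12 points with a stem of two. It has to be explicit: the
  recursion for this residue, from \<open>k\<close> to \<open>12 * k - 10\<close>, would derive
  order 14 at \<open>k = 2\<close> from order 14 itself.\<close>

lemma sqs_order_14: "sqs_order 14"
proof -
  have "design_check 14 (\<lambda>_ _ _. True)
    [[0, 1, 2, 4], [0, 1, 3, 6], [0, 1, 5, 9], [0, 1, 7, 8], [0, 1, 10, 11], [0, 1, 12, 13],
     [0, 2, 3, 11], [0, 2, 5, 6], [0, 2, 7, 9], [0, 2, 8, 13], [0, 2, 10, 12], [0, 3, 4, 5],
     [0, 3, 7, 10], [0, 3, 8, 12], [0, 3, 9, 13], [0, 4, 6, 8], [0, 4, 7, 11], [0, 4, 9, 12],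
     [0, 4, 10, 13], [0, 5, 7, 12], [0, 5, 8, 10], [0, 5, 11, 13], [0, 6, 7, 13], [0, 6, 9, 10],
     [0, 6, 11, 12], [0, 8, 9, 11], [1, 2, 3, 5], [1, 2, 6, 10], [1, 2, 7, 13], [1, 2, 8, 9],
     [1, 2, 11, 12], [1, 3, 4, 12], [1, 3, 7, 9], [1, 3, 8, 10], [1, 3, 11, 13], [1, 4, 5, 6],
     [1, 4, 7, 10], [1, 4, 8, 11], [1, 4, 9, 13], [1, 5, 7, 11], [1, 5, 8, 12], [1, 5, 10, 13],
     [1, 6, 7, 12], [1, 6, 8, 13], [1, 6, 9, 11], [1, 9, 10, 12], [2, 3, 4, 6], [2, 3, 7, 8],
     [2, 3, 9, 10], [2, 3, 12, 13], [2, 4, 5, 13], [2, 4, 7, 12], [2, 4, 8, 10], [2, 4, 9, 11],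
     [2, 5, 7, 10], [2, 5, 8, 11], [2, 5, 9, 12], [2, 6, 7, 11], [2, 6, 8, 12], [2, 6, 9, 13],
     [2, 10, 11, 13], [3, 4, 7, 13], [3, 4, 8, 9], [3, 4, 10, 11], [3, 5, 6, 7], [3, 5, 8, 13],
     [3, 5, 9, 11], [3, 5, 10, 12], [3, 6, 8, 11], [3, 6, 9, 12], [3, 6, 10, 13], [3, 7, 11, 12],
     [4, 5, 7, 8], [4, 5, 9, 10], [4, 5, 11, 12], [4, 6, 7, 9], [4, 6, 10, 12], [4, 6, 11, 13],
     [4, 8, 12, 13], [5, 6, 8, 9], [5, 6, 10, 11], [5, 6, 12, 13], [5, 7, 9, 13], [6, 7, 8, 10],
     [7, 8, 9, 12], [7, 8, 11, 13], [7, 9, 10, 11], [7, 10, 12, 13], [8, 9, 10, 13], [8, 10, 11, 12],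
     [9, 11, 12, 13]]"
    by code_simp
  from sqs_order_check[OF this] show ?thesis by simp
qed

text \<open>The nine blocks through the stem point 9 are the transversals whose coordinates sum to 0
  modulo 3. Nine further blocks have two points in one group and one in each other group, and the
  last nine have two points in each of two groups. This is the step from \<open>k\<close> to
  \<open>3 * k - 2\<close>.\<close>

lemma cross_design_3_1: "\<exists>D. quadruple_design (cross_triples (3::int) (weighted {0..<4} 3 3 1)) D"
proof -
  have "design_check 10 (cross_valid 3)
    [[0, 3, 6, 9], [0, 4, 8, 9], [0, 5, 7, 9], [1, 3, 8, 9], [1, 4, 7, 9], [1, 5, 6, 9],
     [2, 3, 7, 9], [2, 4, 6, 9], [2, 5, 8, 9], [1, 2, 3, 6], [0, 2, 4, 7], [0, 1, 5, 8],
     [0, 4, 5, 6], [1, 3, 5, 7], [2, 3, 4, 8], [0, 3, 7, 8], [1, 4, 6, 8], [2, 5, 6, 7],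
     [1, 2, 4, 5], [0, 2, 3, 5], [0, 1, 3, 4], [1, 2, 7, 8], [0, 2, 6, 8], [0, 1, 6, 7],
     [4, 5, 7, 8], [3, 5, 6, 8], [3, 4, 6, 7]]"
    by code_simp
  then show ?thesis using cross_design_check[of 3 1] by simp
qed



section \<open>Groups of 12 points with a stem of two: a design given by base blocks\<close>

text \<open>Points are coded as \<open>12 i + 6 p + y\<close> with \<open>i < 3\<close>, \<open>p < 2\<close>, \<open>y < 6\<close>, and the two points of the stem as
  36 and 42. The group \<open>\<int>\<^sub>2 \<times> \<int>\<^sub>6\<close> translates \<open>(p, y)\<close>, and the design is a union of orbits of
  this group, so that every triple can be translated until a distinguished point of it
  has \<open>p = y = 0\<close>.\<close>

definition move :: "int \<Rightarrow> int \<Rightarrow> int \<Rightarrow> int" where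
  "move s t k = (if 36 \<le> k then k
     else 12 * (k div 12) + 6 * ((k mod 12 div 6 + s) mod 2) + (k mod 6 + t) mod 6)"

definition points_12_2 :: "int set" where
  "points_12_2 = {0..<36} \<union> {36, 42}"

definition triples_12_2 :: "int set set" where
  "triples_12_2 = {T \<in> triples points_12_2. 2 \<le> card ((\<lambda>k. k div 12) ` T - {3})}"

lemma digits_12_6:
  fixes i p y :: int
  assumes "0 \<le> p" "p < 2" "0 \<le> y" "y < 6"
  shows "(12 * i + 6 * p + y) div 12 = i" "(12 * i + 6 * p + y) mod 12 div 6 = p" "(12 * i + 6 * p + y) mod 6 = y"
proof -
  have "(12 * i + 6 * p + y) mod 12 = 6 * p + y"
    by (rule int_mod_pos_eq[where q = i]) (use assms in auto)
  moreover have "(6 * p + y) div 6 = p" by (rule int_div_pos_eq[where r = y]) (use assms in auto)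
  ultimately show "(12 * i + 6 * p + y) mod 12 div 6 = p" by simp
  show "(12 * i + 6 * p + y) div 12 = i"
    by (rule int_div_pos_eq[where r = "6 * p + y"]) (use assms in auto)
  show "(12 * i + 6 * p + y) mod 6 = y"
    by (rule int_mod_pos_eq[where q = "2 * i + p"]) (use assms in auto)
qed

lemma move_less:
  "k < 36 \<Longrightarrow> move s t k = 12 * (k div 12) + 6 * ((k mod 12 div 6 + s) mod 2) + (k mod 6 + t) mod 6"
  unfolding move_def by (rule if_not_P) simp

lemma move_ge: "\<not> k < 36 \<Longrightarrow> move s t k = k"
  unfolding move_def by (rule if_P) simp

lemma move_digits:
  assumes "k < 36"
  shows "move s t k div 12 = k div 12" "move s t k mod 12 div 6 = (k mod 12 div 6 + s) mod 2"
    "move s t k mod 6 = (k mod 6 + t) mod 6" "move s t k < 36"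
proof -
  have eq: "move s t k = 12 * (k div 12) + 6 * ((k mod 12 div 6 + s) mod 2) + (k mod 6 + t) mod 6"
    by (rule move_less[OF assms])
  have r: "0 \<le> (k mod 12 div 6 + s) mod 2" "(k mod 12 div 6 + s) mod 2 < 2"
    "0 \<le> (k mod 6 + t) mod 6" "(k mod 6 + t) mod 6 < 6" by simp_all
  show "move s t k div 12 = k div 12" "move s t k mod 12 div 6 = (k mod 12 div 6 + s) mod 2"
    "move s t k mod 6 = (k mod 6 + t) mod 6"
    unfolding eq by (rule digits_12_6[OF r])+
  have "k div 12 < 3" using assms by linarith
  then show "move s t k < 36" unfolding eq using r by linarith
qed

lemma move_div_12: "move s t k div 12 = k div 12"
  using move_digits(1) move_ge by metis

lemma move_move: "move s t (move s' t' k) = move (s + s') (t + t') k"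
proof (cases "k < 36")
  case True
  let ?k = "move s' t' k"
  have "move s t ?k = 12 * (?k div 12) + 6 * ((?k mod 12 div 6 + s) mod 2) + (?k mod 6 + t) mod 6"
    by (rule move_less[OF move_digits(4)[OF True]])
  also have "\<dots> = 12 * (k div 12) + 6 * (((k mod 12 div 6 + s') mod 2 + s) mod 2) + ((k mod 6 + t') mod 6 + t) mod 6"
    unfolding move_digits[OF True] ..
  also have "\<dots> = 12 * (k div 12) + 6 * ((k mod 12 div 6 + (s + s')) mod 2) + (k mod 6 + (t + t')) mod 6"
    unfolding mod_add_left_eq by (simp only: add.assoc add.commute[of s'] add.commute[of t'])
  finally show ?thesis by (simp only: move_less[OF True])
qed (simp only: move_ge not_False_eq_True)

lemma move_cong: "s mod 2 = s' mod 2 \<Longrightarrow> t mod 6 = t' mod 6 \<Longrightarrow> move s t k = move s' t' k"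
proof -
  assume "s mod 2 = s' mod 2" "t mod 6 = t' mod 6"
  then have "(k mod 12 div 6 + s) mod 2 = (k mod 12 div 6 + s') mod 2" "(k mod 6 + t) mod 6 = (k mod 6 + t') mod 6"
    by (metis mod_add_right_eq)+
  then show ?thesis unfolding move_def by (simp only:)
qed

lemma move_0: "move 0 0 k = k"
proof -
  have "k mod 12 mod 6 = k mod 6" by (simp add: mod_mod_cancel)
  moreover have "12 * (k div 12) + k mod 12 = k" "6 * (k mod 12 div 6) + k mod 12 mod 6 = k mod 12"
    by simp_all
  moreover have "0 \<le> k mod 12 div 6" "k mod 12 div 6 < 2" using pos_mod_bound[of 12 k] pos_mod_sign[of 12 k] by linarith+
  moreover have "(k mod 12 div 6 + 0) mod 2 = k mod 12 div 6" "(k mod 6 + 0) mod 6 = k mod 6"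
    using calculation(4,5) by simp_all
  ultimately have "12 * (k div 12) + 6 * ((k mod 12 div 6 + 0) mod 2) + (k mod 6 + 0) mod 6 = k" by linarith
  then show ?thesis by (simp only: move_def if_cancel)
qed

lemma move_inverse: "move s t (move (- s) (- t) k) = k" "move (- s) (- t) (move s t k) = k"
  by (simp_all only: move_move add.right_inverse add.left_inverse move_0)

lemma inj_move: "inj (move s t)"
  by (rule inj_on_inverseI[where g="move (- s) (- t)"]) (simp only: move_inverse)

lemma move_points: "k \<in> points_12_2 \<Longrightarrow> move s t k \<in> points_12_2"
proof (cases "k < 36")
  case True
  assume "k \<in> points_12_2"
  then have "0 \<le> k div 12" using True by (auto simp: points_12_2_def)
  then have "0 \<le> move s t k" using move_div_12[of s t k] by linarith
  then show ?thesis using move_digits(4)[OF True] by (simp add: points_12_2_def)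
qed (simp only: move_ge not_False_eq_True)

lemma move_triples: "T \<in> triples_12_2 \<Longrightarrow> move s t ` T \<in> triples_12_2"
proof -
  assume T: "T \<in> triples_12_2"
  have "(\<lambda>k. k div 12) ` move s t ` T = (\<lambda>k. k div 12) ` T" by (simp add: image_image move_div_12)
  moreover have "card (move s t ` T) = card T" using inj_move by (metis card_image inj_on_subset subset_UNIV)
  ultimately show ?thesis using T move_points unfolding triples_12_2_def triples_def by auto
qed

text \<open>A cross triple has either one or three points that are alone in their group. Choosing
  among them by group index makes the pivot follow every translation, and taking the least index
  keeps it out of the stem.\<close>

definition pivot :: "int set \<Rightarrow> int \<Rightarrow> bool" where
  "pivot T d \<longleftrightarrow> d \<in> T \<and> (\<forall>e\<in>T. e div 12 = d div 12 \<longrightarrow> e = d) \<and>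
     (\<forall>e\<in>T. (\<forall>e'\<in>T. e' div 12 = e div 12 \<longrightarrow> e' = e) \<longrightarrow> d div 12 \<le> e div 12)"

lemma pivot_unique:
  assumes "pivot T d" "pivot T d'"
  shows "d = d'"
proof -
  have "d div 12 \<le> d' div 12" "d' div 12 \<le> d div 12" using assms unfolding pivot_def by blast+
  then have "d div 12 = d' div 12" by linarith
  then show ?thesis using assms unfolding pivot_def by blast
qed

lemma pivot_move: "pivot T d \<Longrightarrow> pivot (move s t ` T) (move s t d)"
  unfolding pivot_def by (simp add: move_div_12 inj_eq[OF inj_move])

text \<open>The translations act regularly on a group of 12 points, so up to the moduli this is the
  only one that takes \<open>d\<close> to the first point of its group. Hence each orbit of triples
  has a single normal form. Subtracting from 2 and from 6 negates the digits while the amounts stay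
  positive.\<close>

definition normalizer :: "int \<Rightarrow> int \<Rightarrow> int" where
  "normalizer d = move (2 - d mod 12 div 6) (6 - d mod 6)"

lemma normalizer_move:
  assumes "d < 36"
  shows "normalizer (move s t d) (move s t k) = normalizer d k"
proof -
  have *: "(m - (x + r) mod m + r) mod m = (m - x) mod m" for m x r :: int
  proof -
    have "(m - (x + r) mod m + r) mod m = ((m + r) - (x + r) mod m) mod m" by (simp only: diff_add_eq)
    also have "\<dots> = (m + r - (x + r)) mod m" by (rule mod_diff_right_eq)
    finally show ?thesis by (simp only: add_diff_cancel_right)
  qed
  show ?thesis
    unfolding normalizer_def move_move move_digits[OF assms] by (rule move_cong[OF * *])
qed

lemma normalizer_self:
  assumes "d < 36"
  shows "normalizer d d = 12 * (d div 12)"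
proof -
  have "x + (m - x) = m" for x m :: int by simp
  then show ?thesis unfolding normalizer_def move_less[OF assms] by (simp only: mod_self mult_zero_right add_0_right)
qed

text \<open>All points are below 48 and thus digits in this base. Taking the middle digit from the
  sum makes the code a function of the set.\<close>

definition triple_code :: "int set \<Rightarrow> int" where
  "triple_code S = (Min S * 48 + (\<Sum>S - Min S - Max S)) * 48 + Max S"

lemma triple_code_eq:
  assumes "p < q" "q < r"
  shows "triple_code {p, q, r} = (p * 48 + q) * 48 + r"
proof -
  have "Min {p, q, r} = p" "Max {p, q, r} = r" "\<Sum>{p, q, r} = p + q + r"
    using assms by (auto simp: max_def min_def)
  then show ?thesis by (simp add: triple_code_def)
qed

lemma triple_code_inj:
  assumes "triple_code S = triple_code S'" "S \<subseteq> {0..<48}" "S' \<subseteq> {0..<48}" "card S = 3" "card S' = 3"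
  shows "S = S'"
proof -
  obtain p q r where S: "S = {p, q, r}" "p < q" "q < r" using triple_sorted[OF assms(4)] .
  obtain p' q' r' where S': "S' = {p', q', r'}" "p' < q'" "q' < r'" using triple_sorted[OF assms(5)] .
  have "(p * 48 + q) * 48 + r = (p' * 48 + q') * 48 + r'"
    using assms(1) S S' triple_code_eq by metis
  then have "p = p' \<and> q = q' \<and> r = r'"
    by (rule triple_code_unique) (use assms(2,3) S S' in auto)
  then show ?thesis using S S' by simp
qed

text \<open>The executable form of \<open>triple_code\<close> after \<open>normalizer\<close>. Two
  comparisons sort the moved triple, because translations keep the group indices: only points of the
  same group can change their order.\<close>

definition norm_code :: "int \<Rightarrow> int \<Rightarrow> int \<Rightarrow> int \<Rightarrow> int" where
  "norm_code a b c x =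
    (let d = (if a div 12 = b div 12 then c else a); s = 2 - d mod 12 div 6; t = 6 - d mod 6;
         p = move s t a; q = move s t b; r = move s t c
     in (if p < q then if q < r then (p * 48 + q) * 48 + r else (p * 48 + r) * 48 + q
         else (q * 48 + p) * 48 + r) * 48 + move s t x)"

lemma triples_12_2_sorted:
  assumes "T \<in> triples_12_2"
  obtains a b c where "T = {a, b, c}" "a < b" "b < c" "0 \<le> a" "c < 48"
    "a div 12 \<le> b div 12" "b div 12 \<le> c div 12" "c div 12 \<le> 3" "b < 36"
    "a div 12 < b div 12 \<and> b div 12 < 3 \<or> b div 12 < c div 12 \<and> c div 12 < 3"
proof -
  have T: "T \<subseteq> points_12_2" "card T = 3" "2 \<le> card ((\<lambda>k. k div 12) ` T - {3})"
    using assms by (auto simp: triples_12_2_def triples_def)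
  obtain a b c where a: "T = {a, b, c}" "a < b" "b < c" using triple_sorted[OF T(2)] .
  have r: "0 \<le> a" "c < 48" using T(1) a by (auto simp: points_12_2_def)
  have "fst ` split_point 12 ` T = (\<lambda>k. k div 12) ` T" by (simp add: image_image split_point_def)
  then have "cross_valid 12 a b c" using cross_valid_iff[of 12 a b c] T(3) a r by simp
  then have v: "a div 12 < b div 12 \<and> b div 12 < 3 \<or> b div 12 < c div 12 \<and> c div 12 < 3"
    by (simp add: cross_valid_def Let_def)
  have "a div 12 \<le> b div 12" "b div 12 \<le> c div 12" "c div 12 \<le> 3" "b < 36" using a r v by linarith+
  then show ?thesis using that a r v by blast
qed

lemma pivot_sorted:
  assumes "a div 12 \<le> b div 12" "b div 12 \<le> c div 12"
    "a div 12 < b div 12 \<and> b div 12 < 3 \<or> b div 12 < c div 12 \<and> c div 12 < 3" "a < b"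
  shows "pivot {a, b, c} (if a div 12 = b div 12 then c else a)"
    "(if a div 12 = b div 12 then c else a) < 36"
proof -
  let ?d = "if a div 12 = b div 12 then c else a"
  have less: "?d div 12 < 3" using assms by (cases "a div 12 = b div 12") (simp_all, linarith+)
  then show "?d < 36" by linarith
  show "pivot {a, b, c} ?d"
  proof (cases "a div 12 = b div 12")
    case True
    then have "b div 12 < c div 12" using assms(3) by linarith
    then show ?thesis using True assms(4) by (auto simp: pivot_def)
  next
    case False
    then have "a div 12 < b div 12" "a div 12 < c div 12" using assms(1,2) by linarith+
    then show ?thesis using False assms(2) by (auto simp: pivot_def)
  qed
qed

lemma ex_pivot:
  assumes "T \<in> triples_12_2"
  shows "\<exists>d<36. pivot T d"
proof -
  obtain a b c where "T = {a, b, c}" "a < b" "a div 12 \<le> b div 12" "b div 12 \<le> c div 12"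
    "a div 12 < b div 12 \<and> b div 12 < 3 \<or> b div 12 < c div 12 \<and> c div 12 < 3"
    by (rule triples_12_2_sorted[OF assms])
  then show ?thesis using pivot_sorted by blast
qed

lemma norm_code_eq:
  assumes T: "{a, b, c} \<in> triples_12_2" "a < b" "b < c" and d: "pivot {a, b, c} d"
  shows "norm_code a b c x = triple_code (normalizer d ` {a, b, c}) * 48 + normalizer d x"
proof -
  obtain a' b' c' where T': "{a, b, c} = {a', b', c'}" "a' < b'" "b' < c'"
    "a' div 12 \<le> b' div 12" "b' div 12 \<le> c' div 12"
    "a' div 12 < b' div 12 \<and> b' div 12 < 3 \<or> b' div 12 < c' div 12 \<and> c' div 12 < 3"
    by (rule triples_12_2_sorted[OF T(1)])
  have abc: "a = a'" "b = b'" "c = c'" using sorted_triple_eq[OF T'(1) T(2,3) T'(2,3)] by auto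
  note g = T'(4-6)[folded abc]
  have dd: "d = (if a div 12 = b div 12 then c else a)"
    using pivot_unique[OF d pivot_sorted(1)[OF g T(2)]] .
  let ?f = "normalizer d"
  have fd: "?f k div 12 = k div 12" for k by (simp add: normalizer_def move_div_12)
  have ne: "?f a \<noteq> ?f b" "?f b \<noteq> ?f c" "?f a \<noteq> ?f c"
    using T(2,3) inj_move by (auto simp: normalizer_def inj_eq)
  have eq: "norm_code a b c x = (if ?f a < ?f b then if ?f b < ?f c then (?f a * 48 + ?f b) * 48 + ?f c
      else (?f a * 48 + ?f c) * 48 + ?f b else (?f b * 48 + ?f a) * 48 + ?f c) * 48 + ?f x"
    unfolding norm_code_def Let_def dd[symmetric] normalizer_def by simp
  have lt: "u < v" if "u div 12 < v div 12" for u v :: int using that by linarith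
  consider "?f a < ?f b" "?f b < ?f c" | "?f a < ?f b" "?f c < ?f b" | "?f b < ?f a" using ne by linarith
  then show ?thesis
  proof cases
    case 1
    then show ?thesis using triple_code_eq[of "?f a" "?f b" "?f c"] by (simp add: eq)
  next
    case 2
    have "\<not> b div 12 < c div 12" using lt[of "?f b" "?f c"] 2 by (auto simp: fd)
    then have "a div 12 < c div 12" using g by linarith
    then have "?f a < ?f c" using lt[of "?f a" "?f c"] by (simp add: fd)
    then have "triple_code {?f a, ?f c, ?f b} = (?f a * 48 + ?f c) * 48 + ?f b"
      using triple_code_eq[of "?f a" "?f c" "?f b"] 2 by simp
    then show ?thesis using 2 by (simp add: eq insert_commute)
  next
    case 3
    have "\<not> a div 12 < b div 12" using lt[of "?f a" "?f b"] 3 by (auto simp: fd)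
    then have "a div 12 < c div 12" using g by linarith
    then have "?f a < ?f c" using lt[of "?f a" "?f c"] by (simp add: fd)
    then have "triple_code {?f b, ?f a, ?f c} = (?f b * 48 + ?f a) * 48 + ?f c"
      using triple_code_eq[of "?f b" "?f a" "?f c"] 3 by simp
    then show ?thesis using 3 by (simp add: eq insert_commute)
  qed
qed

text \<open>The digits in the name count the points in the lower and in the upper part. Here the
  single point is the pivot and becomes \<open>12 * j\<close>. In \<open>normal_codes_12\<close> the
  pivot is \<open>12 * i\<close>, and \<open>r\<close> may also lie in a later group or be a stem
  point, 36 or 42, so the transversals are listed there as well.\<close>

definition normal_codes_21 :: "int \<Rightarrow> int \<Rightarrow> int list" where
  "normal_codes_21 i j = concat (map (\<lambda>p. map (\<lambda>q. (p * 48 + q) * 48 + 12 * j) [p + 1..12 * i + 11])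
     [12 * i..12 * i + 11])"

definition normal_codes_12 :: "int \<Rightarrow> int \<Rightarrow> int list" where
  "normal_codes_12 i j = concat (map (\<lambda>q. map (\<lambda>r. (12 * i * 48 + q) * 48 + r)
     ([q + 1..12 * j + 11] @ [12 * j + 12..36] @ [42])) [12 * j..12 * j + 11])"

definition normal_codes :: "int list" where
  "normal_codes = concat (map (\<lambda>(i, j). normal_codes_21 i j @ normal_codes_12 i j) [(0, 1), (0, 2), (1, 2)])"

lemma normal_code_in:
  assumes T: "T \<in> triples_12_2" and d: "pivot T d"
  shows "triple_code (normalizer d ` T) \<in> set normal_codes"
proof -
  obtain a b c where a: "T = {a, b, c}" "a < b" "b < c" "0 \<le> a" "c < 48"
    "a div 12 \<le> b div 12" "b div 12 \<le> c div 12" "c div 12 \<le> 3" "b < 36"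
    "a div 12 < b div 12 \<and> b div 12 < 3 \<or> b div 12 < c div 12 \<and> c div 12 < 3"
    using triples_12_2_sorted[OF T] .
  have dd: "d = (if a div 12 = b div 12 then c else a)" and d36: "d < 36"
    using pivot_unique[OF d pivot_sorted(1)[OF a(6,7,10,2), folded a(1)]] pivot_sorted(2)[OF a(6,7,10,2)] by auto
  let ?f = "normalizer d"
  have fd: "?f k div 12 = k div 12" for k by (simp add: normalizer_def move_div_12)
  have ne: "?f a \<noteq> ?f b" "?f b \<noteq> ?f c"
    using a(2,3) inj_move by (auto simp: normalizer_def inj_eq)
  have pairs: "(i, j) \<in> {(0, 1), (0, 2), (1, 2)}" if "0 \<le> i" "i < j" "j < 3" for i j :: int
    using that by auto
  have ga: "0 \<le> a div 12" using a(4) by linarith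
  have lt: "u < v" if "u div 12 < v div 12" for u v :: int using that by linarith
  have in1: "(p * 48 + q) * 48 + 12 * j \<in> set normal_codes"
    if "0 \<le> i" "i < j" "j < 3" "p < q" "p div 12 = i" "q div 12 = i" for i j p q
  proof -
    have "p \<in> set [12 * i..12 * i + 11]" "q \<in> set [p + 1..12 * i + 11]" using that(4-6) by auto
    then have "(p * 48 + q) * 48 + 12 * j \<in> set (normal_codes_21 i j)"
      unfolding normal_codes_21_def set_concat set_map image_image by blast
    then show ?thesis unfolding normal_codes_def using pairs[OF that(1-3)] by auto
  qed
  have in2: "(12 * i * 48 + q) * 48 + r \<in> set normal_codes"
    if "0 \<le> i" "i < j" "j < 3" "q < r" "q div 12 = j" "r < 37 \<or> r = 42" for i j q r
  proof -
    have "q \<in> set [12 * j..12 * j + 11]" "r \<in> set ([q + 1..12 * j + 11] @ [12 * j + 12..36] @ [42])"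
      using that(4-6) by auto
    then have "(12 * i * 48 + q) * 48 + r \<in> set (normal_codes_12 i j)"
      unfolding normal_codes_12_def set_concat set_map image_image by blast
    then show ?thesis unfolding normal_codes_def using pairs[OF that(1-3)] by auto
  qed
  show ?thesis
  proof (cases "a div 12 = b div 12")
    case True
    have fc: "?f c = 12 * (c div 12)" using normalizer_self[OF d36] dd True by simp
    have g: "a div 12 < c div 12" "c div 12 < 3" using a(10) True by linarith+
    have l: "?f a < ?f c" "?f b < ?f c"
      by (rule lt, use True g(1) in \<open>simp only: fd\<close>)+
    show ?thesis
    proof (cases "?f a < ?f b")
      case ab: True
      have "?f ` T = {?f a, ?f b, ?f c}" using a(1) by simp
      then have "triple_code (?f ` T) = (?f a * 48 + ?f b) * 48 + 12 * (c div 12)"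
        by (metis triple_code_eq[OF ab l(2)] fc)
      then show ?thesis using in1[OF ga g ab fd fd[of b, folded True]] by (simp only:)
    next
      case False
      then have ba: "?f b < ?f a" using ne(1) by linarith
      have "?f ` T = {?f b, ?f a, ?f c}" using a(1) by (simp add: insert_commute)
      then have "triple_code (?f ` T) = (?f b * 48 + ?f a) * 48 + 12 * (c div 12)"
        by (metis triple_code_eq[OF ba l(1)] fc)
      then show ?thesis using in1[OF ga g ba fd[of b, folded True] fd] by (simp only:)
    qed
  next
    case False
    have fa: "?f a = 12 * (a div 12)" using normalizer_self[OF d36] dd False by simp
    have g: "a div 12 < b div 12" "b div 12 < 3" using a(6,9) False by linarith+
    have l: "?f a < ?f c" "?f a < ?f b"
      by (rule lt, use a(7) g(1) in \<open>simp only: fd\<close>)+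
    have "c \<in> points_12_2" using T a(1) by (auto simp: triples_12_2_def triples_def)
    then have "?f c \<in> points_12_2" unfolding normalizer_def by (rule move_points)
    then have fc: "?f c < 37 \<or> ?f c = 42" by (auto simp: points_12_2_def)
    have fb: "?f b < 37 \<or> ?f b = 42" using fd[of b] g(2) by linarith
    show ?thesis
    proof (cases "?f b < ?f c")
      case bc: True
      have "?f ` T = {?f a, ?f b, ?f c}" using a(1) by simp
      then have "triple_code (?f ` T) = (12 * (a div 12) * 48 + ?f b) * 48 + ?f c"
        by (metis triple_code_eq[OF l(2) bc] fa)
      then show ?thesis using in2[OF ga g bc fd fc] by (simp only:)
    next
      case cb': False
      then have cb: "?f c < ?f b" using ne(2) by linarith
      have "\<not> b div 12 < c div 12" using lt[of "?f b" "?f c"] cb' unfolding fd by blast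
      then have gc: "?f c div 12 = b div 12" using a(7) fd[of c] by linarith
      have "?f ` T = {?f a, ?f c, ?f b}" using a(1) by (simp add: insert_commute)
      then have "triple_code (?f ` T) = (12 * (a div 12) * 48 + ?f c) * 48 + ?f b"
        by (metis triple_code_eq[OF l(1) cb] fa)
      then show ?thesis using in2[OF ga g cb gc fb] by (simp only:)
    qed
  qed
qed

text \<open>The 165 base blocks stand for 1836 blocks, a quarter of the 7344 cross triples: 141
  orbits have length 12 and 24 have length 6. The short ones come from blocks such as
  \<open>[0, 6, 12, 18]\<close> and \<open>[0, 3, 18, 21]\<close>, made of two pairs that a
  translation of order two interchanges internally.\<close>

definition base_blocks_12_2 :: "int list list" where
  "base_blocks_12_2 =
    [[0, 1, 12, 23], [0, 1, 13, 14], [0, 1, 15, 19], [0, 1, 16, 21], [0, 1, 17, 18], [0, 1, 20, 22],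
     [0, 1, 24, 29], [0, 1, 25, 32], [0, 1, 26, 31], [0, 1, 27, 34], [0, 1, 28, 30], [0, 1, 33, 35],
     [0, 2, 12, 17], [0, 2, 13, 23], [0, 2, 14, 24], [0, 2, 15, 18], [0, 2, 16, 28], [0, 2, 19, 31],
     [0, 2, 20, 35], [0, 2, 21, 30], [0, 2, 22, 34], [0, 2, 25, 33], [0, 2, 26, 27], [0, 2, 29, 32],
     [0, 3, 12, 19], [0, 3, 13, 17], [0, 3, 18, 21], [0, 3, 20, 23], [0, 3, 24, 35], [0, 3, 25, 29],
     [0, 3, 30, 33], [0, 3, 31, 34], [0, 6, 12, 18], [0, 6, 13, 19], [0, 6, 14, 20], [0, 6, 15, 21],
     [0, 6, 16, 22], [0, 6, 17, 23], [0, 6, 24, 30], [0, 6, 25, 31], [0, 6, 26, 32], [0, 6, 27, 33],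
     [0, 6, 28, 34], [0, 6, 29, 35], [0, 7, 12, 21], [0, 7, 13, 35], [0, 7, 14, 30], [0, 7, 15, 26],
     [0, 7, 16, 20], [0, 7, 17, 32], [0, 7, 18, 25], [0, 7, 19, 22], [0, 7, 23, 34], [0, 7, 24, 27],
     [0, 7, 28, 31], [0, 7, 29, 33], [0, 8, 12, 22], [0, 8, 13, 31], [0, 8, 14, 15], [0, 8, 16, 17],
     [0, 8, 18, 20], [0, 8, 19, 25], [0, 8, 21, 23], [0, 8, 24, 26], [0, 8, 27, 29], [0, 8, 28, 32],
     [0, 8, 30, 35], [0, 8, 33, 34], [0, 9, 12, 24], [0, 9, 13, 29], [0, 9, 14, 28], [0, 9, 15, 27],
     [0, 9, 16, 26], [0, 9, 17, 25], [0, 12, 14, 32], [0, 12, 20, 33], [0, 12, 25, 27], [0, 12, 26, 36],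
     [0, 12, 29, 30], [0, 12, 31, 42], [0, 12, 34, 35], [0, 13, 16, 34], [0, 13, 18, 24], [0, 13, 20, 27],
     [0, 13, 25, 42], [0, 13, 26, 30], [0, 13, 28, 36], [0, 13, 32, 33], [0, 14, 17, 33], [0, 14, 19, 27],
     [0, 14, 21, 31], [0, 14, 25, 34], [0, 14, 29, 42], [0, 14, 35, 36], [0, 15, 17, 24], [0, 15, 23, 25],
     [0, 15, 28, 35], [0, 15, 29, 34], [0, 15, 30, 32], [0, 15, 31, 36], [0, 15, 33, 42], [0, 16, 18, 29],
     [0, 16, 19, 33], [0, 16, 24, 42], [0, 16, 25, 35], [0, 16, 30, 36], [0, 16, 31, 32], [0, 17, 19, 26],
     [0, 17, 20, 28], [0, 17, 27, 31], [0, 17, 29, 36], [0, 17, 34, 42], [0, 18, 22, 27], [0, 18, 23, 32],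
     [0, 18, 26, 42], [0, 18, 31, 35], [0, 18, 34, 36], [0, 19, 20, 24], [0, 19, 23, 30], [0, 19, 28, 42],
     [0, 19, 32, 36], [0, 20, 25, 36], [0, 20, 26, 29], [0, 20, 30, 42], [0, 21, 22, 29], [0, 21, 24, 34],
     [0, 21, 25, 28], [0, 21, 26, 35], [0, 21, 27, 36], [0, 21, 32, 42], [0, 22, 23, 26], [0, 22, 24, 28],
     [0, 22, 30, 31], [0, 22, 33, 36], [0, 22, 35, 42], [0, 23, 24, 36], [0, 23, 27, 42], [0, 23, 28, 33],
     [12, 13, 24, 25], [12, 13, 26, 29], [12, 13, 28, 33], [12, 13, 30, 31], [12, 14, 24, 33], [12, 14, 26, 28],
     [12, 14, 29, 31], [12, 14, 30, 34], [12, 15, 24, 27], [12, 15, 25, 26], [12, 15, 32, 35], [12, 18, 24, 30],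
     [12, 18, 25, 31], [12, 18, 26, 32], [12, 18, 27, 33], [12, 18, 28, 34], [12, 18, 29, 35], [12, 19, 24, 31],
     [12, 19, 25, 34], [12, 19, 27, 28], [12, 19, 29, 33], [12, 20, 24, 32], [12, 20, 26, 30], [12, 20, 29, 34],
     [12, 20, 31, 35], [12, 21, 24, 28], [12, 21, 25, 30]]"

definition base_block_ok :: "int list \<Rightarrow> bool" where
  "base_block_ok b \<longleftrightarrow> block_ok 48 b \<and> list_all (\<lambda>k. k \<le> 36 \<or> k = 42) b \<and>
     (case b of [p, q, r, s] \<Rightarrow> cross_valid 12 p q r \<and> cross_valid 12 p q s \<and> cross_valid 12 p r s \<and> cross_valid 12 q r s
      | _ \<Rightarrow> False)"

lemma base_blocks_ok: "list_all base_block_ok base_blocks_12_2"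
  by code_simp

lemma base_blocks_codes:
  "codes_check 48 (concat (map (block_codes norm_code) base_blocks_12_2)) normal_codes"
  by code_simp

lemma base_block:
  assumes "bl \<in> set base_blocks_12_2"
  shows "block_ok 48 bl" "card (set bl) = 4" "S \<subseteq> set bl \<Longrightarrow> card S = 3 \<Longrightarrow> S \<in> triples_12_2"
proof -
  have ok: "base_block_ok bl" using base_blocks_ok assms by (simp add: list_all_iff)
  then show bo: "block_ok 48 bl" by (simp add: base_block_ok_def)
  obtain p q r s where bl: "bl = [p, q, r, s]" "0 \<le> p" "p < q" "q < r" "r < s" "s < 48"
    using bo by (cases "(48 :: int, bl)" rule: block_ok.cases) auto
  then show "card (set bl) = 4" by auto
  assume S: "S \<subseteq> set bl" "card S = 3"
  obtain a b c where abc: "S = {a, b, c}" "a < b" "b < c" using triple_sorted[OF S(2)] .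
  \<comment> \<open>Used as a code function, the indicator of validity takes the value 1 at each of
    the four triples checked by \<open>base_block_ok\<close>, hence also at
    \<open>S\<close>.\<close>
  let ?\<phi> = "\<lambda>a b c _. if cross_valid 12 a b c then 1 else 0 :: int"
  have "card (set bl - S) = 1"
    using \<open>card (set bl) = 4\<close> S by (simp add: card_Diff_subset finite_subset)
  then obtain x where x: "set bl - S = {x}" using card_1_singletonE by blast
  have "x \<notin> {a, b, c}" "set bl = {a, b, c, x}" using x S(1) abc(1) by auto
  then have "?\<phi> a b c x \<in> set (block_codes ?\<phi> bl)"
    using block_codes_iff[OF bo, of "?\<phi> a b c x" ?\<phi>] abc(2,3) by blast
  moreover have "set (block_codes ?\<phi> bl) = {1}" using ok bl(1) by (simp add: base_block_ok_def)
  ultimately have v: "cross_valid 12 a b c" by (metis singletonD zero_neq_one)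
  have "set bl \<subseteq> points_12_2"
    using ok bl by (auto simp: base_block_ok_def points_12_2_def)
  then have "S \<subseteq> points_12_2" using S by simp
  moreover have "0 \<le> a" "c < 48" using S(1) bl abc by auto
  moreover have "fst ` split_point 12 ` S = (\<lambda>k. k div 12) ` S" by (simp add: image_image split_point_def)
  ultimately show "S \<in> triples_12_2"
    using cross_valid_iff[of 12 a b c] v abc S(2) by (simp add: triples_12_2_def triples_def)
qed

text \<open>A triple is moved to its normal form, where the certificate supplies a base block, and
  this block is moved back. For uniqueness, the pivot moves along with the triple, so two blocks
  through \<open>T\<close> give codes with the same key; injectivity identifies the normal forms of
  their fourth points.\<close>

lemma design_12_2:
  "quadruple_design triples_12_2 {move s t ` set bl | s t bl. bl \<in> set base_blocks_12_2}" (is "quadruple_design _ ?D")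
proof -
  define K where "K = set (concat (map (block_codes norm_code) base_blocks_12_2))"
  have im: "(\<lambda>k. k div 48) ` K = set normal_codes" and inj: "inj_on (\<lambda>k. k div 48) K"
    using codes_check_sound[OF base_blocks_codes] by (simp_all add: K_def)
  have sub48: "normalizer d ` T \<subseteq> {0..<48} \<and> card (normalizer d ` T) = 3" if "T \<in> triples_12_2" for d T
  proof -
    have "normalizer d ` T \<in> triples_12_2" unfolding normalizer_def by (rule move_triples[OF that])
    then have "normalizer d ` T \<subseteq> points_12_2" "card (normalizer d ` T) = 3"
      by (simp_all add: triples_12_2_def triples_def)
    moreover have "points_12_2 \<subseteq> {0..<48}" by (auto simp: points_12_2_def)
    ultimately show ?thesis by blast
  qed
  have code_div: "(triple_code S * 48 + normalizer d x) div 48 = triple_code S" if "x \<in> points_12_2" for S d x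
  proof -
    have "normalizer d x \<in> points_12_2" unfolding normalizer_def using that by (rule move_points)
    then have "0 \<le> normalizer d x" "normalizer d x < 48" by (auto simp: points_12_2_def)
    then show ?thesis by simp
  qed
  have blk_points: "set bl \<subseteq> points_12_2" if bl: "bl \<in> set base_blocks_12_2" for bl
  proof
    fix x assume "x \<in> set bl"
    then obtain T where "T \<subseteq> set bl" "card T = 3" "x \<in> T"
      using card3_in_card4 base_block(2)[OF bl] by metis
    then show "x \<in> points_12_2" using base_block(3)[OF bl, of T] by (auto simp: triples_12_2_def triples_def)
  qed
  show ?thesis
  proof (rule quadruple_designI)
    show "card T = 3" if "T \<in> triples_12_2" for T using that by (simp add: triples_12_2_def triples_def)
    show "card b = 4" if "b \<in> ?D" for b
      using that base_block(2) card_image[OF inj_on_subset[OF inj_move subset_UNIV]] by fastforce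
    show "T \<in> triples_12_2" if b: "b \<in> ?D" and T: "T \<subseteq> b" "card T = 3" for b T
    proof -
      obtain s t bl where bl: "b = move s t ` set bl" "bl \<in> set base_blocks_12_2" using b by blast
      obtain S where S: "S \<subseteq> set bl" "T = move s t ` S" using T(1) bl(1) by (auto simp: subset_image_iff)
      have "card S = 3" using S(2) T(2) card_image[OF inj_on_subset[OF inj_move subset_UNIV]] by metis
      then have "S \<in> triples_12_2" using base_block(3)[OF bl(2) S(1)] by simp
      then show ?thesis using move_triples S(2) by simp
    qed
    show "\<exists>b\<in>?D. T \<subseteq> b" if T: "T \<in> triples_12_2" for T
    proof -
      obtain d where d: "pivot T d" "d < 36" using ex_pivot[OF T] by blast
      have "triple_code (normalizer d ` T) \<in> (\<lambda>k. k div 48) ` K"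
        unfolding im by (rule normal_code_in[OF T d(1)])
      then obtain k where k: "triple_code (normalizer d ` T) = k div 48" "k \<in> K" by (rule imageE)
      obtain bl where bl: "bl \<in> set base_blocks_12_2" "k \<in> set (block_codes norm_code bl)"
        using k(2) unfolding K_def set_concat set_map image_image by blast
      obtain a b c x where S: "a < b" "b < c" "x \<notin> {a, b, c}" "set bl = {a, b, c, x}" "k = norm_code a b c x"
        using bl(2) block_codes_iff[OF base_block(1)[OF bl(1)], of k norm_code] by blast
      have S3: "{a, b, c} \<in> triples_12_2" by (rule base_block(3)[OF bl(1)]) (use S in auto)
      obtain e where e: "pivot {a, b, c} e" using ex_pivot[OF S3] by blast
      have x: "x \<in> points_12_2" using blk_points[OF bl(1)] S(4) by auto
      have "triple_code (normalizer e ` {a, b, c}) = triple_code (normalizer d ` T)"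
        unfolding k(1) S(5) norm_code_eq[OF S3 S(1,2) e] code_div[OF x] ..
      then have eq: "normalizer e ` {a, b, c} = normalizer d ` T"
        by (rule triple_code_inj) (use sub48[OF S3] sub48[OF T] in auto)
      obtain s t where nd: "normalizer d = move s t" by (auto simp: normalizer_def)
      obtain s' t' where ne: "normalizer e = move s' t'" by (auto simp: normalizer_def)
      have "T = move (- s) (- t) ` move s t ` T" unfolding image_image move_inverse by simp
      also have "\<dots> = move (- s) (- t) ` move s' t' ` {a, b, c}" using eq unfolding nd ne by metis
      also have "\<dots> = move (- s + s') (- t + t') ` {a, b, c}" unfolding image_image move_move ..
      also have "\<dots> \<subseteq> move (- s + s') (- t + t') ` set bl" using S(4) by auto
      finally show ?thesis using bl(1) by blast
    qed
    show "b = b'" if T: "T \<in> triples_12_2" and b: "b \<in> ?D" "b' \<in> ?D" "T \<subseteq> b" "T \<subseteq> b'" for T b b'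
    proof -
      obtain d where d: "pivot T d" "d < 36" using ex_pivot[OF T] by blast
      have *: "\<exists>y. c = insert y T \<and> triple_code (normalizer d ` T) * 48 + normalizer d y \<in> K \<and> y \<in> points_12_2"
        if c: "c \<in> ?D" "T \<subseteq> c" for c
      proof -
        obtain s t bl where bl: "c = move s t ` set bl" "bl \<in> set base_blocks_12_2" using c(1) by blast
        obtain S where S: "S \<subseteq> set bl" "T = move s t ` S" using c(2) bl(1) by (auto simp: subset_image_iff)
        have "card S = 3"
          using S(2) T card_image[OF inj_on_subset[OF inj_move subset_UNIV], of s t S]
          by (simp add: triples_12_2_def triples_def)
        then obtain p q r where pqr: "S = {p, q, r}" "p < q" "q < r" using triple_sorted by blast
        have S3: "S \<in> triples_12_2" using base_block(3)[OF bl(2) S(1) \<open>card S = 3\<close>] .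
        obtain e where e: "pivot S e" "e < 36" using ex_pivot[OF S3] by blast
        have de: "d = move s t e" using pivot_unique[OF d(1)] pivot_move[OF e(1), of s t] S(2) by simp
        have "card (set bl - S) = 1"
          using base_block(2)[OF bl(2)] S(1) \<open>card S = 3\<close> by (simp add: card_Diff_subset finite_subset)
        then obtain x where x: "set bl - S = {x}" using card_1_singletonE by blast
        then have bx: "set bl = {p, q, r, x}" "x \<notin> {p, q, r}" using S(1) pqr(1) by auto
        then have "norm_code p q r x \<in> set (block_codes norm_code bl)"
          using block_codes_iff[OF base_block(1)[OF bl(2)], of "norm_code p q r x" norm_code] pqr by blast
        then have "norm_code p q r x \<in> K" unfolding K_def set_concat set_map image_image using bl(2) by blast
        moreover have "norm_code p q r x = triple_code (normalizer e ` S) * 48 + normalizer e x"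
          using norm_code_eq[of p q r e x] S3 e(1) pqr by simp
        moreover have "normalizer d ` T = normalizer e ` S"
          unfolding S(2) image_image de by (intro image_cong normalizer_move[OF e(2)] refl)
        moreover have "normalizer d (move s t x) = normalizer e x"
          unfolding de by (rule normalizer_move[OF e(2)])
        moreover have "c = insert (move s t x) T" using bl(1) bx S(2) pqr(1) by auto
        moreover have "move s t x \<in> points_12_2" using blk_points[OF bl(2)] bx by (auto intro: move_points)
        ultimately show ?thesis by metis
      qed
      obtain y where y: "b = insert y T" "triple_code (normalizer d ` T) * 48 + normalizer d y \<in> K" "y \<in> points_12_2"
        using *[OF b(1,3)] by blast
      obtain y' where y': "b' = insert y' T" "triple_code (normalizer d ` T) * 48 + normalizer d y' \<in> K" "y' \<in> points_12_2"
        using *[OF b(2,4)] by blast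
      have "triple_code (normalizer d ` T) * 48 + normalizer d y = triple_code (normalizer d ` T) * 48 + normalizer d y'"
        by (rule inj_onD[OF inj _ y(2) y'(2)]) (simp only: code_div[OF y(3)] code_div[OF y'(3)])
      then have "normalizer d y = normalizer d y'" by simp
      then have "y = y'" using inj_move by (simp add: normalizer_def inj_eq)
      then show ?thesis using y(1) y'(1) by simp
    qed
  qed
qed

lemma cross_design_12_2: "\<exists>D. quadruple_design (cross_triples (3::int) (weighted {0..<4} 3 12 2)) D"
proof -
  define f :: "int \<Rightarrow> int \<times> int" where "f k = (k div 12, if k < 36 then k mod 12 else (k - 36) div 6)" for k
  have inj: "inj_on f points_12_2"
  proof (rule inj_onI)
    fix k l assume kl: "k \<in> points_12_2" "l \<in> points_12_2" "f k = f l"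
    then have d: "k div 12 = l div 12" by (simp add: f_def)
    show "k = l"
    proof (cases "k < 36")
      case True
      then have "k div 12 < 3" by linarith
      then have "l < 36" unfolding d by linarith
      then have "k mod 12 = l mod 12" using kl(3) True by (simp add: f_def)
      then show ?thesis using d by (metis div_mult_mod_eq)
    next
      case False
      then have "\<not> k div 12 < 3" by linarith
      then have "\<not> l < 36" unfolding d by linarith
      then have "k \<in> {36, 42}" "l \<in> {36, 42}" using kl(1,2) False by (auto simp: points_12_2_def)
      then show ?thesis using kl(3) by (auto simp: f_def)
    qed
  qed
  have im: "f ` points_12_2 = weighted {0..<4} 3 12 2"
  proof -
    have "f ` {0..<36} = {0..<3} \<times> {0..<12}"
    proof
      have "f k \<in> {0..<3} \<times> {0..<12}" if "0 \<le> k" "k < 36" for k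
      proof -
        have "0 \<le> k div 12" "k div 12 < 3" using that by linarith+
        then show ?thesis using that by (simp add: f_def)
      qed
      then show "f ` {0..<36} \<subseteq> {0..<3} \<times> {0..<12}" by force
      show "{0..<3} \<times> {0..<12} \<subseteq> f ` {0..<36}"
      proof
        fix p :: "int \<times> int" assume p: "p \<in> {0..<3} \<times> {0..<12}"
        then have "p = f (12 * fst p + snd p)" by (auto simp: f_def prod_eq_iff)
        moreover have "12 * fst p + snd p \<in> {0..<36}" using p by auto
        ultimately show "p \<in> f ` {0..<36}" by blast
      qed
    qed
    moreover have "{0..<4} - {3} = {0..<3::int}" "{0..<2} = {0, 1::int}" by auto
    ultimately show ?thesis unfolding points_12_2_def weighted_def image_Un by (auto simp: f_def)
  qed
  have "quadruple_design ((`) f ` triples_12_2) ((`) f ` {move s t ` set bl | s t bl. bl \<in> set base_blocks_12_2})"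
    by (rule quadruple_design_image[OF design_12_2 inj]) (auto simp: triples_12_2_def triples_def)
  moreover have "(`) f ` triples_12_2 = cross_triples 3 (weighted {0..<4} 3 12 2)"
  proof -
    have "fst ` f ` T = (\<lambda>k. k div 12) ` T" for T by (simp add: image_image f_def)
    then show ?thesis
      unfolding cross_triples_def im[symmetric] triples_image[OF inj] triples_12_2_def
      by (auto simp del: image_image)
  qed
  ultimately show ?thesis by auto
qed

section \<open>Weighting with two special points: from order k to 4k - 6\<close>

text \<open>Meant for triples in two groups of size 4: the lower group is read as 0 to 3, the upper
  one as 4 to 7. The order of the base points is essential, since the families of patterns used
  later are not symmetric in the two groups.\<close>

definition pattern :: "('p::linorder \<times> int) set \<Rightarrow> int set" where
  "pattern T = (\<lambda>(p, x). (if p = Min (fst ` T) then 0 else 4) + x) ` T"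

text \<open>Triples over three base points belong to every type, as the base block through these
  points has to cover all of them. Those over two base points are shared out between the special
  points by pattern.\<close>

definition typed_triples :: "int set set \<Rightarrow> 'p::linorder \<Rightarrow> ('p \<times> int) set \<Rightarrow> ('p \<times> int) set set" where
  "typed_triples \<A> \<alpha> X = {T \<in> cross_triples \<alpha> X. card (fst ` T) = 3 \<or> pattern T \<in> \<A>}"

text \<open>Monotonicity on the three ordinary groups preserves patterns. The label 3 goes to
  \<alpha> wherever \<alpha> lies in the order.\<close>

lemma ex_mono_bij_betw_block:
  fixes b :: "nat set"
  assumes "card b = 4" "\<alpha> \<in> b"
  obtains h :: "int \<Rightarrow> nat" where "bij_betw h {0..<4} b" "h 3 = \<alpha>" "strict_mono_on {0..<3} h"
proof -
  have "finite b" using assms(1) card.infinite by fastforce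
  then have 3: "card (b - {\<alpha>}) = 3" using assms by simp
  define xs where "xs = sorted_list_of_set (b - {\<alpha>})"
  have len: "length xs = 3" and set: "set xs = b - {\<alpha>}" and srt: "sorted_wrt (<) xs"
    using 3 \<open>finite b\<close> by (simp_all add: xs_def)
  define h where "h = (\<lambda>i::int. if i = 3 then \<alpha> else xs ! nat i)"
  have mono: "strict_mono_on {0..<3} h"
    using srt len by (auto simp: strict_mono_on_def h_def sorted_wrt_iff_nth_less)
  have "h ` {0..<3} = set xs"
  proof
    show "h ` {0..<3} \<subseteq> set xs" using len by (auto simp: h_def)
    show "set xs \<subseteq> h ` {0..<3}"
    proof
      fix p assume "p \<in> set xs"
      then obtain j where "j < 3" "p = xs ! j" using len by (metis in_set_conv_nth)
      then have "p = h (int j)" "int j \<in> {0..<3}" by (auto simp: h_def)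
      then show "p \<in> h ` {0..<3}" by blast
    qed
  qed
  moreover have "{0..<4::int} = insert 3 {0..<3}" by auto
  ultimately have "h ` {0..<4} = insert (h 3) (b - {\<alpha>})" using set by simp
  then have im: "h ` {0..<4} = b" using assms by (auto simp: h_def)
  then have "inj_on h {0..<4}" using assms by (intro eq_card_imp_inj_on) auto
  then show ?thesis using that[of h] im mono by (simp add: bij_betw_def h_def)
qed

lemma pattern_map_prod:
  fixes h :: "'p::linorder \<Rightarrow> 'q::linorder"
  assumes "finite T" "T \<noteq> {}" "strict_mono_on S h" "fst ` T \<subseteq> S"
  shows "pattern (map_prod h id ` T) = pattern T"
proof -
  have ne: "finite (fst ` T)" "fst ` T \<noteq> {}" using assms by auto
  have "fst ` map_prod h id ` T = h ` fst ` T" by force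
  moreover have "Min (h ` fst ` T) = h (Min (fst ` T))"
  proof (rule Min_eqI)
    fix y assume "y \<in> h ` fst ` T"
    then obtain x where x: "x \<in> fst ` T" "y = h x" by blast
    then show "h (Min (fst ` T)) \<le> y"
      using strict_mono_on_leD[OF assms(3)] ne assms(4) Min_le[OF ne(1) x(1)] Min_in[OF ne] by blast
  qed (use ne in auto)
  moreover have "h p = h (Min (fst ` T)) \<longleftrightarrow> p = Min (fst ` T)" if "p \<in> fst ` T" for p
    using strict_mono_on_imp_inj_on[OF assms(3)] assms(4) that Min_in[OF ne] by (auto simp: inj_on_def)
  ultimately show ?thesis
    unfolding pattern_def image_image by (intro image_cong) (force split: prod.splits)+
qed

lemma typed_design_on_block:
  fixes b :: "nat set"
  assumes D: "quadruple_design (typed_triples \<A> (3::int) (weighted {0..<4} 3 g k)) D"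
    and b: "card b = 4" "\<alpha> \<in> b"
  shows "\<exists>B. quadruple_design (typed_triples \<A> \<alpha> (weighted b \<alpha> g k)) B"
proof -
  obtain h :: "int \<Rightarrow> nat" where h: "bij_betw h {0..<4} b" "h 3 = \<alpha>" "strict_mono_on {0..<3} h"
    using ex_mono_bij_betw_block[OF b] by blast
  have inj: "inj_on h {0..<4}" and im: "h ` {0..<4} = b" using h by (auto simp: bij_betw_def)
  let ?f = "map_prod h id" and ?L = "weighted {0..<4} (3::int) g k"
  have "quadruple_design ((`) ?f ` typed_triples \<A> 3 ?L) ((`) ?f ` D)"
    using D
  proof (rule quadruple_design_image)
    show "inj_on ?f ?L"
      by (rule inj_on_subset[OF map_prod_inj_on[OF inj inj_on_id[of UNIV]]]) (auto simp: weighted_def)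
  qed (auto simp: typed_triples_def cross_triples_def triples_def)
  moreover have cr: "cross_triples \<alpha> (weighted b \<alpha> g k) = (`) ?f ` cross_triples 3 ?L"
    using cross_triples_image[OF inj, of 3 ?L] map_prod_weighted[OF inj, of 3]
      fst_weighted[of "3::int" "{0..<4}" g k] im h(2) by simp
  have iff: "card (fst ` ?f ` T) = 3 \<or> pattern (?f ` T) \<in> \<A> \<longleftrightarrow> card (fst ` T) = 3 \<or> pattern T \<in> \<A>"
    if T: "T \<in> cross_triples 3 ?L" for T
  proof -
    have sub: "fst ` T \<subseteq> {0..<4}" and TL: "T \<in> triples ?L"
      using T fst_weighted[of "3::int" "{0..<4}" g k] by (auto simp: cross_triples_def triples_def)
    have fin: "finite T" "T \<noteq> {}" using triples_card3[OF TL] by auto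
    have "fst ` ?f ` T = h ` fst ` T" by force
    then have c: "card (fst ` ?f ` T) = card (fst ` T)" using inj sub by (metis card_image inj_on_subset)
    show ?thesis
    proof (cases "card (fst ` T) = 3")
      case False
      \<comment> \<open>A cross triple over two base points avoids the stem, the only label at which
        \<open>h\<close> may fail to be monotone.\<close>
      have "3 \<notin> fst ` T"
      proof
        assume "3 \<in> fst ` T"
        then have "card (fst ` T - {3}) = card (fst ` T) - 1" using fin by simp
        moreover have "card (fst ` T - {3}) \<ge> 2" using T by (simp add: cross_triples_def)
        moreover have "card (fst ` T) \<le> 3" using triples_card3[OF TL] card_image_le[of T fst] by simp
        ultimately show False using False by linarith
      qed
      then have "fst ` T \<subseteq> {0..<3}" using sub by force
      then show ?thesis using pattern_map_prod[OF fin h(3)] c False by simp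
    qed (use c in simp)
  qed
  have "(`) ?f ` typed_triples \<A> 3 ?L = typed_triples \<A> \<alpha> (weighted b \<alpha> g k)"
    unfolding typed_triples_def cr using iff by blast
  ultimately show ?thesis by auto
qed

definition unsplit :: "nat \<Rightarrow> nat \<Rightarrow> int \<Rightarrow> nat \<times> int" where
  "unsplit P Q c = (if c < 4 then P else Q, c mod 4)"

lemma pattern_unsplit:
  assumes "P < Q" "S \<subseteq> {0..<8}" "finite S" "\<exists>c\<in>S. c < 4" "\<exists>c\<in>S. \<not> c < 4"
  shows "fst ` unsplit P Q ` S = {P, Q}" "pattern (unsplit P Q ` S) = S"
proof -
  show fs: "fst ` unsplit P Q ` S = {P, Q}" using assms by (force simp: unsplit_def image_image)
  have "Min {P, Q} = P" using assms(1) by simp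
  then have "pattern (unsplit P Q ` S) = (\<lambda>c. (if c < 4 then 0 else 4) + c mod 4) ` S"
    unfolding pattern_def fs using assms(1) by (auto simp: unsplit_def image_image)
  also have "\<dots> = id ` S"
  proof (rule image_cong)
    fix c assume "c \<in> S"
    then have "0 \<le> c" "c < 8" using assms by auto
    then show "(if c < 4 then 0 else 4) + c mod 4 = id c"
      using mod_pos_pos_trivial[of c 4] mod_pos_pos_trivial[of "c - 4" 4] by auto
  qed simp
  finally show "pattern (unsplit P Q ` S) = S" by simp
qed

lemma unsplit_pattern:
  assumes "P < Q" "fst ` T = {P, Q}" "T \<subseteq> {P, Q} \<times> {0..<4}" "card T = 3"
  shows "unsplit P Q ` pattern T = T" "pattern T \<subseteq> {0..<8}" "card (pattern T) = 3"
    "\<exists>c\<in>pattern T. c < 4" "\<exists>c\<in>pattern T. \<not> c < 4"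
proof -
  let ?g = "\<lambda>(p, x). (if p = P then 0 else 4) + x :: int"
  have "Min {P, Q} = P" using assms(1) by simp
  then have pt: "pattern T = ?g ` T" unfolding pattern_def assms(2) by simp
  have inv: "unsplit P Q (?g p) = p" if "p \<in> T" for p
    using that assms(1,3) by (auto simp: unsplit_def)
  then have "unsplit P Q ` ?g ` T = id ` T" unfolding image_image by (intro image_cong) auto
  then show "unsplit P Q ` pattern T = T" by (simp add: pt)
  show sub: "pattern T \<subseteq> {0..<8}" unfolding pt using assms(3) by auto
  have "inj_on ?g T" using inv by (rule inj_on_inverseI)
  then show "card (pattern T) = 3" by (simp add: pt card_image assms(4))
  obtain p q where p: "p \<in> T" "fst p = P" "q \<in> T" "fst q = Q" using assms(2) by (metis imageE insertCI)
  have "?g p < 4" "\<not> ?g q < 4" using p assms(1,3) by (auto split: prod.splits)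
  then show "\<exists>c\<in>pattern T. c < 4" "\<exists>c\<in>pattern T. \<not> c < 4" unfolding pt using p by blast+
qed

lemma inj_unsplit: "P < Q \<Longrightarrow> inj_on (unsplit P Q) {0..<8}"
proof (rule inj_onI)
  fix c d assume "P < Q" "c \<in> {0..<8}" "d \<in> {0..<8}" "unsplit P Q c = unsplit P Q d"
  then have "c < 4 \<longleftrightarrow> d < 4" "c mod 4 = d mod 4" "0 \<le> c" "c < 8" "0 \<le> d" "d < 8"
    by (auto simp: unsplit_def split: if_splits)
  moreover have "x mod 4 = (if x < 4 then x else x - 4)" if "0 \<le> x" "x < 8" for x :: int
    using that mod_pos_pos_trivial[of x 4] mod_pos_pos_trivial[of "x - 4" 4] by auto
  ultimately show "c = d" by (metis add_diff_cancel_right' diff_add_cancel)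
qed

text \<open>The base points 0 and 1 keep weight one, all others get weight four. A base block
  through both carries ten points and is filled by a whole system; a block through one of them gets
  a typed design, any other block a transversal design. A triple over \<open>P < Q\<close> alone
  could be covered over \<open>{0, P, Q}\<close> or over \<open>{1, P, Q}\<close>: the patterns in
  \<A> go to 0, those in \<B> to 1, and those in \<W> are covered inside the two groups. If 0, 1,
  \<open>P\<close>, \<open>Q\<close> form a block, its system of order 10 already covers everything,
  so \<W> is used only for unmatched pairs.\<close>

theorem sqs_order_two_point_weighting:
  assumes Z: "sqs_order n" and n: "n \<ge> 3" and F: "sqs_order 10"
    and DA: "quadruple_design (typed_triples \<A> (3::int) (weighted {0..<4} 3 4 1)) D\<^sub>1"
    and DB: "quadruple_design (typed_triples \<B> (3::int) (weighted {0..<4} 3 4 1)) D\<^sub>2"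
    and DW: "quadruple_design \<W> D\<^sub>3"
    and disj: "\<A> \<inter> \<B> = {}" "\<A> \<inter> \<W> = {}" "\<B> \<inter> \<W> = {}"
    and cover: "\<And>S. S \<subseteq> {0..<8} \<Longrightarrow> card S = 3 \<Longrightarrow> \<exists>c\<in>S. c < 4 \<Longrightarrow> \<exists>c\<in>S. \<not> c < 4 \<Longrightarrow> S \<in> \<A> \<union> \<B> \<union> \<W>"
    and W: "\<And>S. S \<in> \<W> \<Longrightarrow> S \<subseteq> {0..<8} \<and> (\<exists>c\<in>S. c < 4) \<and> (\<exists>c\<in>S. \<not> c < 4)"
  shows "sqs_order (4 * (n - 2) + 2)"
proof -
  obtain \<BB> where BB: "sqs {..<n} \<BB>" using Z by (auto simp: sqs_order_def)
  have bb: "card b = 4" "b \<subseteq> {..<n}" "finite b" if "b \<in> \<BB>" for b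
    using quadruple_designD(2)[OF BB that] sqs_block_subset[OF BB that] finite_subset by auto
  have share: "b = b'" if S: "b \<in> \<BB>" "b' \<in> \<BB>" "S \<subseteq> b" "S \<subseteq> b'" "card S \<ge> 3" for b b' S
  proof -
    obtain S' where S': "S' \<subseteq> S" "card S' = 3" using obtain_subset_with_card_n[OF S(5)] by blast
    then show ?thesis using quadruple_designD(5)[OF BB S(1,2), of S'] S(3,4) by blast
  qed
  have ex: "\<exists>b\<in>\<BB>. {p, q, r} \<subseteq> b" if "p < n" "q < n" "r < n" "p \<noteq> q" "q \<noteq> r" "p \<noteq> r" for p q r
    using quadruple_designD(4)[OF BB, of "{p, q, r}"] that by (auto simp: triples_def)
  define X :: "(nat \<times> int) set" where "X = {..<2} \<times> {0..<1} \<union> {2..<n} \<times> {0..<4}"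
  have finX: "finite X" by (simp add: X_def)
  have fX: "fst ` X \<subseteq> {..<n}" using n by (auto simp: X_def)
  define E where "E b = {p \<in> X. fst p \<in> b}" for b
  have X_iff: "(p, x) \<in> X \<longleftrightarrow> p < n \<and> 0 \<le> x \<and> x < (if p = 0 \<or> p = 1 then 1 else 4)" for p x
    using n by (cases "p = 0"; cases "p = 1") (auto simp: X_def)
  have E0: "E b = weighted b 0 4 1" if "b \<in> \<BB>" "0 \<in> b" "1 \<notin> b" for b
  proof -
    have "(p, x) \<in> E b \<longleftrightarrow> (p, x) \<in> weighted b 0 4 1" for p x
      using that bb(2)[OF that(1)] by (cases "p = 0"; cases "p = 1") (auto simp: E_def X_iff weighted_def)
    then show ?thesis by auto
  qed
  have E1: "E b = weighted b 1 4 1" if "b \<in> \<BB>" "1 \<in> b" "0 \<notin> b" for b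
  proof -
    have "(p, x) \<in> E b \<longleftrightarrow> (p, x) \<in> weighted b 1 4 1" for p x
      using that bb(2)[OF that(1)] by (cases "p = 0"; cases "p = 1") (auto simp: E_def X_iff weighted_def)
    then show ?thesis by auto
  qed
  define \<T> where "\<T> b = (if 0 \<in> b \<and> 1 \<in> b then triples (E b)
     else if 0 \<in> b then typed_triples \<A> 0 (E b) else if 1 \<in> b then typed_triples \<B> 1 (E b)
     else {T. T \<subseteq> b \<times> {0..<4} \<and> card T = 3 \<and> card (fst ` T) = 3})" for b
  have Tb: "T \<in> triples X" "fst ` T \<subseteq> b" if "b \<in> \<BB>" "T \<in> \<T> b" for b T
  proof -
    show f: "fst ` T \<subseteq> b"
      using that(2) by (fastforce simp: \<T>_def typed_triples_def cross_triples_def triples_def E_def split: if_splits)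
    show "T \<in> triples X"
    proof (cases "0 \<in> b \<or> 1 \<in> b")
      case True
      then show ?thesis using that(2)
        by (fastforce simp: \<T>_def typed_triples_def cross_triples_def triples_def E_def split: if_splits)
    next
      case False
      then have T: "T \<subseteq> b \<times> {0..<4}" "card T = 3" using that(2) by (auto simp: \<T>_def)
      have "p \<in> {2..<n}" if "p \<in> b" for p
      proof -
        have "p \<noteq> 0" "p \<noteq> 1" using that False by metis+
        then show ?thesis using that bb(2)[OF \<open>b \<in> \<BB>\<close>] by auto
      qed
      then show ?thesis using T by (auto simp: triples_def X_def)
    qed
  qed
  have "\<exists>B. quadruple_design (\<T> b) B" if b: "b \<in> \<BB>" for b
  proof -
    consider "0 \<in> b \<and> 1 \<in> b" | "0 \<in> b" "1 \<notin> b" | "1 \<in> b" "0 \<notin> b" | "0 \<notin> b" "1 \<notin> b" by blast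
    then show ?thesis
    proof cases
      case 1
      define b' where "b' = b - {0, 1}"
      have b': "b = insert 0 (insert 1 b')" "finite b'" "card b' = 2" "0 \<notin> b'" "1 \<notin> b'"
        using 1 bb[OF b] by (auto simp: b'_def card_Diff_subset)
      have "E b = {0, 1} \<times> {0..<1} \<union> b' \<times> {0..<4}"
      proof -
        have "p \<in> {2..<n}" if "p \<in> b'" for p
        proof -
          have "p \<noteq> 0" "p \<noteq> 1" using that b'(4,5) by metis+
          then show ?thesis using that bb(2)[OF b] by (auto simp: b'_def)
        qed
        then show ?thesis
          unfolding E_def X_def b'(1) by (auto simp: numeral_2_eq_2 less_Suc_eq)
      qed
      then have "card (E b) = card ({0, 1::nat} \<times> {0..<1::int}) + card (b' \<times> {0..<4::int})"
        using b'(2,4,5) by (simp only:) (intro card_Un_disjoint, auto)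
      then have "card (E b) = 10" using b'(3) by (simp add: card_cartesian_product)
      moreover have "finite (E b)" using finX by (simp add: E_def)
      ultimately show ?thesis using sqs_order_imp_sqs[OF F] 1 by (simp add: \<T>_def)
    next
      case 2
      then show ?thesis using typed_design_on_block[OF DA bb(1)[OF b]] E0[OF b] by (simp add: \<T>_def)
    next
      case 3
      then show ?thesis using typed_design_on_block[OF DB bb(1)[OF b]] E1[OF b] by (simp add: \<T>_def)
    next
      case 4
      then show ?thesis using transversal_design[OF bb(1)[OF b], of 4] by (auto simp: \<T>_def)
    qed
  qed
  then obtain B where B: "\<And>b. b \<in> \<BB> \<Longrightarrow> quadruple_design (\<T> b) (B b)" by metis
  have design1: "quadruple_design (\<Union>b\<in>\<BB>. \<T> b) (\<Union>b\<in>\<BB>. B b)"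
  proof (rule quadruple_design_UN[OF B])
    fix b b' T assume b: "b \<in> \<BB>" "b' \<in> \<BB>" "T \<in> \<T> b" "T \<in> \<T> b'"
    have sub: "fst ` T \<subseteq> b" "fst ` T \<subseteq> b'" using Tb b by blast+
    have TX: "T \<in> triples X" using Tb b by blast
    have fin: "finite (fst ` T)" using triples_card3[OF TX] by simp
    show "b = b'"
    proof (cases "card (fst ` T) = 3")
      case True
      then show ?thesis using share[OF b(1,2) sub] by simp
    next
      case False
      \<comment> \<open>Over fewer than three base points, a triple reaches \<open>c\<close> only
        through a special point. Two different special points are kept apart by the disjointness of
        \<A> and \<B>.\<close>
      have *: "(0 \<in> c \<and> 1 \<in> c) \<or> (0 \<in> c \<and> 1 \<notin> c \<and> card (fst ` T - {0}) \<ge> 2 \<and> pattern T \<in> \<A>)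
        \<or> (1 \<in> c \<and> 0 \<notin> c \<and> card (fst ` T - {1}) \<ge> 2 \<and> pattern T \<in> \<B>)" if "T \<in> \<T> c" for c
        using that False by (auto simp: \<T>_def typed_triples_def cross_triples_def split: if_splits)
      have i: "b = b'" if "i \<in> b" "i \<in> b'" "card (fst ` T - {i}) \<ge> 2" for i
      proof -
        have "card (insert i (fst ` T - {i})) = Suc (card (fst ` T - {i}))"
          by (rule card_insert_disjoint) (use fin in auto)
        then have "card (insert i (fst ` T - {i})) \<ge> 3" using that(3) by linarith
        then show ?thesis using share[OF b(1,2), of "insert i (fst ` T - {i})"] that sub by blast
      qed
      have 01: "b = b'" if "0 \<in> b" "1 \<in> b" "0 \<in> b'" "1 \<in> b'"
      proof -
        have "\<not> fst ` T \<subseteq> {0, 1}"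
        proof
          assume "fst ` T \<subseteq> {0, 1}"
          then have "T \<subseteq> {0, 1} \<times> {0..<1}" using TX by (fastforce simp: triples_def X_def)
          then have "card T \<le> card ({0, 1::nat} \<times> {0..<1::int})" by (intro card_mono) auto
          then show False using TX by (simp add: triples_def card_cartesian_product)
        qed
        then obtain p where p: "p \<in> fst ` T" "p \<notin> {0, 1}" by (meson subsetI)
        then have "card {0, 1, p} = 3" by simp
        moreover have "{0, 1, p} \<subseteq> b" "{0, 1, p} \<subseteq> b'" using that subsetD[OF sub(1) p(1)] subsetD[OF sub(2) p(1)] by simp_all
        ultimately show ?thesis using share[OF b(1,2), of "{0, 1, p}"] by linarith
      qed
      show ?thesis using *[OF b(3)] *[OF b(4)] i[of 0] i[of 1] 01 disj(1) by blast
    qed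
  qed
  define unmatched where "unmatched = {(P, Q). 2 \<le> P \<and> P < Q \<and> Q < n \<and> (\<forall>b\<in>\<BB>. \<not> {0, 1, P, Q} \<subseteq> b)}"
  define \<U> where "\<U> = (\<lambda>(P, Q). (`) (unsplit P Q) ` \<W>)"
  have U: "fst ` T = {P, Q} \<and> pattern T \<in> \<W> \<and> T \<in> triples X" if "(P, Q) \<in> unmatched" "T \<in> \<U> (P, Q)" for P Q T
  proof -
    from that obtain S where S: "S \<in> \<W>" "T = unsplit P Q ` S" by (auto simp: \<U>_def)
    have PQ: "P < Q" "2 \<le> P" "Q < n" using that by (auto simp: unmatched_def)
    have S': "S \<subseteq> {0..<8}" "card S = 3" using W[OF S(1)] quadruple_designD(1)[OF DW S(1)] by auto
    then have "finite S" using finite_subset by blast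
    then have "fst ` T = {P, Q}" "pattern T = S"
      using pattern_unsplit[OF PQ(1) S'(1)] W[OF S(1)] S(2) by auto
    moreover have "card T = 3"
      unfolding S(2) using S' inj_unsplit[OF PQ(1)] by (metis card_image inj_on_subset)
    moreover have "unsplit P Q c \<in> X" for c using PQ by (cases "c < 4") (auto simp: unsplit_def X_def)
    then have "T \<subseteq> X" unfolding S(2) by blast
    ultimately show ?thesis using S by (simp add: triples_def)
  qed
  have "quadruple_design (\<Union>i\<in>unmatched. \<U> i) (\<Union>i\<in>unmatched. case i of (P, Q) \<Rightarrow> (`) (unsplit P Q) ` D\<^sub>3)"
  proof (rule quadruple_design_UN)
    fix i assume "i \<in> unmatched"
    then obtain P Q where i: "i = (P, Q)" "P < Q" by (auto simp: unmatched_def)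
    show "quadruple_design (\<U> i) (case i of (P, Q) \<Rightarrow> (`) (unsplit P Q) ` D\<^sub>3)"
      using quadruple_design_image[OF DW inj_unsplit[OF i(2)]] W i by (simp add: \<U>_def)
  next
    fix i j T assume *: "i \<in> unmatched" "j \<in> unmatched" "T \<in> \<U> i" "T \<in> \<U> j"
    obtain P Q P' Q' where ij: "i = (P, Q)" "j = (P', Q')" by fastforce
    have "{P, Q} = {P', Q'}" using U * ij by metis
    moreover have "P < Q" "P' < Q'" using * ij by (auto simp: unmatched_def)
    ultimately show "i = j" using ij by (auto simp: doubleton_eq_iff)
  qed
  then obtain B\<^sub>2 where design2: "quadruple_design (\<Union>i\<in>unmatched. \<U> i) B\<^sub>2" by blast
  have "(\<Union>b\<in>\<BB>. \<T> b) \<inter> (\<Union>i\<in>unmatched. \<U> i) = {}"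
  proof -
    have False if *: "b \<in> \<BB>" "T \<in> \<T> b" "(P, Q) \<in> unmatched" "T \<in> \<U> (P, Q)" for b T P Q
    proof -
      have f: "fst ` T = {P, Q}" and w: "pattern T \<in> \<W>" using U[OF *(3,4)] by auto
      have PQ: "P < Q" using * by (auto simp: unmatched_def)
      then have "card (fst ` T) = 2" unfolding f by simp
      then have "0 \<in> b \<and> 1 \<in> b \<or> pattern T \<in> \<A> \<or> pattern T \<in> \<B>"
        using *(2) by (auto simp: \<T>_def typed_triples_def split: if_splits)
      then have "0 \<in> b \<and> 1 \<in> b" using w disj by blast
      then have "{0, 1, P, Q} \<subseteq> b" using Tb(2)[OF *(1,2)] f by blast
      then show False using * by (auto simp: unmatched_def)
    qed
    then show ?thesis by fast
  qed
  then have "quadruple_design ((\<Union>b\<in>\<BB>. \<T> b) \<union> (\<Union>i\<in>unmatched. \<U> i)) ((\<Union>b\<in>\<BB>. B b) \<union> B\<^sub>2)"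
    by (rule quadruple_design_Un[OF design1 design2])
  moreover have "(\<Union>b\<in>\<BB>. \<T> b) \<union> (\<Union>i\<in>unmatched. \<U> i) = triples X"
  proof
    show "(\<Union>b\<in>\<BB>. \<T> b) \<union> (\<Union>i\<in>unmatched. \<U> i) \<subseteq> triples X" using Tb(1) U by fast
    show "triples X \<subseteq> (\<Union>b\<in>\<BB>. \<T> b) \<union> (\<Union>i\<in>unmatched. \<U> i)"
    proof
      fix T assume TX: "T \<in> triples X"
      then have T: "T \<subseteq> X" "card T = 3" by (simp_all add: triples_def)
      have finT: "finite T" using triples_card3[OF TX] by simp
      define S where "S = fst ` T"
      have S: "finite S" "S \<subseteq> {..<n}" "card S \<le> 3"
        using finT fX T card_image_le[of T fst] by (auto simp: S_def)
      have TE: "T \<subseteq> E b" if "S \<subseteq> b" for b using that T(1) by (auto simp: E_def S_def)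
      show "T \<in> (\<Union>b\<in>\<BB>. \<T> b) \<union> (\<Union>i\<in>unmatched. \<U> i)"
      \<comment> \<open>A block through both special points takes precedence, because its system
        covers all of its triples regardless of pattern.\<close>
      proof (cases "\<exists>b\<in>\<BB>. {0, 1} \<union> S \<subseteq> b")
        case True
        then obtain b where b: "b \<in> \<BB>" "{0, 1} \<union> S \<subseteq> b" by blast
        then have "T \<in> \<T> b" using TE[of b] T(2) by (auto simp: \<T>_def triples_def)
        then show ?thesis using b by blast
      next
        case False
        \<comment> \<open>With at most one further base point \<open>p\<close>, a block through 0, 1
          and \<open>p\<close> would contain \<open>S\<close>; if there is none,
          \<open>p = 2\<close> serves, which is where \<open>n \<ge> 3\<close> enters.\<close>
        have two: "card (S - {0, 1}) \<ge> 2"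
        proof (rule ccontr)
          assume "\<not> card (S - {0, 1}) \<ge> 2"
          then have "card (S - {0, 1}) \<le> Suc 0" by simp
          then have eq: "\<forall>x\<in>S - {0, 1}. \<forall>y\<in>S - {0, 1}. x = y"
            using card_le_Suc0_iff_eq[of "S - {0, 1}"] S(1) by blast
          obtain p where p: "S - {0, 1} \<subseteq> {p}" "p < n" "p \<noteq> 0" "p \<noteq> 1"
          proof (cases "S - {0, 1} = {}")
            case True
            then show ?thesis using that[of 2] n by auto
          next
            case False
            then obtain q where "q \<in> S - {0, 1}" by blast
            then show ?thesis using that[of q] eq S(2) by blast
          qed
          then obtain b where "b \<in> \<BB>" "{0, 1, p} \<subseteq> b" using ex[of 0 1 p] n by auto
          then show False using False p(1) by blast
        qed
        then have c0: "card (S - {i}) \<ge> 2" if "i \<in> {0, 1}" for i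
          using card_mono[of "S - {i}" "S - {0, 1}"] S(1) that by fastforce
        show ?thesis
        proof (cases "card S = 3")
          case True
          then have "S \<in> triples {..<n}" using S by (simp add: triples_def)
          then obtain b where b: "b \<in> \<BB>" "S \<subseteq> b" using quadruple_designD(4)[OF BB] by blast
          have "\<not> (0 \<in> b \<and> 1 \<in> b)" using False b by blast
          moreover have "T \<subseteq> b \<times> {0..<4}" if "0 \<notin> b" "1 \<notin> b"
          proof
            fix p assume "p \<in> T"
            then have "p \<in> X" "fst p \<in> b" using T(1) b(2) by (auto simp: S_def)
            moreover have "fst p \<noteq> 0" "fst p \<noteq> 1" using calculation that by metis+
            ultimately show "p \<in> b \<times> {0..<4}" by (cases p) (auto simp: X_def)
          qed
          ultimately have "T \<in> \<T> b"
            using TE[OF b(2)] T(2) c0 True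
            by (auto simp: \<T>_def typed_triples_def cross_triples_def triples_def S_def)
          then show ?thesis using b by blast
        next
          case c3: False
          then have "card S \<le> 2" using S(3) by simp
          moreover have "card (S - {0, 1}) \<le> card S" using S(1) by (intro card_mono) auto
          ultimately have "card S = 2" "card (S - {0, 1}) = card S" using two by linarith+
          then have S01: "S - {0, 1} = S" using S(1) by (intro card_subset_eq) auto
          obtain p q where pq: "S = {p, q}" "p \<noteq> q" using \<open>card S = 2\<close> by (meson card_2_iff)
          obtain P Q where PQ: "S = {P, Q}" "P < Q"
            using that pq by (cases "p < q") (auto simp: insert_commute neq_iff)
          have r: "P < n" "Q < n" "P \<noteq> 0" "P \<noteq> 1" "Q \<noteq> 0" "Q \<noteq> 1" 
          proof -
            have "P \<in> S - {0, 1}" "Q \<in> S - {0, 1}" unfolding S01 using PQ(1) by simp_all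
            then show "P < n" "Q < n" "P \<noteq> 0" "P \<noteq> 1" "Q \<noteq> 0" "Q \<noteq> 1" using S(2) by auto
          qed
          have "T \<subseteq> {P, Q} \<times> {0..<4}"
          proof
            fix x assume "x \<in> T"
            then have "x \<in> X" "fst x \<in> {P, Q}" using T(1) PQ by (auto simp: S_def)
            then show "x \<in> {P, Q} \<times> {0..<4}" using r by (cases x) (auto simp: X_def)
          qed
          note pt = unsplit_pattern[OF PQ(2) PQ(1)[unfolded S_def] this T(2)]
          from cover[OF pt(2-5)] consider "pattern T \<in> \<A>" | "pattern T \<in> \<B>" | "pattern T \<in> \<W>" by blast
          then show ?thesis
          proof cases
            case 1
            obtain b where b: "b \<in> \<BB>" "{0, P, Q} \<subseteq> b" using ex[of 0 P Q] r PQ by auto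
            then have "1 \<notin> b" using False PQ by blast
            then have "T \<in> \<T> b" using b 1 c0[of 0] TE[of b] T(2) PQ(1)
              by (auto simp: \<T>_def typed_triples_def cross_triples_def triples_def S_def)
            then show ?thesis using b by blast
          next
            case 2
            obtain b where b: "b \<in> \<BB>" "{1, P, Q} \<subseteq> b" using ex[of 1 P Q] r PQ n by auto
            then have "0 \<notin> b" using False PQ by blast
            then have "T \<in> \<T> b" using b 2 c0[of 1] TE[of b] T(2) PQ(1)
              by (auto simp: \<T>_def typed_triples_def cross_triples_def triples_def S_def)
            then show ?thesis using b by blast
          next
            case 3
            have "(P, Q) \<in> unmatched" using r PQ False by (auto simp: unmatched_def)
            moreover have "unsplit P Q ` pattern T \<in> \<U> (P, Q)" using 3 by (simp add: \<U>_def)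
            ultimately show ?thesis unfolding pt(1) by blast
          qed
        qed
      qed
    qed
  qed
  ultimately obtain B' where "sqs X B'" by metis
  moreover have "card X = 4 * (n - 2) + 2"
    unfolding X_def by (subst card_Un_disjoint) (auto simp: card_cartesian_product)
  ultimately show ?thesis using sqs_imp_sqs_order finX by blast
qed

text \<open>In the case of two groups the list spells out \<open>pattern\<close> for sorted codes;
  \<open>e = d\<close> tells that the middle point lies in the lower group. There
  \<open>f < 3\<close> expresses the cross condition, which is automatic for three distinct
  groups.\<close>

definition typed_valid :: "int list list \<Rightarrow> int \<Rightarrow> int \<Rightarrow> int \<Rightarrow> bool" where
  "typed_valid pl a b c \<longleftrightarrow> (let d = a div 4; e = b div 4; f = c div 4 in d < e \<and> e < f \<or>
     (d = e \<and> e < f \<or> d < e \<and> e = f) \<and> f < 3 \<and>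
     set [a mod 4, (if e = d then 0 else 4) + b mod 4, 4 + c mod 4] \<in> set ` set pl)"

lemma typed_valid_iff:
  assumes "0 \<le> a" "a < b" "b < c" "c < 16"
  shows "typed_valid pl a b c \<longleftrightarrow> 2 \<le> card (fst ` split_point 4 ` {a, b, c} - {3}) \<and>
    (card (fst ` split_point 4 ` {a, b, c}) = 3 \<or> pattern (split_point 4 ` {a, b, c}) \<in> set ` set pl)"
proof -
  define d e f where "d = a div 4" "e = b div 4" "f = c div 4"
  have o: "d \<le> e" "e \<le> f" "f \<le> 3" using assms unfolding d_e_f_def by linarith+
  have fs: "fst ` split_point 4 ` {a, b, c} = {d, e, f}" by (simp add: split_point_def d_e_f_def)
  have "2 \<le> card ({d, e, f} - {3}) \<longleftrightarrow> d < e \<and> e < 3 \<or> e < f \<and> f < 3"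
    using cross_valid_iff[of 4 a b c] assms unfolding fs by (simp add: cross_valid_def Let_def d_e_f_def)
  moreover have "card {d, e, f} = 3 \<longleftrightarrow> d < e \<and> e < f" using o by (auto simp: card_insert_if)
  moreover have "pattern (split_point 4 ` {a, b, c}) = set [a mod 4, (if e = d then 0 else 4) + b mod 4, 4 + c mod 4]"
    if "d < f"
  proof -
    have "Min {d, e, f} = d" using o by (auto simp: min_def)
    then show ?thesis unfolding pattern_def fs using that by (simp add: split_point_def d_e_f_def)
  qed
  moreover have "typed_valid pl a b c \<longleftrightarrow> d < e \<and> e < f \<or> (d = e \<and> e < f \<or> d < e \<and> e = f) \<and> f < 3 \<and>
     set [a mod 4, (if e = d then 0 else 4) + b mod 4, 4 + c mod 4] \<in> set ` set pl"
    by (simp only: typed_valid_def Let_def d_e_f_def)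
  ultimately show ?thesis unfolding fs using o by (smt (verit))
qed

lemma typed_design_check:
  assumes "design_check 13 (typed_valid pl) Bs"
  shows "\<exists>D. quadruple_design (typed_triples (set ` set pl) (3::int) (weighted {0..<4} 3 4 1)) D"
proof -
  have "\<exists>D. quadruple_design {T \<in> triples (weighted {0..<4} (3::int) 4 1). 2 \<le> card (fst ` T - {3}) \<and>
      (card (fst ` T) = 3 \<or> pattern T \<in> set ` set pl)} D"
    by (rule design_check_image[where V = "typed_valid pl"]) (use assms typed_valid_iff in auto)
  then show ?thesis by (simp add: typed_triples_def cross_triples_def conj_assoc)
qed

text \<open>Of the 48 triples that meet both \<open>{0..<4}\<close> and \<open>{4..<8}\<close>, this
  family and \<open>patterns_B\<close> take 16 each. The other 16 are exactly the triples of the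
  four blocks \<open>[0, 1, 4, 5]\<close>, \<open>[0, 2, 4, 6]\<close>, \<open>[1, 3, 5, 7]\<close>
  and \<open>[2, 3, 6, 7]\<close>.\<close>

definition patterns_A :: "int list list" where
  "patterns_A =
    [[0, 1, 6], [0, 1, 7], [0, 3, 5], [0, 3, 6], [1, 2, 4], [1, 2, 7], [2, 3, 4], [2, 3, 5],
     [2, 4, 5], [3, 4, 5], [0, 4, 7], [3, 4, 7], [1, 5, 6], [2, 5, 6], [0, 6, 7], [1, 6, 7]]"

definition patterns_B :: "int list list" where
  "patterns_B =
    [[0, 2, 5], [0, 2, 7], [0, 3, 4], [0, 3, 7], [1, 2, 5], [1, 2, 6], [1, 3, 4], [1, 3, 6],
     [1, 4, 6], [3, 4, 6], [1, 4, 7], [2, 4, 7], [0, 5, 6], [3, 5, 6], [0, 5, 7], [2, 5, 7]]"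

lemma typed_design_A: "\<exists>D. quadruple_design (typed_triples (set ` set patterns_A) (3::int) (weighted {0..<4} 3 4 1)) D"
proof (rule typed_design_check)
  show "design_check 13 (typed_valid patterns_A)
    [[0, 4, 10, 12], [0, 5, 8, 12], [0, 6, 9, 12], [0, 7, 11, 12], [1, 4, 9, 12], [1, 5, 11, 12],
     [1, 6, 10, 12], [1, 7, 8, 12], [2, 4, 11, 12], [2, 5, 9, 12], [2, 6, 8, 12], [2, 7, 10, 12],
     [3, 4, 8, 12], [3, 5, 10, 12], [3, 6, 11, 12], [3, 7, 9, 12], [0, 1, 6, 11], [0, 1, 7, 10],
     [0, 3, 5, 9], [0, 3, 6, 10], [1, 2, 4, 8], [1, 2, 7, 11], [2, 3, 4, 9], [2, 3, 5, 8],
     [2, 4, 5, 10], [3, 4, 5, 11], [0, 4, 7, 9], [3, 4, 7, 10], [1, 5, 6, 8], [2, 5, 6, 11],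
     [0, 6, 7, 8], [1, 6, 7, 9], [2, 7, 8, 9], [3, 6, 8, 9], [0, 4, 8, 11], [3, 7, 8, 11],
     [1, 5, 9, 10], [2, 6, 9, 10], [0, 5, 10, 11], [1, 4, 10, 11]]"
    by code_simp
qed

lemma typed_design_B: "\<exists>D. quadruple_design (typed_triples (set ` set patterns_B) (3::int) (weighted {0..<4} 3 4 1)) D"
proof (rule typed_design_check)
  show "design_check 13 (typed_valid patterns_B)
    [[0, 4, 11, 12], [0, 5, 9, 12], [0, 6, 8, 12], [0, 7, 10, 12], [1, 4, 8, 12], [1, 5, 10, 12],
     [1, 6, 11, 12], [1, 7, 9, 12], [2, 4, 10, 12], [2, 5, 8, 12], [2, 6, 9, 12], [2, 7, 11, 12],
     [3, 4, 9, 12], [3, 5, 11, 12], [3, 6, 10, 12], [3, 7, 8, 12], [0, 2, 5, 11], [0, 2, 7, 9],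
     [0, 3, 4, 8], [0, 3, 7, 11], [1, 2, 5, 9], [1, 2, 6, 10], [1, 3, 4, 10], [1, 3, 6, 8],
     [1, 4, 6, 9], [3, 4, 6, 11], [1, 4, 7, 11], [2, 4, 7, 8], [0, 5, 6, 10], [3, 5, 6, 9],
     [0, 5, 7, 8], [2, 5, 7, 10], [1, 7, 8, 10], [3, 5, 8, 10], [1, 5, 8, 11], [2, 6, 8, 11],
     [0, 4, 9, 10], [3, 7, 9, 10], [0, 6, 9, 11], [2, 4, 9, 11]]"
    by code_simp
qed

theorem sqs_order_4n_minus_6:
  assumes "sqs_order n" "n \<ge> 3" "sqs_order 10"
  shows "sqs_order (4 * (n - 2) + 2)"
proof -
  let ?A = "set ` set patterns_A" and ?B = "set ` set patterns_B"
  let ?V = "\<lambda>a b c. a < 4 \<and> 4 \<le> c \<and> set [a, b, c] \<notin> ?A \<and> set [a, b, c] \<notin> ?B"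
  let ?W = "{{a, b, c} | a b c. 0 \<le> a \<and> a < b \<and> b < c \<and> c < 8 \<and> ?V a b c}"
  obtain D\<^sub>1 where D1: "quadruple_design (typed_triples ?A (3::int) (weighted {0..<4} 3 4 1)) D\<^sub>1"
    using typed_design_A by blast
  obtain D\<^sub>2 where D2: "quadruple_design (typed_triples ?B (3::int) (weighted {0..<4} 3 4 1)) D\<^sub>2"
    using typed_design_B by blast
  have "design_check 8 ?V [[0, 1, 4, 5], [0, 2, 4, 6], [1, 3, 5, 7], [2, 3, 6, 7]]"
    by code_simp
  from design_check_sound[OF this] obtain D\<^sub>3 where D3: "quadruple_design ?W D\<^sub>3" by blast
  show ?thesis
  proof (rule sqs_order_two_point_weighting[OF assms D1 D2 D3])
    show "?A \<inter> ?B = {}" by code_simp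
    show "?A \<inter> ?W = {}" "?B \<inter> ?W = {}" by auto
    show "S \<in> ?A \<union> ?B \<union> ?W"
      if S: "S \<subseteq> {0..<8}" "card S = 3" "\<exists>c\<in>S. c < 4" "\<exists>c\<in>S. \<not> c < 4" for S
    proof -
      obtain a b c where abc: "S = {a, b, c}" "a < b" "b < c" using triple_sorted[OF S(2)] .
      have "0 \<le> a" "c < 8" "a < 4" "4 \<le> c" using S abc by auto
      show ?thesis
      proof (cases "S \<in> ?A \<union> ?B")
        case False
        then have "S \<in> ?W"
          using abc \<open>0 \<le> a\<close> \<open>c < 8\<close> \<open>a < 4\<close> \<open>4 \<le> c\<close> by (intro CollectI exI[of _ a] exI[of _ b] exI[of _ c]) auto
        then show ?thesis by blast
      qed blast
    qed
    show "S \<subseteq> {0..<8} \<and> (\<exists>c\<in>S. c < 4) \<and> (\<exists>c\<in>S. \<not> c < 4)" if "S \<in> ?W" for S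
      using that by auto
  qed
qed

section \<open>One-factorizations and the doubling construction\<close>

definition one_factorization :: "'a set \<Rightarrow> 'c set \<Rightarrow> ('a \<Rightarrow> 'a \<Rightarrow> 'c) \<Rightarrow> bool" where
  "one_factorization X C col \<longleftrightarrow>
     (\<forall>x\<in>X. \<forall>y\<in>X. x \<noteq> y \<longrightarrow> col x y \<in> C \<and> col x y = col y x) \<and>
     (\<forall>x\<in>X. \<forall>c\<in>C. \<exists>!y. y \<in> X \<and> y \<noteq> x \<and> col x y = c)"

text \<open>The round-robin factorization: \<open>n - 1\<close> is the fixed point of the rotation of the other points.\<close>

definition round_robin :: "int \<Rightarrow> int \<Rightarrow> int \<Rightarrow> int" where
  "round_robin n x y = (if x = n - 1 then 2 * y else if y = n - 1 then 2 * x else x + y) mod (n - 1)"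

lemma one_factorization_round_robin:
  assumes "even n" "n \<ge> 2"
  shows "one_factorization {0..<n} {0..<n - 1} (round_robin n)"
proof -
  have sym: "round_robin n x y = round_robin n y x" if "x \<noteq> y" for x y
    using that by (auto simp: round_robin_def add.commute)
  have uniq: "\<exists>!y. y \<in> {0..<n} \<and> y \<noteq> x \<and> round_robin n x y = c"
    if x: "x \<in> {0..<n}" and c: "c \<in> {0..<n - 1}" for x c
  proof (cases "x = n - 1")
    case True
    \<comment> \<open>Half of \<open>n\<close> is the inverse of 2 modulo the odd number
      \<open>n - 1\<close>.\<close>
    obtain k where k: "n = 2 * k" using assms by (elim evenE)
    have inv: "(k * (2 * y)) mod (n - 1) = y mod (n - 1)" for y
    proof -
      have "k * (2 * y) = y + y * (n - 1)" by (simp add: k algebra_simps)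
      then show ?thesis by simp
    qed
    define y where "y = (k * c) mod (n - 1)"
    have "(2 * y) mod (n - 1) = c"
    proof -
      have "(2 * y) mod (n - 1) = (k * (2 * c)) mod (n - 1)"
        unfolding y_def by (simp add: mod_mult_right_eq mult.left_commute)
      then show ?thesis using inv[of c] c by simp
    qed
    moreover have "y \<in> {0..<n}" "y \<noteq> x"
    proof -
      have "0 < n - 1" using c by simp
      then have "0 \<le> y" "y < n - 1" unfolding y_def by (rule pos_mod_sign, rule pos_mod_bound)
      then show "y \<in> {0..<n}" "y \<noteq> x" using True by auto
    qed
    moreover have "z = y" if z: "z \<in> {0..<n}" "z \<noteq> x" "round_robin n x z = c" for z
    proof -
      have "(2 * z) mod (n - 1) = c" using z True by (simp add: round_robin_def)
      then have "y = (k * (2 * z)) mod (n - 1)" unfolding y_def by (metis mod_mult_right_eq)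
      then show "z = y" using inv[of z] z True by simp
    qed
    moreover have "round_robin n x y = c" using calculation(1) True by (simp add: round_robin_def)
    ultimately show ?thesis by metis
  next
    case x': False
    show ?thesis
    \<comment> \<open>The equation \<open>x + y = c\<close> modulo \<open>n - 1\<close> has the
      solution \<open>y = x\<close> precisely in this case, and then the fixed point
      \<open>n - 1\<close> becomes the partner.\<close>
    proof (cases "(2 * x) mod (n - 1) = c")
      case True
      have "y = n - 1" if y: "y \<in> {0..<n}" "y \<noteq> x" "round_robin n x y = c" for y
      proof (rule ccontr)
        assume ny: "y \<noteq> n - 1"
        then have "(x + y) mod (n - 1) = (x + x) mod (n - 1)" using y x' True by (simp add: round_robin_def)
        then have "(n - 1) dvd (y - x)" by (simp add: mod_eq_dvd_iff)
        moreover have "\<bar>y - x\<bar> < n - 1" using y x x' ny by auto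
        ultimately have "y - x = 0" using dvd_imp_le_int[of "y - x" "n - 1"] by fastforce
        then show False using y by simp
      qed
      moreover have "n - 1 \<in> {0..<n}" "n - 1 \<noteq> x" "round_robin n x (n - 1) = c"
        using x' True assms by (auto simp: round_robin_def)
      ultimately show ?thesis by metis
    next
      case False
      define y where "y = (c - x) mod (n - 1)"
      have y: "0 \<le> y" "y < n - 1" using c by (auto simp: y_def)
      have xy: "(x + y) mod (n - 1) = c" unfolding y_def using c by (simp add: mod_add_right_eq)
      have "y \<noteq> x" using False xy by auto
      moreover have "z = y" if z: "z \<in> {0..<n}" "z \<noteq> x" "round_robin n x z = c" for z
      proof -
        have "z \<noteq> n - 1" using z False x' by (auto simp: round_robin_def)
        then have "(x + z) mod (n - 1) = c" "z < n - 1" using z x' by (auto simp: round_robin_def)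
        then have "y = (x + z - x) mod (n - 1)" unfolding y_def by (metis mod_diff_left_eq)
        then show "z = y" using z \<open>z < n - 1\<close> by simp
      qed
      moreover have "y \<in> {0..<n}" "round_robin n x y = c" using x' y xy by (auto simp: round_robin_def)
      ultimately show ?thesis by metis
    qed
  qed
  show ?thesis
    unfolding one_factorization_def
  proof (intro conjI ballI impI)
    show "round_robin n x y \<in> {0..<n - 1}" if "x \<in> {0..<n}" "y \<in> {0..<n}" "x \<noteq> y" for x y
      using that assms by (auto simp: round_robin_def)
  qed (use sym uniq in auto)
qed

text \<open>A triple that meets both copies has a pair in one of them; the colour of this pair,
  carried over by \<pi>, names the factor that supplies the partner of the single point. The
  permutation stays general because its choice decides whether a shift that exchanges the copies
  preserves the mixed blocks.\<close>

lemma sqs_doubling: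
  fixes e\<^sub>0 e\<^sub>1 :: "'a \<Rightarrow> 'b"
  assumes B: "sqs X B" and F: "one_factorization X C col" and \<pi>: "bij_betw \<pi> C C"
    and inj: "inj_on e\<^sub>0 X" "inj_on e\<^sub>1 X" and disj: "e\<^sub>0 ` X \<inter> e\<^sub>1 ` X = {}"
  shows "sqs (e\<^sub>0 ` X \<union> e\<^sub>1 ` X) ((`) e\<^sub>0 ` B \<union> (`) e\<^sub>1 ` B \<union>
    {{e\<^sub>0 a, e\<^sub>0 b, e\<^sub>1 c, e\<^sub>1 d} | a b c d. a \<in> X \<and> b \<in> X \<and> c \<in> X \<and> d \<in> X \<and> a \<noteq> b \<and> c \<noteq> d \<and> col c d = \<pi> (col a b)})"
    (is "sqs ?Y (?B0 \<union> ?B1 \<union> ?M)")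
proof -
  let ?\<T> = "{T \<in> triples ?Y. \<not> T \<subseteq> e\<^sub>0 ` X \<and> \<not> T \<subseteq> e\<^sub>1 ` X}"
  have e0: "e\<^sub>0 a = e\<^sub>0 b \<longleftrightarrow> a = b" "e\<^sub>1 a = e\<^sub>1 b \<longleftrightarrow> a = b" "e\<^sub>0 a \<noteq> e\<^sub>1 b" "e\<^sub>1 b \<noteq> e\<^sub>0 a"
    if "a \<in> X" "b \<in> X" for a b
    using that inj disj by (auto simp: inj_on_def)
  have colC: "col a b \<in> C" "col a b = col b a" if "a \<in> X" "b \<in> X" "a \<noteq> b" for a b
    using F that unfolding one_factorization_def by blast+
  have colU: "\<exists>!y. y \<in> X \<and> y \<noteq> x \<and> col x y = c" if "x \<in> X" "c \<in> C" for x c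
    using F that unfolding one_factorization_def by blast
  have colI: "y = z" if "x \<in> X" "y \<in> X" "z \<in> X" "y \<noteq> x" "z \<noteq> x" "col x y = col x z" for x y z
    using colU[OF that(1) colC(1)[OF that(1,2)]] that by metis
  have \<pi>C: "\<pi> c \<in> C" if "c \<in> C" for c using \<pi> that by (auto simp: bij_betw_def)
  have \<pi>inv: "\<exists>d\<in>C. \<pi> d = c" if "c \<in> C" for c
    using \<pi> that by (metis bij_betw_imp_surj_on imageE)
  have \<pi>inj: "c = d" if "\<pi> c = \<pi> d" "c \<in> C" "d \<in> C" for c d
    using \<pi> that by (auto simp: bij_betw_def inj_on_def)
  have M: "quadruple_design ?\<T> ?M"
  proof (rule quadruple_designI')
    show "card T = 3" if "T \<in> ?\<T>" for T using that by (simp add: triples_def)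
    show "card b = 4" if b: "b \<in> ?M" for b
    proof -
      obtain p q r s where *: "b = {e\<^sub>0 p, e\<^sub>0 q, e\<^sub>1 r, e\<^sub>1 s}" "p \<in> X" "q \<in> X" "r \<in> X" "s \<in> X" "p \<noteq> q" "r \<noteq> s"
        using b by blast
      then show ?thesis using e0 by simp
    qed
    show "T \<in> ?\<T>" if b: "b \<in> ?M" and T: "T \<subseteq> b" "card T = 3" for b T
    proof -
      obtain p q r s where *: "b = {e\<^sub>0 p, e\<^sub>0 q, e\<^sub>1 r, e\<^sub>1 s}" "p \<in> X" "q \<in> X" "r \<in> X" "s \<in> X"
        using b by blast
      have False if "T \<subseteq> e\<^sub>0 ` X"
      proof -
        have "T \<subseteq> {e\<^sub>0 p, e\<^sub>0 q}" using that T(1) * disj by blast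
        then have "card T \<le> card {e\<^sub>0 p, e\<^sub>0 q}" by (intro card_mono) auto
        also have "\<dots> \<le> 2" by (simp add: card_insert_if)
        finally show False using T(2) by simp
      qed
      moreover have False if "T \<subseteq> e\<^sub>1 ` X"
      proof -
        have "T \<subseteq> {e\<^sub>1 r, e\<^sub>1 s}" using that T(1) * disj by blast
        then have "card T \<le> card {e\<^sub>1 r, e\<^sub>1 s}" by (intro card_mono) auto
        also have "\<dots> \<le> 2" by (simp add: card_insert_if)
        finally show False using T(2) by simp
      qed
      moreover have "T \<subseteq> ?Y" using T(1) * by auto
      ultimately show ?thesis using T(2) by (auto simp: triples_def)
    qed
    show "\<exists>b\<in>?M. T \<subseteq> b \<and> (\<forall>b'\<in>?M. T \<subseteq> b' \<longrightarrow> b' = b)" if T: "T \<in> ?\<T>" for T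
    proof -
      define P where "P = {x \<in> X. e\<^sub>0 x \<in> T}"
      define Q where "Q = {x \<in> X. e\<^sub>1 x \<in> T}"
      have fin: "finite T" and c3: "card T = 3" and TY: "T \<subseteq> ?Y"
        using T by (auto simp: triples_def intro: card_ge_0_finite)
      have TPQ: "T = e\<^sub>0 ` P \<union> e\<^sub>1 ` Q" using TY by (auto simp: P_def Q_def)
      have PX: "P \<subseteq> X" "Q \<subseteq> X" by (auto simp: P_def Q_def)
      have fPQ: "finite (e\<^sub>0 ` P)" "finite (e\<^sub>1 ` Q)" using fin TPQ by auto
      have "e\<^sub>0 ` P \<inter> e\<^sub>1 ` Q = {}" using disj PX by blast
      then have "card (e\<^sub>0 ` P) + card (e\<^sub>1 ` Q) = 3" using c3 card_Un_disjoint[OF fPQ] TPQ by simp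
      moreover have "card (e\<^sub>0 ` P) = card P" "card (e\<^sub>1 ` Q) = card Q"
        using inj PX by (meson card_image inj_on_subset)+
      ultimately have sum: "card P + card Q = 3" by simp
      have finPQ: "finite P" "finite Q"
        using fPQ inj PX by (meson finite_imageD inj_on_subset)+
      have "P \<noteq> {}" "Q \<noteq> {}" using T TPQ PX by auto
      then have "card P > 0" "card Q > 0" using finPQ by (auto simp: card_gt_0_iff)
      then consider "card P = 2" "card Q = 1" | "card P = 1" "card Q = 2" using sum by linarith
      then show ?thesis
      proof cases
        case 1
        obtain a b where P: "P = {a, b}" "a \<noteq> b" using 1(1) by (meson card_2_iff)
        obtain c where Q: "Q = {c}" using 1(2) by (meson card_1_singletonE)
        have X: "a \<in> X" "b \<in> X" "c \<in> X" using PX P Q by auto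
        obtain d where d: "d \<in> X" "d \<noteq> c" "col c d = \<pi> (col a b)"
          using colU[OF X(3) \<pi>C[OF colC(1)[OF X(1,2) P(2)]]] by blast
        have m1: "T \<subseteq> {e\<^sub>0 a, e\<^sub>0 b, e\<^sub>1 c, e\<^sub>1 d}" using TPQ P Q by auto
        have m2: "{e\<^sub>0 a, e\<^sub>0 b, e\<^sub>1 c, e\<^sub>1 d} \<in> ?M" using X P d by blast
        have m3: "b' = {e\<^sub>0 a, e\<^sub>0 b, e\<^sub>1 c, e\<^sub>1 d}" if b': "b' \<in> ?M" "T \<subseteq> b'" for b'
        proof -
          obtain p q r s where *: "b' = {e\<^sub>0 p, e\<^sub>0 q, e\<^sub>1 r, e\<^sub>1 s}" "p \<in> X" "q \<in> X" "r \<in> X" "s \<in> X"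
            "p \<noteq> q" "r \<noteq> s" "col r s = \<pi> (col p q)" using b'(1) by blast
          have in': "e\<^sub>0 a \<in> b'" "e\<^sub>0 b \<in> b'" "e\<^sub>1 c \<in> b'" using b'(2) TPQ P Q by auto
          have "a = p \<or> a = q" "b = p \<or> b = q" "c = r \<or> c = s" using in' * X e0 by auto
          then have ab: "{a, b} = {p, q}" using P(2) by auto
          then have "col a b = col p q" using P(2) *(2,3,6) colC(2) by (metis doubleton_eq_iff)
          then have rs: "col r s = col c d" using *(8) d(3) by simp
          have "{c, d} = {r, s}"
            using \<open>c = r \<or> c = s\<close>
          proof
            assume "c = r"
            then show ?thesis using colI[of c d s] rs d X *(5,7) by auto
          next
            assume "c = s"
            then show ?thesis using colI[of c d r] rs d X *(4,7) colC(2)[OF *(4,5,7)] by auto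
          qed
          then have "e\<^sub>1 ` {c, d} = e\<^sub>1 ` {r, s}" "e\<^sub>0 ` {a, b} = e\<^sub>0 ` {p, q}" using ab by simp_all
          then show ?thesis using *(1) by auto
        qed
        show ?thesis by (intro bexI[OF _ m2] conjI ballI impI m1 m3)
      next
        case 2
        obtain c d where Q: "Q = {c, d}" "c \<noteq> d" using 2(2) by (meson card_2_iff)
        obtain a where P: "P = {a}" using 2(1) by (meson card_1_singletonE)
        have X: "c \<in> X" "d \<in> X" "a \<in> X" using PX P Q by auto
        obtain k where k: "k \<in> C" "\<pi> k = col c d" using \<pi>inv[OF colC(1)[OF X(1,2) Q(2)]] by blast
        obtain b where b: "b \<in> X" "b \<noteq> a" "col a b = k" using colU[OF X(3) k(1)] by blast
        have m1: "T \<subseteq> {e\<^sub>0 a, e\<^sub>0 b, e\<^sub>1 c, e\<^sub>1 d}" using TPQ P Q by auto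
        have "col c d = \<pi> (col a b)" "a \<noteq> b" using b k by simp_all
        then have m2: "{e\<^sub>0 a, e\<^sub>0 b, e\<^sub>1 c, e\<^sub>1 d} \<in> ?M" using X Q(2) b(1) by blast
        have m3: "b' = {e\<^sub>0 a, e\<^sub>0 b, e\<^sub>1 c, e\<^sub>1 d}" if b': "b' \<in> ?M" "T \<subseteq> b'" for b'
        proof -
          obtain p q r s where *: "b' = {e\<^sub>0 p, e\<^sub>0 q, e\<^sub>1 r, e\<^sub>1 s}" "p \<in> X" "q \<in> X" "r \<in> X" "s \<in> X"
            "p \<noteq> q" "r \<noteq> s" "col r s = \<pi> (col p q)" using b'(1) by blast
          have in': "e\<^sub>1 c \<in> b'" "e\<^sub>1 d \<in> b'" "e\<^sub>0 a \<in> b'" using b'(2) TPQ P Q by auto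
          have "c = r \<or> c = s" "d = r \<or> d = s" "a = p \<or> a = q" using in' * X e0 by auto
          then have cd: "{c, d} = {r, s}" using Q(2) by auto
          then have "col c d = col r s" using Q(2) *(4,5,7) colC(2) by (metis doubleton_eq_iff)
          then have "col p q = k" using \<pi>inj k *(2,3,6,8) colC(1) by metis
          then have pq: "col p q = col a b" using b(3) by simp
          have "{a, b} = {p, q}"
            using \<open>a = p \<or> a = q\<close>
          proof
            assume "a = p"
            then show ?thesis using colI[of a b q] pq b X *(3,6) by auto
          next
            assume "a = q"
            then show ?thesis using colI[of a b p] pq b X *(2,6) colC(2)[OF *(2,3,6)] by auto
          qed
          then have "e\<^sub>1 ` {c, d} = e\<^sub>1 ` {r, s}" "e\<^sub>0 ` {a, b} = e\<^sub>0 ` {p, q}" using cd by simp_all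
          then show ?thesis using *(1) by auto
        qed
        show ?thesis by (intro bexI[OF _ m2] conjI ballI impI m1 m3)
      qed
    qed
  qed
  have "quadruple_design (triples (e\<^sub>0 ` X) \<union> triples (e\<^sub>1 ` X) \<union> ?\<T>) (?B0 \<union> ?B1 \<union> ?M)"
  proof (intro quadruple_design_Un M sqs_image[OF B] inj)
    show "triples (e\<^sub>0 ` X) \<inter> triples (e\<^sub>1 ` X) = {}"
    proof -
      have False if "T \<subseteq> e\<^sub>0 ` X" "T \<subseteq> e\<^sub>1 ` X" "card T = 3" for T
      proof -
        have "T = {}" using that disj by blast
        then show False using that by simp
      qed
      then show ?thesis by (auto simp: triples_def)
    qed
  qed (auto simp: triples_def)
  moreover have "triples (e\<^sub>0 ` X) \<union> triples (e\<^sub>1 ` X) \<union> ?\<T> = triples ?Y" by (auto simp: triples_def)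
  ultimately show ?thesis by simp
qed

lemma sqs_order_double:
  assumes "sqs_order n" "even n" "n \<ge> 2"
  shows "sqs_order (2 * n)"
proof -
  obtain B where B: "sqs {0..<int n} B" using sqs_order_imp_sqs[OF assms(1), of "{0..<int n}"] by auto
  have "sqs ((\<lambda>x. (x, False)) ` {0..<int n} \<union> (\<lambda>x. (x, True)) ` {0..<int n})
    ((`) (\<lambda>x. (x, False)) ` B \<union> (`) (\<lambda>x. (x, True)) ` B \<union>
    {{(a, False), (b, False), (c, True), (d, True)} | a b c d. a \<in> {0..<int n} \<and> b \<in> {0..<int n} \<and>
      c \<in> {0..<int n} \<and> d \<in> {0..<int n} \<and> a \<noteq> b \<and> c \<noteq> d \<and> round_robin (int n) c d = id (round_robin (int n) a b)})"
    by (rule sqs_doubling[OF B one_factorization_round_robin]) (use assms in \<open>auto simp: inj_on_def bij_betw_id[unfolded id_def]\<close>)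
  then show ?thesis
  proof (rule sqs_imp_sqs_order)
    show "card ((\<lambda>x. (x, False)) ` {0..<int n} \<union> (\<lambda>x. (x, True)) ` {0..<int n}) = 2 * n"
      by (subst card_Un_disjoint) (auto simp: card_image inj_on_def)
  qed auto
qed

section \<open>Tripling: three large groups of equal size with a stem\<close>

text \<open>Transversals \<open>{(0, a), (1, b), (2, c)}\<close> are treated according to \<open>\<sigma> = (a + b + c) mod m\<close>: sums below \<open>u\<close> are
  completed by a point of the stem, and the other sums form three intervals of length \<open>2 q\<close>, each of
  which is reflected by changing the coordinate of the group with the same index. This reflection
  uses the pairs of points of a group at odd distance less than \<open>2 q\<close>, with every point of the
  other groups.\<close>

locale tripling =
  fixes m q u :: int
  assumes q: "q \<ge> 1" and u: "u \<ge> 1" and m: "m = 6 * q + u"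
begin

definition lo :: "int \<Rightarrow> int" where "lo i = u + 2 * q * i"

definition interval_of :: "int \<Rightarrow> int" where
  "interval_of \<sigma> = (if \<sigma> < u + 2 * q then 0 else if \<sigma> < u + 4 * q then 1 else 2)"

text \<open>The sum of the two end points of the interval, so that \<sigma> and
  \<open>reflection i - \<sigma>\<close> are mirror images. As this number is odd, no sum is its own
  mirror image.\<close>

definition reflection :: "int \<Rightarrow> int" where "reflection i = 2 * lo i + 2 * q - 1"

definition coord_sum :: "(int \<Rightarrow> int) \<Rightarrow> int" where "coord_sum \<phi> = (\<phi> 0 + \<phi> 1 + \<phi> 2) mod m"

text \<open>Adding \<open>reflection i - 2 * \<sigma>\<close> to a single coordinate carries the sum
  \<sigma> to its mirror image.\<close>

definition completion :: "(int \<Rightarrow> int) \<Rightarrow> int \<times> int" where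
  "completion \<phi> = (let \<sigma> = coord_sum \<phi>; i = interval_of \<sigma>
     in if \<sigma> < u then (3, \<sigma>) else (i, (\<phi> i + reflection i - 2 * \<sigma>) mod m))"

definition graph :: "(int \<Rightarrow> int) \<Rightarrow> (int \<times> int) set" where "graph \<phi> = (\<lambda>i. (i, \<phi> i)) ` {0, 1, 2}"

definition block :: "(int \<Rightarrow> int) \<Rightarrow> (int \<times> int) set" where "block \<phi> = insert (completion \<phi>) (graph \<phi>)"

definition coords :: "(int \<Rightarrow> int) \<Rightarrow> bool" where "coords \<phi> \<longleftrightarrow> (\<forall>i\<in>{0, 1, 2}. 0 \<le> \<phi> i \<and> \<phi> i < m)"

text \<open>Here \<open>r\<close> is the position of the sum in its interval. The displacement
  \<open>reflection i - 2 * \<sigma>\<close> is then \<open>2 * q - 1 - 2 * r\<close> for every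
  \<open>i\<close>, so all three groups have the same near pairs.\<close>

definition near :: "int \<Rightarrow> int \<Rightarrow> bool" where
  "near a b \<longleftrightarrow> (\<exists>r. 0 \<le> r \<and> r < 2 * q \<and> m dvd b - a - (2 * q - 1 - 2 * r))"

definition far_pairs :: "int set set" where
  "far_pairs = {e. e \<subseteq> {0..<m} \<and> card e = 2 \<and> (\<forall>a\<in>e. \<forall>b\<in>e. \<not> near a b)}"

lemma m_pos: "m > 0" using m q u by simp

lemma coord_sum_range: "0 \<le> coord_sum \<phi>" "coord_sum \<phi> < m"
  using m_pos by (simp_all add: coord_sum_def)

lemma interval_of_iff:
  assumes "u \<le> \<sigma>" "\<sigma> < m"
  shows "interval_of \<sigma> \<in> {0, 1, 2}" "lo (interval_of \<sigma>) \<le> \<sigma>" "\<sigma> < lo (interval_of \<sigma>) + 2 * q"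
  using assms m by (auto simp: interval_of_def lo_def)

lemma interval_of_eq:
  assumes "i \<in> {0, 1, 2}" "lo i \<le> \<sigma>" "\<sigma> < lo i + 2 * q"
  shows "interval_of \<sigma> = i" "u \<le> \<sigma>" "\<sigma> < m"
  using assms m q by (auto simp: interval_of_def lo_def)

lemma sum_perm:
  fixes \<phi> :: "int \<Rightarrow> int"
  assumes "i \<in> {0, 1, 2}" "j \<in> {0, 1, 2}" "k \<in> {0, 1, 2}" "i \<noteq> j" "j \<noteq> k" "i \<noteq> k"
  shows "\<phi> 0 + \<phi> 1 + \<phi> 2 = \<phi> i + \<phi> j + \<phi> k" "{0, 1, 2} = {i, j, k}"
proof -
  have "(i, j, k) \<in> {(0, 1, 2), (0, 2, 1), (1, 0, 2), (1, 2, 0), (2, 0, 1), (2, 1, 0)}"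
    using assms by auto
  then show "\<phi> 0 + \<phi> 1 + \<phi> 2 = \<phi> i + \<phi> j + \<phi> k" "{0, 1, 2} = {i, j, k}"
    by (elim insertE; force)+
qed

lemma block_cong: "(\<And>i. i \<in> {0, 1, 2} \<Longrightarrow> \<phi> i = \<psi> i) \<Longrightarrow> block \<phi> = block \<psi>"
proof -
  assume *: "\<And>i. i \<in> {0, 1, 2} \<Longrightarrow> \<phi> i = \<psi> i"
  have "coord_sum \<phi> = coord_sum \<psi>" using * by (simp add: coord_sum_def)
  moreover have "\<phi> (interval_of \<sigma>) = \<psi> (interval_of \<sigma>)" for \<sigma> by (rule *) (simp add: interval_of_def)
  ultimately have "completion \<phi> = completion \<psi>" by (simp add: completion_def Let_def)
  then show ?thesis using * by (simp add: block_def graph_def)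
qed

lemma completion_less: "coord_sum \<phi> < u \<Longrightarrow> completion \<phi> = (3, coord_sum \<phi>)"
  by (simp add: completion_def Let_def)

lemma completion_ge:
  "u \<le> coord_sum \<phi> \<Longrightarrow> i = interval_of (coord_sum \<phi>) \<Longrightarrow>
    completion \<phi> = (i, (\<phi> i + reflection i - 2 * coord_sum \<phi>) mod m)"
  by (simp add: completion_def Let_def)

lemma fst_completion: "fst (completion \<phi>) = 3 \<longleftrightarrow> coord_sum \<phi> < u" "fst (completion \<phi>) \<in> {0, 1, 2, 3}"
  by (auto simp: completion_def Let_def interval_of_def)

lemma in_block_iff:
  "k \<in> {0, 1, 2} \<Longrightarrow> (k, x) \<in> block \<phi> \<longleftrightarrow> x = \<phi> k \<or> (k, x) = completion \<phi>"
  "(3, x) \<in> block \<phi> \<longleftrightarrow> (3, x) = completion \<phi>"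
  by (auto simp: block_def graph_def)

lemma dvd_small: "m dvd x \<Longrightarrow> \<bar>x\<bar> < m \<Longrightarrow> x = 0"
  using dvd_imp_le_int[of x m] by fastforce

text \<open>After the coordinate \<open>i\<close> is exchanged for the completing point, the sum is
  the mirror image in the same interval, so the next completion restores the old coordinate. Both
  transversals thus generate one block.\<close>

lemma flip:
  assumes \<phi>: "coords \<phi>" and \<sigma>: "u \<le> coord_sum \<phi>" and i: "completion \<phi> = (i, a)"
  defines "\<phi>' \<equiv> \<phi>(i := a)"
  shows "coords \<phi>'" "completion \<phi>' = (i, \<phi> i)" "block \<phi>' = block \<phi>" "i \<in> {0, 1, 2}" "near (\<phi> i) a" "a \<noteq> \<phi> i"
    "0 \<le> a" "a < m"
proof -
  let ?\<sigma> = "coord_sum \<phi>"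
  have ii: "i = interval_of ?\<sigma>" and a: "a = (\<phi> i + reflection i - 2 * ?\<sigma>) mod m"
    using completion_ge[OF \<sigma> refl] i by auto
  have r: "lo i \<le> ?\<sigma>" "?\<sigma> < lo i + 2 * q"
    using interval_of_iff[OF \<sigma> coord_sum_range(2)] by (simp_all add: ii)
  show i3: "i \<in> {0, 1, 2}" using interval_of_iff(1)[OF \<sigma> coord_sum_range(2)] by (simp add: ii)
  show a0: "0 \<le> a" "a < m" using m_pos by (simp_all add: a)
  then show "coords \<phi>'" using \<phi> by (auto simp: coords_def \<phi>'_def)
  have dvd: "m dvd a - \<phi> i - (reflection i - 2 * ?\<sigma>)"
  proof -
    have "(a - (\<phi> i + reflection i - 2 * ?\<sigma>)) mod m = 0" unfolding a by (simp add: mod_diff_left_eq)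
    then show ?thesis by (simp add: mod_eq_0_iff_dvd algebra_simps)
  qed
  show "near (\<phi> i) a"
    unfolding near_def
    by (rule exI[of _ "?\<sigma> - lo i"]) (use r dvd in \<open>simp add: reflection_def algebra_simps\<close>)
  show ne: "a \<noteq> \<phi> i"
  proof
    assume "a = \<phi> i"
    then have "m dvd reflection i - 2 * ?\<sigma>" using dvd dvd_minus_iff[of m "reflection i - 2 * ?\<sigma>"] by simp
    moreover have "\<bar>reflection i - 2 * ?\<sigma>\<bar> < m" using r m u q by (simp add: reflection_def abs_less_iff)
    ultimately have "reflection i = 2 * ?\<sigma>" using dvd_small by fastforce
    then show False unfolding reflection_def by presburger
  qed
  have "coord_sum \<phi>' = (\<phi> 0 + \<phi> 1 + \<phi> 2 + (a - \<phi> i)) mod m"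
    using i3 by (auto simp: coord_sum_def \<phi>'_def algebra_simps)
  also have "\<dots> = (?\<sigma> + (reflection i - 2 * ?\<sigma>)) mod m"
  proof (rule mod_eq_dvd_iff[THEN iffD2])
    have "m dvd (\<phi> 0 + \<phi> 1 + \<phi> 2) - ?\<sigma>" unfolding coord_sum_def by (simp add: dvd_minus_mod)
    then have "m dvd ((\<phi> 0 + \<phi> 1 + \<phi> 2) - ?\<sigma>) + (a - \<phi> i - (reflection i - 2 * ?\<sigma>))" using dvd by (rule dvd_add)
    then show "m dvd (\<phi> 0 + \<phi> 1 + \<phi> 2 + (a - \<phi> i)) - (?\<sigma> + (reflection i - 2 * ?\<sigma>))" by (simp add: algebra_simps)
  qed
  also have "\<dots> = reflection i - ?\<sigma>"
  proof -
    have "lo i \<le> reflection i - ?\<sigma>" "reflection i - ?\<sigma> < lo i + 2 * q" using r by (auto simp: reflection_def)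
    then have "0 \<le> reflection i - ?\<sigma>" "reflection i - ?\<sigma> < m" using interval_of_eq[OF i3, of "reflection i - ?\<sigma>"] u by auto
    then show ?thesis by (simp add: algebra_simps)
  qed
  finally have s': "coord_sum \<phi>' = reflection i - ?\<sigma>" .
  have r': "lo i \<le> coord_sum \<phi>'" "coord_sum \<phi>' < lo i + 2 * q" using r by (auto simp: s' reflection_def)
  have "\<phi>' i = a" by (simp add: \<phi>'_def)
  have "completion \<phi>' = (i, (a + reflection i - 2 * (reflection i - ?\<sigma>)) mod m)"
    unfolding completion_ge[OF interval_of_eq(2)[OF i3 r'] interval_of_eq(1)[OF i3 r', symmetric]]
    by (simp only: s' \<open>\<phi>' i = a\<close>)
  also have "(a + reflection i - 2 * (reflection i - ?\<sigma>)) mod m = \<phi> i mod m"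
    by (rule mod_eq_dvd_iff[THEN iffD2]) (use dvd in \<open>simp add: algebra_simps\<close>)
  also have "\<phi> i mod m = \<phi> i" using \<phi> i3 unfolding coords_def by (intro mod_pos_pos_trivial) auto
  finally show c': "completion \<phi>' = (i, \<phi> i)" .
  have "graph \<phi>' = insert (i, a) (graph \<phi> - {(i, \<phi> i)})"
    using i3 by (auto simp: graph_def \<phi>'_def)
  moreover have "(i, \<phi> i) \<in> graph \<phi>" using i3 by (auto simp: graph_def)
  ultimately show "block \<phi>' = block \<phi>" using i c' by (auto simp: block_def)
qed

lemma card_block:
  assumes "coords \<phi>"
  shows "card (block \<phi>) = 4"
proof -
  have "card (graph \<phi>) = 3" by (simp add: graph_def)
  moreover have "completion \<phi> \<notin> graph \<phi>"
  proof (cases "coord_sum \<phi> < u")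
    case True
    then show ?thesis by (auto simp: completion_less graph_def)
  next
    case False
    obtain i a where ia: "completion \<phi> = (i, a)" by fastforce
    have "a \<noteq> \<phi> i" using flip(6)[OF assms _ ia] False by simp
    then show ?thesis by (auto simp: ia graph_def)
  qed
  ultimately show ?thesis by (simp add: block_def graph_def)
qed

lemma block_subset:
  assumes "coords \<phi>"
  shows "block \<phi> \<subseteq> weighted {0..<4} 3 m u"
proof -
  have "graph \<phi> \<subseteq> weighted {0..<4} 3 m u" using assms by (auto simp: graph_def coords_def weighted_def)
  moreover have "completion \<phi> \<in> weighted {0..<4} 3 m u"
  proof (cases "coord_sum \<phi> < u")
    case True
    then show ?thesis using coord_sum_range by (auto simp: completion_less weighted_def)
  next
    case False
    obtain i a where ia: "completion \<phi> = (i, a)" by fastforce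
    have "0 \<le> a" "a < m" "i \<in> {0, 1, 2}" using flip(4,7,8)[OF assms _ ia] False by simp_all
    then show ?thesis by (auto simp: ia weighted_def)
  qed
  ultimately show ?thesis by (simp add: block_def)
qed

text \<open>The cases follow the construction: a transversal generates its own block, a stem point
  prescribes the sum, and a pair in one group is covered by a reflection or by the factorization,
  according to \<open>near\<close>.\<close>

lemma cross_triple_cases:
  assumes T: "T \<in> cross_triples 3 (weighted {0..<4} (3::int) m u)"
  obtains (transversal) \<phi> where "coords \<phi>" "T = graph \<phi>"
  | (stem) s i j a b where "0 \<le> s" "s < u" "i \<in> {0, 1, 2}" "j \<in> {0, 1, 2}" "i \<noteq> j" "0 \<le> a" "a < m" "0 \<le> b" "b < m"
      "T = {(3, s), (i, a), (j, b)}"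
  | (pair) i j e b where "i \<in> {0, 1, 2}" "j \<in> {0, 1, 2}" "i \<noteq> j" "e \<subseteq> {0..<m}" "card e = 2" "0 \<le> b" "b < m"
      "T = {i} \<times> e \<union> {(j, b)}"
proof -
  have TX: "T \<subseteq> weighted {0..<4} 3 m u" "card T = 3" and two: "2 \<le> card (fst ` T - {3})"
    using T by (auto simp: cross_triples_def triples_def)
  obtain x y z where xyz: "T = {x, y, z}" "x \<noteq> y" "y \<noteq> z" "x \<noteq> z" using TX(2) by (metis card_3_iff)
  have pt: "fst p \<in> {0, 1, 2} \<and> 0 \<le> snd p \<and> snd p < m \<or> fst p = 3 \<and> 0 \<le> snd p \<and> snd p < u" if "p \<in> T" for p
    using that TX(1) by (force simp: weighted_def)
  have A: thesis if "x' \<in> T" "y' \<in> T" "z' \<in> T" "T = {x', y', z'}" "fst x' \<noteq> 3" "fst y' \<noteq> 3" "fst x' \<noteq> fst y'"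
      "fst z' \<noteq> fst x'" "fst z' \<noteq> fst y'" for x' y' z'
  proof (cases "fst z' = 3")
    case True
    show ?thesis
      by (rule stem[of "snd z'" "fst x'" "fst y'" "snd x'" "snd y'"])
        (use that True pt[of x'] pt[of y'] pt[of z'] in \<open>auto simp: insert_commute prod_eq_iff\<close>)
  next
    case False
    define \<phi> where "\<phi> k = (if k = fst x' then snd x' else if k = fst y' then snd y' else snd z')" for k
    have S: "fst x' \<in> {0, 1, 2}" "fst y' \<in> {0, 1, 2}" "fst z' \<in> {0, 1, 2}"
      using that False pt[of x'] pt[of y'] pt[of z'] by auto
    have e: "{0, 1, 2} = {fst x', fst y', fst z'}" using sum_perm(2)[OF S] that by auto
    have "coords \<phi>" unfolding coords_def using that False pt[of x'] pt[of y'] pt[of z'] by (auto simp: \<phi>_def)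
    moreover have "T = graph \<phi>" unfolding graph_def e that(4) using that(7-9) by (auto simp: \<phi>_def)
    ultimately show ?thesis by (rule transversal)
  qed
  have B: thesis if "x' \<in> T" "y' \<in> T" "z' \<in> T" "T = {x', y', z'}" "x' \<noteq> y'" "fst x' = fst y'" "fst z' \<noteq> fst x'"
      "fst x' \<noteq> 3" "fst z' \<noteq> 3" for x' y' z'
    by (rule pair[of "fst x'" "fst z'" "{snd x', snd y'}" "snd z'"])
      (use that pt[of x'] pt[of y'] pt[of z'] in \<open>auto simp: prod_eq_iff\<close>)
  have "finite (fst ` T - {3})" using TX(2) xyz(1) by simp
  then obtain g h where gh: "g \<in> fst ` T - {3}" "h \<in> fst ` T - {3}" "g \<noteq> h"
    using two card_le_Suc0_iff_eq[of "fst ` T - {3}"] by (metis not_less_eq_eq numeral_2_eq_2)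
  obtain p p' where p: "p \<in> T" "p' \<in> T" "fst p = g" "fst p' = h" using gh by auto
  then have "p \<noteq> p'" using gh by auto
  have "card (T - {p, p'}) = 1" using p(1,2) \<open>p \<noteq> p'\<close> TX(2) by (simp add: card_Diff_subset)
  then obtain r where "T - {p, p'} = {r}" using card_1_singletonE by blast
  then have r: "r \<in> T" "T = {p, p', r}" "r \<noteq> p" "r \<noteq> p'" using p(1,2) by auto
  have n3: "fst p \<noteq> 3" "fst p' \<noteq> 3" "fst p \<noteq> fst p'" using gh p by auto
  consider "fst r \<noteq> fst p" "fst r \<noteq> fst p'" | "fst r = fst p" | "fst r = fst p'" by blast
  then show ?thesis
  proof cases
    case 1
    then show ?thesis using A[OF p(1,2) r(1,2)] n3 by simp
  next
    case 2
    then show ?thesis using B[of p r p'] p(1,2) r n3 by (auto simp: insert_commute)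
  next
    case 3
    then show ?thesis using B[of p' r p] p(1,2) r n3 by (auto simp: insert_commute)
  qed
qed

lemma near_sym: "near a b \<Longrightarrow> near b a"
proof -
  assume "near a b"
  then obtain r where r: "0 \<le> r" "r < 2 * q" "m dvd b - a - (2 * q - 1 - 2 * r)" by (auto simp: near_def)
  have "m dvd a - b - (2 * q - 1 - 2 * (2 * q - 1 - r))"
    using dvd_minus_iff[of m "b - a - (2 * q - 1 - 2 * r)"] r(3) by (simp add: algebra_simps)
  then show ?thesis unfolding near_def by (intro exI[of _ "2 * q - 1 - r"]) (use r(1,2) in auto)
qed

lemma not_near:
  assumes "\<And>r. 0 \<le> r \<Longrightarrow> r < 2 * q \<Longrightarrow> d \<noteq> 2 * q - 1 - 2 * r" "\<bar>d\<bar> \<le> 4 * q" "m dvd b - a - d"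
  shows "\<not> near a b"
proof
  assume "near a b"
  then obtain r where r: "0 \<le> r" "r < 2 * q" "m dvd b - a - (2 * q - 1 - 2 * r)" by (auto simp: near_def)
  have "m dvd (b - a - (2 * q - 1 - 2 * r)) - (b - a - d)" using r(3) assms(3) by (rule dvd_diff)
  then have "m dvd d - (2 * q - 1 - 2 * r)" by (simp add: algebra_simps)
  moreover have "\<bar>d - (2 * q - 1 - 2 * r)\<bar> < m" using r(1,2) assms(2) m u by (simp add: abs_le_iff abs_less_iff)
  ultimately show False using dvd_small assms(1)[OF r(1,2)] by fastforce
qed

lemma not_near_self: "\<not> near a a"
proof (rule not_near[of 0])
  show "0 \<noteq> 2 * q - 1 - 2 * r" for r by presburger
  show "\<bar>0\<bar> \<le> 4 * q" using q by simp
  show "m dvd a - a - 0" by simp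
qed

lemma far_pair_iff:
  assumes "a \<noteq> b"
  shows "{a, b} \<in> far_pairs \<longleftrightarrow> 0 \<le> a \<and> a < m \<and> 0 \<le> b \<and> b < m \<and> \<not> near a b"
proof -
  have "near b a \<longleftrightarrow> near a b" using near_sym by blast
  then show ?thesis using assms by (auto simp: far_pairs_def not_near_self)
qed

lemma third_index:
  fixes i j :: int
  assumes "i \<in> {0, 1, 2}" "j \<in> {0, 1, 2}" "i \<noteq> j"
  obtains k where "k \<in> {0, 1, 2}" "k \<noteq> i" "k \<noteq> j"
proof -
  have "3 - i - j = 0 \<or> 3 - i - j = 1 \<or> 3 - i - j = 2" "3 - i - j \<noteq> i" "3 - i - j \<noteq> j"
    using assms unfolding insert_iff empty_iff by presburger+
  then show thesis using that[of "3 - i - j"] by blast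
qed

text \<open>The pairs of points at larger distance are matched by a factorization of the remaining graph.\<close>

theorem cross_design_tripling:
  fixes C :: "int set \<Rightarrow> 'c"
  assumes C: "\<And>e b. e \<in> far_pairs \<Longrightarrow> 0 \<le> b \<Longrightarrow> b < m \<Longrightarrow> \<exists>!f. f \<in> far_pairs \<and> b \<in> f \<and> C f = C e"
  shows "\<exists>D. quadruple_design (cross_triples (3::int) (weighted {0..<4} 3 m u)) D"
proof -
  define W where "W = {{i} \<times> e \<union> {j} \<times> f | i j e f. i \<in> {0, 1, 2::int} \<and> j \<in> {0, 1, 2} \<and> i \<noteq> j \<and>
    e \<in> far_pairs \<and> f \<in> far_pairs \<and> C e = C f}"
  define V where "V = block ` {\<phi>. coords \<phi>}"
  have Wcases: "\<exists>i j e f. w = {i} \<times> e \<union> {j} \<times> f \<and> i \<in> {0, 1, 2::int} \<and> j \<in> {0, 1, 2} \<and> i \<noteq> j \<and>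
    e \<in> far_pairs \<and> f \<in> far_pairs \<and> C e = C f" if "w \<in> W" for w using that unfolding W_def by blast
  have far: "e \<subseteq> {0..<m}" "card e = 2" "finite e" if "e \<in> far_pairs" for e
    using that by (auto simp: far_pairs_def intro: card_ge_0_finite)
  have "quadruple_design (cross_triples (3::int) (weighted {0..<4} 3 m u)) (V \<union> W)"
  proof (rule quadruple_designI')
    show "card T = 3" if "T \<in> cross_triples 3 (weighted {0..<4} 3 m u)" for T
      using that by (simp add: cross_triples_def triples_def)
    show "card b = 4" if bVW: "b \<in> V \<union> W" for b
    proof (cases "b \<in> V")
      case True
      then show ?thesis using card_block by (auto simp: V_def)
    next
      case False
      then have "b \<in> W" using bVW by simp
      from Wcases[OF this] obtain i j e f where w: "b = {i} \<times> e \<union> {j} \<times> f" "i \<noteq> j" "e \<in> far_pairs" "f \<in> far_pairs"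
        by (elim exE conjE) (rule that, assumption+)
      have "card b = card ({i} \<times> e) + card ({j} \<times> f)" unfolding w(1)
        using w far(3) by (intro card_Un_disjoint) auto
      then show ?thesis using far(2) w by (simp add: card_cartesian_product)
    qed
    show "T \<in> cross_triples 3 (weighted {0..<4} 3 m u)" if b: "b \<in> V \<union> W" and T: "T \<subseteq> b" "card T = 3" for b T
    proof -
      have finT: "finite T" using T(2) by (intro card_ge_0_finite) simp
      have "b \<subseteq> weighted {0..<4} 3 m u \<and> (\<exists>g\<in>fst ` T - {3}. \<exists>h\<in>fst ` T - {3}. g \<noteq> h)"
      proof (cases "b \<in> V")
        case True
        then obtain \<phi> where \<phi>: "coords \<phi>" "b = block \<phi>" by (auto simp: V_def)
        \<comment> \<open>Two points of \<open>T\<close> other than the completion lie on the graph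
          and hence in different groups outside the stem.\<close>
        have "card (T - {completion \<phi>}) \<ge> 2" using T(2) finT by (simp add: card_Diff_singleton_if)
        then obtain x y where xy: "x \<in> T - {completion \<phi>}" "y \<in> T - {completion \<phi>}" "x \<noteq> y"
          using card_le_Suc0_iff_eq[of "T - {completion \<phi>}"] finT by (metis finite_Diff not_less_eq_eq numeral_2_eq_2)
        then have "x \<in> graph \<phi>" "y \<in> graph \<phi>" using T(1) \<phi>(2) by (auto simp: block_def)
        then have "fst x \<noteq> fst y" "fst x \<noteq> 3" "fst y \<noteq> 3" using xy(3) by (auto simp: graph_def)
        moreover have "fst x \<in> fst ` T" "fst y \<in> fst ` T" using xy by auto
        ultimately show ?thesis using block_subset[OF \<phi>(1)] \<phi>(2) by blast
      next
        case False
        then have "b \<in> W" using b by simp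
        from Wcases[OF this] obtain i j e f where w: "b = {i} \<times> e \<union> {j} \<times> f" "i \<noteq> j" "e \<in> far_pairs" "f \<in> far_pairs"
            "i \<in> {0, 1, 2}" "j \<in> {0, 1, 2}"
          by (elim exE conjE) (rule that, assumption+)
        have "\<not> T \<subseteq> {i} \<times> e" if "e \<in> far_pairs" for i and e :: "int set"
          using card_mono[of "{i} \<times> e" T] far[OF that] T(2) by (auto simp: card_cartesian_product)
        then have "\<not> T \<subseteq> {i} \<times> e" "\<not> T \<subseteq> {j} \<times> f" using w by auto
        then obtain x y where "x \<in> T" "x \<notin> {i} \<times> e" "y \<in> T" "y \<notin> {j} \<times> f" by blast
        then have "fst x = j" "fst y = i" "j \<in> fst ` T" "i \<in> fst ` T" using T(1) w(1) by force+
        moreover have "i \<noteq> 3" "j \<noteq> 3" using w(5,6) by auto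
        moreover have "b \<subseteq> weighted {0..<4} 3 m u"
          using w far(1)[OF w(3)] far(1)[OF w(4)] by (auto simp: weighted_def)
        ultimately show ?thesis using w(2) by blast
      qed
      moreover have "2 \<le> card (fst ` T - {3})" if "\<exists>g\<in>fst ` T - {3}. \<exists>h\<in>fst ` T - {3}. g \<noteq> h"
        using that card_le_Suc0_iff_eq[of "fst ` T - {3}"] finT by (metis finite_Diff finite_imageI not_less_eq_eq numeral_2_eq_2)
      ultimately show ?thesis using T by (simp add: cross_triples_def triples_def) blast
    qed
    show "\<exists>b\<in>V \<union> W. T \<subseteq> b \<and> (\<forall>b'\<in>V \<union> W. T \<subseteq> b' \<longrightarrow> b' = b)"
      if "T \<in> cross_triples 3 (weighted {0..<4} 3 m u)" for T
      using that
    proof (cases rule: cross_triple_cases)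
      case (transversal \<phi>)
      have "b' = block \<phi>" if b': "b' \<in> V \<union> W" "T \<subseteq> b'" for b'
      proof (cases "b' \<in> V")
        case True
        then obtain \<psi> where \<psi>: "coords \<psi>" "b' = block \<psi>" by (auto simp: V_def)
        have mem: "\<phi> k = \<psi> k \<or> (k, \<phi> k) = completion \<psi>" if "k \<in> {0, 1, 2}" for k
        proof -
          have "(k, \<phi> k) \<in> block \<psi>" using that b'(2) transversal(2) \<psi>(2) by (auto simp: graph_def)
          then show ?thesis using in_block_iff(1)[OF that] by simp
        qed
        show ?thesis
        proof (cases "\<forall>k\<in>{0, 1, 2}. \<phi> k = \<psi> k")
          case True
          then have "block \<phi> = block \<psi>" by (intro block_cong) blast
          then show ?thesis using \<psi>(2) by simp
        next
          case False
          then obtain i where i: "i \<in> {0, 1, 2}" "\<phi> i \<noteq> \<psi> i" by blast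
          then have c: "completion \<psi> = (i, \<phi> i)" using mem by metis
          then have "u \<le> coord_sum \<psi>" using fst_completion(1)[of \<psi>] i(1) by (cases "coord_sum \<psi> < u") auto
          note fl = flip[OF \<psi>(1) this c]
          have "\<phi> k = (\<psi>(i := \<phi> i)) k" if "k \<in> {0, 1, 2}" for k using mem[OF that] c by auto
          then have "block \<phi> = block (\<psi>(i := \<phi> i))" by (rule block_cong)
          then show ?thesis using fl(3) \<psi>(2) by simp
        qed
      next
        case False
        then have "b' \<in> W" using b'(1) by simp
        from Wcases[OF this] obtain i j e f where w: "b' = {i} \<times> e \<union> {j} \<times> f" by (elim exE conjE) (rule that, assumption+)
        have "fst ` T \<subseteq> {i, j}" using b'(2) w by auto
        moreover have "fst ` T = {0, 1, 2}" using transversal(2) by (auto simp: graph_def image_image)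
        ultimately have "card {0, 1, 2::int} \<le> card {i, j}" by (metis card_mono finite.emptyI finite_insert)
        also have "\<dots> \<le> 2" by (simp add: card_insert_if)
        finally show ?thesis by simp
      qed
      moreover have "block \<phi> \<in> V \<union> W" "T \<subseteq> block \<phi>" using transversal by (auto simp: V_def block_def)
      ultimately show ?thesis by blast
    next
      case (stem s i j a b)
      obtain k where k: "k \<in> {0, 1, 2}" "k \<noteq> i" "k \<noteq> j" using third_index[OF stem(3-5)] .
      define \<phi> where "\<phi> = (\<lambda>x. if x = i then a else if x = j then b else (s - a - b) mod m)"
      have \<phi>: "\<phi> i = a" "\<phi> j = b" "\<phi> k = (s - a - b) mod m" using stem(5) k by (auto simp: \<phi>_def)
      have co: "coords \<phi>" unfolding coords_def \<phi>_def using stem(6-9) m_pos by simp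
      have perm: "\<psi> 0 + \<psi> 1 + \<psi> 2 = \<psi> i + \<psi> j + \<psi> k" for \<psi> :: "int \<Rightarrow> int"
        by (rule sum_perm(1)[OF stem(3,4) k(1) stem(5) k(3)[symmetric] k(2)[symmetric]])
      have "coord_sum \<phi> = (a + b + (s - a - b) mod m) mod m" unfolding coord_sum_def perm \<phi> ..
      also have "\<dots> = s" using stem m u q by (simp add: mod_add_right_eq)
      finally have cs: "coord_sum \<phi> = s" .
      have "completion \<phi> = (3, s)" using completion_less[of \<phi>] cs stem(2) by simp
      then have sub: "T \<subseteq> block \<phi>" using stem \<phi> by (auto simp: in_block_iff)
      have "b' = block \<phi>" if b': "b' \<in> V \<union> W" "T \<subseteq> b'" for b'
      proof (cases "b' \<in> V")
        case True
        then obtain \<psi> where \<psi>: "coords \<psi>" "b' = block \<psi>" by (auto simp: V_def)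
        have c: "completion \<psi> = (3, s)" using b'(2) \<psi>(2) stem(10) in_block_iff(2)[of s \<psi>] by auto
        then have cs': "coord_sum \<psi> = s" using fst_completion(1)[of \<psi>] completion_less[of \<psi>] by simp
        have "\<psi> i = a" "\<psi> j = b"
          using b'(2) \<psi>(2) stem(10) in_block_iff(1)[OF stem(3), of a \<psi>] in_block_iff(1)[OF stem(4), of b \<psi>] c stem(3,4)
          by auto
        moreover have "\<psi> k = \<phi> k"
        proof -
          have "(a + b + \<psi> k) mod m = s" using cs' calculation unfolding coord_sum_def perm by simp
          then have "(s - a - b) mod m = (a + b + \<psi> k - a - b) mod m" by (metis mod_diff_left_eq)
          then show ?thesis using \<psi>(1) k(1) \<phi>(3) by (auto simp: coords_def)
        qed
        ultimately have "\<psi> x = \<phi> x" if "x \<in> {0, 1, 2}" for x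
          using that sum_perm(2)[OF stem(3,4) k(1) stem(5) k(3)[symmetric] k(2)[symmetric]] \<phi> by auto
        then have "block \<psi> = block \<phi>" by (rule block_cong)
        then show ?thesis using \<psi>(2) by simp
      next
        case False
        then have "b' \<in> W" using b'(1) by simp
        from Wcases[OF this] obtain i' j' e f where w: "b' = {i'} \<times> e \<union> {j'} \<times> f" "i' \<in> {0, 1, 2}" "j' \<in> {0, 1, 2}"
          by (elim exE conjE) (rule that, assumption+)
        have "(3, s) \<in> b'" using b'(2) stem(10) by auto
        then show ?thesis using w by auto
      qed
      moreover have "block \<phi> \<in> V \<union> W" using co by (auto simp: V_def)
      ultimately show ?thesis using sub by blast
    next
      case (pair i j e b)
      obtain a a' where a: "e = {a, a'}" "a \<noteq> a'" using pair(5) by (meson card_2_iff)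
      have ar: "0 \<le> a" "a < m" "0 \<le> a'" "a' < m" using pair(4) a by auto
      obtain k where k: "k \<in> {0, 1, 2}" "k \<noteq> i" "k \<noteq> j" using third_index[OF pair(1-3)] .
      have perm: "\<psi> 0 + \<psi> 1 + \<psi> 2 = \<psi> i + \<psi> j + \<psi> k" for \<psi> :: "int \<Rightarrow> int"
        by (rule sum_perm(1)[OF pair(1,2) k(1) pair(3) k(3)[symmetric] k(2)[symmetric]])
      have perm2: "{0, 1, 2} = {i, j, k}"
        by (rule sum_perm(2)[OF pair(1,2) k(1) pair(3) k(3)[symmetric] k(2)[symmetric]])
      have inT: "(i, a) \<in> T" "(i, a') \<in> T" "(j, b) \<in> T" using pair(8) a by auto
      text \<open>A block of the first kind through the pair can be flipped so that the first point of the pair lies on the graph.\<close>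
      have norm: "\<exists>\<psi>. coords \<psi> \<and> b' = block \<psi> \<and> \<psi> i = x \<and> \<psi> j = b \<and> u \<le> coord_sum \<psi> \<and> completion \<psi> = (i, y)"
        if b': "b' \<in> V" "T \<subseteq> b'" and xy: "{x, y} = {a, a'}" for b' x y
      proof -
        obtain \<psi> where \<psi>: "coords \<psi>" "b' = block \<psi>" using b'(1) by (auto simp: V_def)
        have "x = a \<and> y = a' \<or> x = a' \<and> y = a" using xy by (auto simp: doubleton_eq_iff)
        then have m: "(i, x) \<in> block \<psi>" "(i, y) \<in> block \<psi>" "(j, b) \<in> block \<psi>" "x \<noteq> y"
          using inT b'(2) \<psi>(2) a(2) by auto
        have "x = \<psi> i \<or> (i, x) = completion \<psi>" "y = \<psi> i \<or> (i, y) = completion \<psi>"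
          using m(1,2) by (simp_all only: in_block_iff(1)[OF pair(1)])
        then have or: "\<psi> i = x \<and> completion \<psi> = (i, y) \<or> \<psi> i = y \<and> completion \<psi> = (i, x)"
          using m(4) by (metis prod.inject)
        then have "fst (completion \<psi>) = i" by auto
        then have ge: "u \<le> coord_sum \<psi>" using fst_completion(1)[of \<psi>] pair(1) by (cases "coord_sum \<psi> < u") auto
        have j: "\<psi> j = b" using m(3) in_block_iff(1)[OF pair(2), of b \<psi>] or pair(3) by auto
        show ?thesis
          using or
        proof
          assume "\<psi> i = x \<and> completion \<psi> = (i, y)"
          then show ?thesis using \<psi> ge j by blast
        next
          assume o: "\<psi> i = y \<and> completion \<psi> = (i, x)"
          note fl = flip[OF \<psi>(1) ge conjunct2[OF o]]
          let ?\<psi> = "\<psi>(i := x)"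
          have "completion ?\<psi> = (i, y)" using fl(2) o by simp
          moreover have "u \<le> coord_sum ?\<psi>"
            using fst_completion(1)[of ?\<psi>] calculation pair(1) by (cases "coord_sum ?\<psi> < u") auto
          ultimately show ?thesis using fl(1,3) \<psi>(2) j pair(3) by (intro exI[of _ ?\<psi>]) auto
        qed
      qed
      show ?thesis
      proof (cases "near a a'")
        case True
        then obtain r where r: "0 \<le> r" "r < 2 * q" "m dvd a' - a - (2 * q - 1 - 2 * r)" by (auto simp: near_def)
        \<comment> \<open>The sum at position \<open>r\<close> of the interval is the one whose
          reflection displaces \<open>a\<close> to \<open>a'\<close>.\<close>
        define \<sigma> where "\<sigma> = lo i + r"
        have \<sigma>: "lo i \<le> \<sigma>" "\<sigma> < lo i + 2 * q" using r by (auto simp: \<sigma>_def)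
        note \<sigma>' = interval_of_eq[OF pair(1) \<sigma>]
        have dvd: "m dvd a' - a - (reflection i - 2 * \<sigma>)" using r(3) by (simp add: reflection_def \<sigma>_def algebra_simps)
        define \<phi> where "\<phi> = (\<lambda>x. if x = i then a else if x = j then b else (\<sigma> - a - b) mod m)"
        have \<phi>: "\<phi> i = a" "\<phi> j = b" "\<phi> k = (\<sigma> - a - b) mod m" using pair(3) k by (auto simp: \<phi>_def)
        have co: "coords \<phi>" unfolding coords_def \<phi>_def using pair(6,7) ar m_pos by simp
        have "coord_sum \<phi> = (a + b + (\<sigma> - a - b) mod m) mod m" unfolding coord_sum_def perm \<phi> ..
        also have "\<dots> = \<sigma>" using \<sigma>' u by (simp add: mod_add_right_eq)
        finally have cs: "coord_sum \<phi> = \<sigma>" .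
        have "completion \<phi> = (i, (a + reflection i - 2 * \<sigma>) mod m)"
          using completion_ge[of \<phi> i] cs \<sigma>' \<phi> by simp
        also have "(a + reflection i - 2 * \<sigma>) mod m = a' mod m"
          using dvd by (intro mod_eq_dvd_iff[THEN iffD2]) (simp add: dvd_diff_commute algebra_simps)
        also have "\<dots> = a'" using ar by simp
        finally have c\<phi>: "completion \<phi> = (i, a')" .
        have sub: "T \<subseteq> block \<phi>" unfolding pair(8) a(1) using pair(1,2) c\<phi> \<phi> by (auto simp: in_block_iff)
        have "b' = block \<phi>" if b': "b' \<in> V \<union> W" "T \<subseteq> b'" for b'
        proof (cases "b' \<in> V")
          case True
          obtain \<psi> where \<psi>: "coords \<psi>" "b' = block \<psi>" "\<psi> i = a" "\<psi> j = b" "u \<le> coord_sum \<psi>" "completion \<psi> = (i, a')"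
            using norm[OF True b'(2), of a a'] by blast
          let ?s = "coord_sum \<psi>"
          have ii: "interval_of ?s = i" using completion_ge[OF \<psi>(5) refl] \<psi>(6) by simp
          have sr: "lo i \<le> ?s" "?s < lo i + 2 * q"
            using interval_of_iff[OF \<psi>(5) coord_sum_range(2)] by (simp_all add: ii)
          have "a' = (a + reflection i - 2 * ?s) mod m" using completion_ge[OF \<psi>(5) ii[symmetric]] \<psi>(3,6) by simp
          then have "m dvd (a + reflection i - 2 * ?s) - a'" by (simp add: dvd_minus_mod)
          then have "m dvd ((a + reflection i - 2 * ?s) - a') + (a' - a - (reflection i - 2 * \<sigma>))" using dvd by (rule dvd_add)
          \<comment> \<open>Both sums lie in an interval of length \<open>2 * q\<close>, so twice
            their difference is smaller than \<open>4 * q < m\<close> in absolute value and must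
            vanish.\<close>
          then have "m dvd 2 * (\<sigma> - ?s)" by (simp add: algebra_simps)
          moreover have "\<bar>2 * (\<sigma> - ?s)\<bar> < m" using sr \<sigma> m u by (simp add: abs_less_iff)
          ultimately have s\<sigma>: "?s = \<sigma>" using dvd_small by fastforce
          have "\<psi> k = \<phi> k"
          proof -
            have "(a + b + \<psi> k) mod m = \<sigma>" using s\<sigma> \<psi>(3,4) unfolding coord_sum_def perm by simp
            then have "(\<sigma> - a - b) mod m = (a + b + \<psi> k - a - b) mod m" by (metis mod_diff_left_eq)
            then show ?thesis using \<psi>(1) k(1) \<phi>(3) by (auto simp: coords_def)
          qed
          then have "\<psi> x = \<phi> x" if "x \<in> {0, 1, 2}" for x using that unfolding perm2 using \<psi>(3,4) \<phi> by auto
          then have "block \<psi> = block \<phi>" by (rule block_cong)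
        then show ?thesis using \<psi>(2) by simp
        next
          case False
          then have "b' \<in> W" using b'(1) by simp
          from Wcases[OF this] obtain i' j' e' f where w: "b' = {i'} \<times> e' \<union> {j'} \<times> f" "e' \<in> far_pairs" "f \<in> far_pairs" "i' \<noteq> j'"
            by (elim exE conjE) (rule that, assumption+)
          have "(i, a) \<in> b'" "(i, a') \<in> b'" using inT b'(2) by auto
          then have "a \<in> e' \<and> a' \<in> e' \<or> a \<in> f \<and> a' \<in> f" using w by auto
          then show ?thesis using w(2,3) True by (auto simp: far_pairs_def)
        qed
        moreover have "block \<phi> \<in> V \<union> W" using co by (auto simp: V_def)
        ultimately show ?thesis using sub by blast
      next
        case False
        have nV: "b' \<notin> V" if Tb: "T \<subseteq> b'" for b'
        proof
          assume "b' \<in> V"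
          then obtain \<psi> where \<psi>: "coords \<psi>" "\<psi> i = a" "u \<le> coord_sum \<psi>" "completion \<psi> = (i, a')"
            using norm[OF _ Tb, of a a'] by blast
          then show False using flip(5)[OF \<psi>(1,3,4)] False by simp
        qed
        have e: "e \<in> far_pairs"
          using far_pair_iff[of a a'] False a ar by simp
        obtain f where f: "f \<in> far_pairs" "b \<in> f" "C f = C e" using C[OF e pair(6,7)] by blast
        let ?w = "{i} \<times> e \<union> {j} \<times> f"
        have "C e = C f" using f(3) by simp
        then have "?w \<in> W" unfolding W_def using e f(1) pair(1-3) by blast
        then have "?w \<in> V \<union> W" by simp
        moreover have "T \<subseteq> ?w" using pair(8) f by auto
        moreover have "b' = ?w" if b': "b' \<in> V \<union> W" "T \<subseteq> b'" for b'
        proof -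
          have "b' \<in> W" using b' nV[OF b'(2)] by simp
          from Wcases[OF this] obtain i' j' e' f' where w: "b' = {i'} \<times> e' \<union> {j'} \<times> f'" "i' \<noteq> j'" "e' \<in> far_pairs" "f' \<in> far_pairs" "C e' = C f'"
            by (elim exE conjE) (rule that, assumption+)
          have *: "b' = ?w" if "b' = {i} \<times> e'' \<union> {j} \<times> f''" "e'' \<in> far_pairs" "f'' \<in> far_pairs" "C e'' = C f''" for e'' f''
          proof -
            have "e \<subseteq> e''" "b \<in> f''" using b'(2) that(1) pair(3,8) by auto
            then have "e = e''" using far[OF that(2)] pair(5) by (metis card_subset_eq)
            then have "f'' = f" using C[OF e pair(6,7)] f that(3,4) \<open>b \<in> f''\<close> by metis
            then show ?thesis using that(1) \<open>e = e''\<close> by simp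
          qed
          have "i \<in> {i', j'}" "j \<in> {i', j'}" using inT b'(2) w(1) by auto
          then have "i = i' \<and> j = j' \<or> i = j' \<and> j = i'" using pair(3) by auto
          then show ?thesis
          proof
            assume "i = i' \<and> j = j'"
            then show ?thesis using *[of e' f'] w by simp
          next
            assume "i = j' \<and> j = i'"
            then show ?thesis using *[of f' e'] w by (simp add: Un_commute)
          qed
        qed
        ultimately show ?thesis by blast
      qed
    qed
  qed
  then show ?thesis by blast
qed

lemma near_odd:
  assumes "even m" "near a b"
  shows "odd (b - a)"
proof -
  obtain r where "m dvd b - a - (2 * q - 1 - 2 * r)" using assms(2) by (auto simp: near_def)
  then have "even (b - a - (2 * q - 1 - 2 * r))" using assms(1) dvd_trans by blast
  then show ?thesis by presburger
qed

lemma near_cong: "m dvd (b - a) - (b' - a') \<Longrightarrow> near a b \<Longrightarrow> near a' b'"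
proof -
  assume d: "m dvd (b - a) - (b' - a')" and "near a b"
  then obtain r where r: "0 \<le> r" "r < 2 * q" "m dvd b - a - (2 * q - 1 - 2 * r)" by (auto simp: near_def)
  have "m dvd (b - a - (2 * q - 1 - 2 * r)) - ((b - a) - (b' - a'))" using r(3) d by (rule dvd_diff)
  then show ?thesis unfolding near_def using r(1,2) by (intro exI[of _ r]) (simp add: algebra_simps)
qed

text \<open>For even \<open>m\<close> all near pairs have odd difference, and \<open>h\<close>
  exceeds \<open>2 * q\<close>, so pairs at even difference or at difference \<open>h\<close> are
  far; \<open>K\<close> has to factor the graph that they form. The difference \<open>h\<close>
  joins this graph for the sake of odd \<open>h\<close>, where the two parity classes have odd size
  and admit no one-factorization. The other far pairs have odd differences and factor by
  themselves.\<close>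

theorem cross_design_even_tripling:
  fixes K :: "int \<Rightarrow> int \<Rightarrow> int"
  assumes h: "m = 2 * h"
    and K_sym: "\<And>x y. K x y = K y x"
    and K: "\<And>x y b. x \<noteq> y \<Longrightarrow> 0 \<le> x \<Longrightarrow> x < m \<Longrightarrow> 0 \<le> y \<Longrightarrow> y < m \<Longrightarrow> even (y - x) \<or> m dvd y - x - h \<Longrightarrow> 0 \<le> b \<Longrightarrow> b < m \<Longrightarrow>
      \<exists>!z. 0 \<le> z \<and> z < m \<and> z \<noteq> b \<and> (even (z - b) \<or> m dvd z - b - h) \<and> K b z = K x y"
  shows "\<exists>D. quadruple_design (cross_triples (3::int) (weighted {0..<4} 3 m u)) D"
proof -
  have ev: "even m" using h by simp
  define spec where "spec x y \<longleftrightarrow> even (y - x) \<or> m dvd y - x - h" for x y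
  have spec_sym: "spec x y \<longleftrightarrow> spec y x" for x y
  proof -
    have "m dvd x - y - h" if "m dvd y - x - h" for x y
    proof -
      have "m dvd - (y - x - h)" using that by (simp only: dvd_minus_iff)
      then have "m dvd - (y - x - h) - m" by (rule dvd_diff) simp
      then show ?thesis using h by (simp add: algebra_simps)
    qed
    then show ?thesis by (auto simp: spec_def)
  qed
  have spec_far: "\<not> near x y" if "spec x y" for x y
  proof
    assume n: "near x y"
    then have "m dvd y - x - h" using that near_odd[OF ev n] by (auto simp: spec_def)
    then show False
    proof -
      obtain r where r: "0 \<le> r" "r < 2 * q" "m dvd y - x - (2 * q - 1 - 2 * r)" using n by (auto simp: near_def)
      have "m dvd (y - x - (2 * q - 1 - 2 * r)) - (y - x - h)" using r(3) \<open>m dvd y - x - h\<close> by (rule dvd_diff)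
      then have "m dvd h - (2 * q - 1 - 2 * r)" by (simp add: algebra_simps)
      moreover have "\<bar>h - (2 * q - 1 - 2 * r)\<bar> < m" using r h m u q by (simp add: abs_less_iff)
      ultimately have "h - (2 * q - 1 - 2 * r) = 0" by (rule dvd_small)
      then show False using r h m u q by linarith
    qed
  qed
  \<comment> \<open>On a pair of mixed parity this is the difference directed from the even to the
    odd end. Each value gives every point exactly one partner.\<close>
  define alt where "alt e = (\<Sum>x\<in>e. if odd x then x else - x) mod m" for e :: "int set"
  define C where "C e = (if spec (Min e) (Max e) then Inr (K (Min e) (Max e)) else Inl (alt e))" for e
  have C2: "C {x, y} = (if spec x y then Inr (K x y) else Inl (alt {x, y}))" if "x \<noteq> y" for x y
  proof (cases "x < y")
    case True
    then have "Min {x, y} = x" "Max {x, y} = y" by auto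
    then show ?thesis by (simp add: C_def)
  next
    case False
    then have "Min {x, y} = y" "Max {x, y} = x" using that by auto
    then show ?thesis using spec_sym[of x y] K_sym[of x y] by (simp add: C_def)
  qed
  have alt2: "alt {x, y} = (y - x) mod m" if "even x" "odd y" for x y
  proof -
    have "x \<noteq> y" using that by auto
    then show ?thesis using that by (simp add: alt_def)
  qed
  show ?thesis
  proof (rule cross_design_tripling[of C])
    fix e b assume e: "e \<in> far_pairs" and b: "0 \<le> b" "b < m"
    obtain x y where xy: "e = {x, y}" "x \<noteq> y" using e by (auto simp: far_pairs_def card_2_iff)
    have r: "0 \<le> x" "x < m" "0 \<le> y" "y < m" "\<not> near x y" using e far_pair_iff[OF xy(2)] xy(1) by auto
    have "\<exists>!z. z \<noteq> b \<and> {b, z} \<in> far_pairs \<and> C {b, z} = C e"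
    proof (cases "spec x y")
      case True
      then have Ce: "C e = Inr (K x y)" using C2[OF xy(2)] xy(1) by simp
      have "\<exists>!z. 0 \<le> z \<and> z < m \<and> z \<noteq> b \<and> spec b z \<and> K b z = K x y"
        using K[OF xy(2) r(1-4) _ b] True unfolding spec_def by simp
      moreover have "z \<noteq> b \<and> {b, z} \<in> far_pairs \<and> C {b, z} = C e \<longleftrightarrow>
          0 \<le> z \<and> z < m \<and> z \<noteq> b \<and> spec b z \<and> K b z = K x y" for z
        using far_pair_iff[of b z] C2[of b z] spec_far[of b z] b by (auto simp: Ce split: if_splits)
      ultimately show ?thesis by simp
    next
      case False
      then have Ce: "C e = Inl (alt e)" using C2[OF xy(2)] xy(1) by simp
      have "odd (y - x)" using False by (simp add: spec_def)
      then obtain x' y' where x': "e = {x', y'}" "even x'" "odd y'" "x' \<noteq> y'"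
        using xy by (cases "even x") (auto simp: insert_commute)
      define t where "t = y' - x'"
      have alte: "alt e = t mod m" using alt2[OF x'(2,3)] x'(1) by (simp add: t_def)
      have far': "\<not> near x' y'" using e far_pair_iff[OF x'(4)] x'(1) by simp
      have nspec: "\<not> spec x' y'"
        using False spec_sym x'(1) xy(1) by (metis doubleton_eq_iff)
      then have th: "\<not> m dvd t - h" "odd t" using x' by (auto simp: spec_def t_def)
      define z where "z = (if even b then b + t else b - t) mod m"
      have z: "0 \<le> z" "z < m" using m_pos by (simp_all add: z_def)
      have zb: "m dvd z - (if even b then b + t else b - t)"
        unfolding z_def by (metis dvd_diff_commute dvd_minus_mod)
      then have "even (z - (if even b then b + t else b - t))" using ev dvd_trans by blast
      then have par: "odd (z - b)" using th(2) by (auto split: if_splits)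
      have C_iff: "w \<noteq> b \<and> {b, w} \<in> far_pairs \<and> C {b, w} = C e \<longleftrightarrow> w = z" for w
      proof
        assume w: "w \<noteq> b \<and> {b, w} \<in> far_pairs \<and> C {b, w} = C e"
        then have ns: "\<not> spec b w" and al: "alt {b, w} = t mod m"
          using C2[of b w] Ce alte by (auto split: if_splits)
        have wr: "0 \<le> w" "w < m" using w far_pair_iff[of b w] by auto
        have ow: "odd (w - b)" using ns by (simp add: spec_def)
        have "w mod m = (if even b then b + t else b - t) mod m"
        proof (cases "even b")
          case True
          then have "(w - b) mod m = t mod m" using al alt2[of b w] ow by simp
          then have "m dvd (w - b) - t" by (simp add: mod_eq_dvd_iff)
          then show ?thesis using True by (simp add: mod_eq_dvd_iff algebra_simps)
        next
          case False
          then have "(b - w) mod m = t mod m" using al alt2[of w b] ow by (simp add: insert_commute)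
          then have "m dvd (b - w) - t" by (simp add: mod_eq_dvd_iff)
          then have "m dvd - ((b - w) - t)" by (simp only: dvd_minus_iff)
          then show ?thesis using False by (simp add: mod_eq_dvd_iff algebra_simps)
        qed
        then show "w = z" using wr by (simp add: z_def)
      next
        assume w: "w = z"
        have zb': "z \<noteq> b" using par by auto
        have "\<not> near b z \<and> \<not> spec b z \<and> alt {b, z} = t mod m"
        proof (cases "even b")
          case True
          have d: "m dvd (z - b) - t" using zb True by (simp add: algebra_simps)
          have "near b z \<Longrightarrow> near x' y'" by (rule near_cong) (use d in \<open>simp_all add: t_def\<close>)
          moreover have "m dvd t - h" if "m dvd z - b - h"
            using dvd_diff[OF that d] by (simp add: algebra_simps)
          moreover have "alt {b, z} = t mod m"
            using alt2[of b z] True par d by (simp add: mod_eq_dvd_iff)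
          ultimately show ?thesis using far' th par by (auto simp: spec_def)
        next
          case False
          have "m dvd - (z - (b - t))" using zb False by (simp only: dvd_minus_iff if_False)
          then have d: "m dvd (b - z) - t" by (simp add: algebra_simps)
          have "near z b \<Longrightarrow> near x' y'" by (rule near_cong) (use d in \<open>simp_all add: t_def\<close>)
          moreover have "m dvd t - h" if "m dvd b - z - h"
            using dvd_diff[OF that d] by (simp add: algebra_simps)
          moreover have "alt {z, b} = t mod m"
            using alt2[of z b] False par d by (simp add: mod_eq_dvd_iff)
          moreover have "odd (b - z)" using par by simp
          ultimately have "\<not> near z b \<and> \<not> spec z b \<and> alt {z, b} = t mod m" using far' th by (auto simp: spec_def)
          then show ?thesis using near_sym[of b z] spec_sym[of b z] by (auto simp: insert_commute)
        qed
        then show "w \<noteq> b \<and> {b, w} \<in> far_pairs \<and> C {b, w} = C e"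
          using w zb' z b far_pair_iff[of b z] C2[of b z] Ce alte by simp
      qed
      show ?thesis unfolding C_iff by simp
    qed
    then obtain z where z: "z \<noteq> b" "{b, z} \<in> far_pairs" "C {b, z} = C e"
      and uz: "\<And>w. w \<noteq> b \<Longrightarrow> {b, w} \<in> far_pairs \<Longrightarrow> C {b, w} = C e \<Longrightarrow> w = z" by metis
    show "\<exists>!f. f \<in> far_pairs \<and> b \<in> f \<and> C f = C e"
    proof (rule ex1I[of _ "{b, z}"])
      fix f assume f: "f \<in> far_pairs \<and> b \<in> f \<and> C f = C e"
      then obtain p p' where "f = {p, p'}" "p \<noteq> p'" by (auto simp: far_pairs_def card_2_iff)
      then obtain w where "f = {b, w}" "w \<noteq> b" using f by (auto simp: insert_commute)
      then show "f = {b, z}" using uz f by blast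
    qed (use z in auto)
  qed
qed

text \<open>For even \<open>s\<close> the rule \<open>x + y = s\<close> leaves unmatched the
  solutions of \<open>2 * b = s\<close> modulo \<open>m\<close>. They are two points
  \<open>b\<close> and \<open>b + h\<close>, one in each parity class as \<open>h\<close> is odd,
  and the pair at distance \<open>h\<close> joins them; adding \<open>h\<close> to the sum of this
  pair gives it the colour \<open>s\<close>.\<close>

lemma cross_design_odd_half:
  assumes h: "m = 2 * h" "odd h"
  shows "\<exists>D. quadruple_design (cross_triples (3::int) (weighted {0..<4} 3 m u)) D"
proof (rule cross_design_even_tripling[OF h(1), of "\<lambda>x y. (if even (y - x) then x + y else x + y + h) mod m"])
  let ?K = "\<lambda>x y. (if even (y - x) then x + y else x + y + h) mod m"
  have ev: "even m" using h by simp
  fix x y b :: int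
  show "?K x y = ?K y x" by (simp add: add.commute)
  assume r: "0 \<le> b" "b < m"
  define s where "s = ?K x y"
  assume "even (y - x) \<or> m dvd y - x - h"
  have s: "even s" "0 \<le> s" "s < m"
  proof -
    have "even (if even (y - x) then x + y else x + y + h)" using h(2) by auto
    then show "even s" unfolding s_def using ev by (simp add: dvd_mod_iff)
    show "0 \<le> s" "s < m" using m_pos by (simp_all add: s_def)
  qed
  define z where "z = (if m dvd 2 * b - s then b + h else s - b) mod m"
  have z: "0 \<le> z" "z < m" using m_pos by (simp_all add: z_def)
  have zm: "m dvd z - (if m dvd 2 * b - s then b + h else s - b)"
    unfolding z_def by (metis dvd_diff_commute dvd_minus_mod)
  have iff: "0 \<le> w \<and> w < m \<and> w \<noteq> b \<and> (even (w - b) \<or> m dvd w - b - h) \<and> ?K b w = s \<longleftrightarrow> w = z" for w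
  proof
    assume w: "0 \<le> w \<and> w < m \<and> w \<noteq> b \<and> (even (w - b) \<or> m dvd w - b - h) \<and> ?K b w = s"
    then have wr: "0 \<le> w" "w < m" "w \<noteq> b" by blast+
    have "w mod m = z"
    proof (cases "even (w - b)")
      case True
      then have "(b + w) mod m = s mod m" using w s by simp
      then have d: "m dvd b + w - s" by (simp add: mod_eq_dvd_iff)
      have "\<not> m dvd 2 * b - s"
      proof
        assume "m dvd 2 * b - s"
        then have "m dvd (b + w - s) - (2 * b - s)" using d by (rule dvd_diff[rotated])
        then have "m dvd w - b" by (simp add: algebra_simps)
        then have "w - b = 0" by (rule dvd_small) (use wr r in \<open>simp add: abs_less_iff\<close>)
        then show False using wr by simp
      qed
      then show ?thesis using d by (simp add: z_def mod_eq_dvd_iff algebra_simps)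
    next
      case False
      then have d: "m dvd w - b - h" using w by blast
      have "(b + w + h) mod m = s mod m" using w s False by simp
      then have "m dvd b + w + h - s" by (simp add: mod_eq_dvd_iff)
      then have "m dvd (b + w + h - s) - (w - b - h) - m" using d by (rule dvd_diff[OF dvd_diff dvd_refl])
      then have "m dvd 2 * b - s" using h(1) by (simp add: algebra_simps)
      then show ?thesis using d by (simp add: z_def mod_eq_dvd_iff algebra_simps)
    qed
    then show "w = z" using wr by simp
  next
    assume w: "w = z"
    show "0 \<le> w \<and> w < m \<and> w \<noteq> b \<and> (even (w - b) \<or> m dvd w - b - h) \<and> ?K b w = s"
    proof (cases "m dvd 2 * b - s")
      case True
      then have d: "m dvd z - (b + h)" using zm by simp
      then have "even (z - (b + h))" using ev dvd_trans by blast
      then have o: "odd (z - b)" using h(2) by auto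
      have "m dvd (z - (b + h)) + (2 * b - s) + m" using d True by (rule dvd_add[OF dvd_add dvd_refl])
      then have "m dvd (b + z + h) - s" using h(1) by (simp add: algebra_simps)
      then have "(b + z + h) mod m = s mod m" by (simp add: mod_eq_dvd_iff)
      then show ?thesis using w z o d s by (auto simp: algebra_simps)
    next
      case False
      then have d: "m dvd z - (s - b)" using zm by simp
      then have "even (z - (s - b))" using ev dvd_trans by blast
      then have e: "even (z - b)" using s(1) by auto
      have "z \<noteq> b" using d False by (auto simp: algebra_simps)
      moreover have "(b + z) mod m = s mod m" using d by (simp add: mod_eq_dvd_iff algebra_simps)
      ultimately show ?thesis using w z e s by simp
    qed
  qed
  show "\<exists>!z. 0 \<le> z \<and> z < m \<and> z \<noteq> b \<and> (even (z - b) \<or> m dvd z - b - h) \<and> ?K b z = ?K x y"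
    using iff unfolding s_def by simp
qed

text \<open>Now difference \<open>h\<close> is even itself. Halving identifies each parity class
  with \<open>{0..<h}\<close>, which has even size, so a round robin works in both. The value 0 is a
  mere default, as distinct numbers of equal parity have distinct halves.\<close>

lemma cross_design_even_half:
  assumes h: "m = 2 * h" "even h"
  shows "\<exists>D. quadruple_design (cross_triples (3::int) (weighted {0..<4} 3 m u)) D"
proof (rule cross_design_even_tripling[OF h(1), of "\<lambda>x y. if x div 2 = y div 2 then 0 else round_robin h (x div 2) (y div 2)"])
  let ?K = "\<lambda>x y. if x div 2 = y div 2 then 0 else round_robin h (x div 2) (y div 2)"
  have h2: "h \<ge> 2" using h m_pos by presburger
  note F = one_factorization_round_robin[OF h(2) h2, unfolded one_factorization_def]
  fix x y b :: int
  show "?K x y = ?K y x" by (simp add: round_robin_def add.commute)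
  assume xy: "x \<noteq> y" "0 \<le> x" "x < m" "0 \<le> y" "y < m" and b: "0 \<le> b" "b < m"
  have spec: "even (v - w) \<or> m dvd v - w - h \<longleftrightarrow> even (v - w)" for v w
  proof -
    have "even (v - w)" if "m dvd v - w - h"
    proof -
      have "even (v - w - h)" using that h(1) by (metis dvd_trans dvd_triv_left)
      then show ?thesis using h(2) by simp
    qed
    then show ?thesis by blast
  qed
  assume "even (y - x) \<or> m dvd y - x - h"
  then have e: "even (y - x)" using spec by blast
  have ne: "w div 2 \<noteq> v div 2" if "even (w - v)" "w \<noteq> v" for v w :: int using that by presburger
  have rng: "w div 2 \<in> {0..<h}" if "0 \<le> w" "w < m" for w using that h(1) by auto
  define c where "c = round_robin h (x div 2) (y div 2)"
  have xd: "x div 2 \<noteq> y div 2" using ne[of x y] e xy(1) by (simp add: even_diff)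
  have "c \<in> {0..<h - 1}" using F rng xy xd unfolding c_def by blast
  then have "\<exists>!t. t \<in> {0..<h} \<and> t \<noteq> b div 2 \<and> round_robin h (b div 2) t = c" using F rng[OF b] by blast
  then obtain t where t: "t \<in> {0..<h}" "t \<noteq> b div 2" "round_robin h (b div 2) t = c"
    and ut: "\<And>t'. t' \<in> {0..<h} \<Longrightarrow> t' \<noteq> b div 2 \<Longrightarrow> round_robin h (b div 2) t' = c \<Longrightarrow> t' = t"
    unfolding Ex1_def by blast
  define z where "z = 2 * t + b mod 2"
  have z2: "z div 2 = t" "z mod 2 = b mod 2" by (simp_all add: z_def)
  have z: "0 \<le> z" "z < m" "z \<noteq> b" "even (z - b)" using t h(1) z2 by (auto simp: z_def)
  have uniq: "w = z" if w: "0 \<le> w" "w < m" "w \<noteq> b" "even (w - b)" "?K b w = c" for w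
  proof -
    have "w div 2 \<noteq> b div 2" using ne w by blast
    then have "w div 2 = t" using ut[OF rng[OF w(1,2)]] w(5) by simp
    moreover have "w mod 2 = b mod 2" using w(4) by presburger
    ultimately show ?thesis using z2 by (metis div_mult_mod_eq)
  qed
  have zc: "?K b z = c" using z2 t by simp
  have xyc: "?K x y = c" using xd by (simp add: c_def)
  show "\<exists>!z. 0 \<le> z \<and> z < m \<and> z \<noteq> b \<and> (even (z - b) \<or> m dvd z - b - h) \<and> ?K b z = ?K x y"
    unfolding spec xyc
  proof (rule ex1I[of _ z])
    show "0 \<le> z \<and> z < m \<and> z \<noteq> b \<and> even (z - b) \<and> ?K b z = c" using z zc by blast
  next
    fix w assume "0 \<le> w \<and> w < m \<and> w \<noteq> b \<and> even (w - b) \<and> ?K b w = c"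
    then show "w = z" using uniq by blast
  qed
qed

end

section \<open>Shift-invariant systems on the grid\<close>

definition shift :: "int \<Rightarrow> int \<Rightarrow> int \<times> int \<Rightarrow> int \<times> int" where
  "shift v r p = (fst p, (snd p + r) mod v)"

definition grid :: "int \<Rightarrow> int \<Rightarrow> (int \<times> int) set" where
  "grid u v = {0..<u} \<times> {0..<v}"

definition cyclic_sqs :: "int \<Rightarrow> int \<Rightarrow> (int \<times> int) set set \<Rightarrow> bool" where
  "cyclic_sqs u v B \<longleftrightarrow> sqs (grid u v) B \<and> (\<forall>b\<in>B. shift v 1 ` b \<in> B) \<and>
     4 * int (card {b \<in> B. shift v (v div 2) ` b = b}) = u * v"

lemma shift_shift: "shift v r (shift v s p) = shift v (r + s) p"
  by (simp add: shift_def mod_simps add_ac)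

lemma shift_cong: "r mod v = s mod v \<Longrightarrow> shift v r p = shift v s p"
  unfolding shift_def by (metis mod_add_right_eq)

lemma shift_0: "p \<in> grid u v \<Longrightarrow> shift v 0 p = p"
  by (auto simp: shift_def grid_def)

lemma shift_grid: "v > 0 \<Longrightarrow> p \<in> grid u v \<Longrightarrow> shift v r p \<in> grid u v"
  by (auto simp: shift_def grid_def)

lemma inj_on_shift: "inj_on (shift v r) (grid u v)"
proof (rule inj_on_inverseI[where g = "shift v (- r)"])
  fix p assume "p \<in> grid u v"
  then show "shift v (- r) (shift v r p) = p" by (simp add: shift_shift shift_0)
qed

lemma sqs_finite: "sqs X B \<Longrightarrow> finite X \<Longrightarrow> finite B"
  using sqs_block_subset by (metis PowI finite_Pow_iff finite_subset subsetI)

lemma finite_grid: "finite (grid u v)"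
  by (simp add: grid_def)

text \<open>The shift by one permutes the colours \<open>Sum\<close> among themselves and fixes the
  others. \<open>Opp\<close> joins every point to its image under the shift of order two.\<close>

datatype colour = Sum int | Opp | Diff int int

locale cyclic_factorization =
  fixes u v h :: int
  assumes u: "even u" "u \<ge> 2" and v: "v = 2 * h" and h: "h \<ge> 1"
begin

text \<open>Inside a row, a fixed sum gives no admissible partner to a point whose partner would be
  itself or its opposite, the latter pair being taken by \<open>Opp\<close>. Such points are matched
  with the row that is the round-robin partner in colour 0, at difference 0 or \<open>h\<close>.
  These two differences are therefore withdrawn from \<open>Diff\<close> in colour 0. Directing the
  difference from the lower to the higher row makes the colouring symmetric.\<close>

definition col :: "int \<times> int \<Rightarrow> int \<times> int \<Rightarrow> colour" where
  "col p q = (case (p, q) of ((i, x), (j, y)) \<Rightarrow>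
     let k = round_robin u i j; d = (if i < j then y - x else x - y) mod v
     in if i = j then if d = h then Opp else Sum ((x + y) mod v)
        else if k = 0 \<and> (d = 0 \<or> d = h) then Sum ((x + y) mod v) else Diff k d)"

definition colours :: "colour set" where
  "colours = Sum ` {0..<v} \<union> {Opp} \<union> {Diff k d | k d. k \<in> {0..<u - 1} \<and> d \<in> {0..<v} \<and> \<not> (k = 0 \<and> (d = 0 \<or> d = h))}"

text \<open>A solution of \<open>perm_turn_perm\<close> that moves \<open>Opp\<close>. On sums,
  \<open>turn\<close> adds 2, so subtracting 1 is a square root of its inverse. On colours that
  \<open>turn\<close> fixes, an involution is required, and \<open>Opp\<close> is exchanged with
  \<open>Diff 0 1\<close>. For \<open>v = 2\<close> that colour does not exist, as
  \<open>h = 1\<close>; but then \<open>turn\<close> fixes the sums too, and \<open>Sum 0\<close>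
  takes its place.\<close>

definition perm :: "colour \<Rightarrow> colour" where
  "perm c = (if v = 2 then (case c of Opp \<Rightarrow> Sum 0 | Sum s \<Rightarrow> if s = 0 then Opp else Sum s | _ \<Rightarrow> c)
     else (case c of Sum s \<Rightarrow> Sum ((s - 1) mod v) | Opp \<Rightarrow> Diff 0 1 | Diff k d \<Rightarrow> if k = 0 \<and> d = 1 then Opp else c))"

definition turn :: "colour \<Rightarrow> colour" where
  "turn c = (case c of Sum s \<Rightarrow> Sum ((s + 2) mod v) | _ \<Rightarrow> c)"

lemma v_pos: "v > 0" using v h by simp

lemma mod_h: "(- y) mod v = h \<longleftrightarrow> y mod v = h"
proof -
  have hm: "h mod v = h" using v h by simp
  have "(- y) mod v = h \<longleftrightarrow> v dvd - y - h" using hm by (metis mod_eq_dvd_iff)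
  also have "\<dots> \<longleftrightarrow> v dvd - (- y - h)" by (simp only: dvd_minus_iff)
  also have "- (- y - h) = (y - h) + v" using v by simp
  also have "v dvd \<dots> \<longleftrightarrow> v dvd y - h" by (simp only: dvd_add_left_iff dvd_refl)
  also have "\<dots> \<longleftrightarrow> y mod v = h" using hm by (metis mod_eq_dvd_iff)
  finally show ?thesis .
qed

lemma rr: "one_factorization {0..<u} {0..<u - 1} (round_robin u)"
  by (rule one_factorization_round_robin[OF u])

lemma rr_sym: "round_robin u i j = round_robin u j i"
  by (simp add: round_robin_def add.commute)

lemma col_sym: "col p q = col q p"
proof -
  obtain i x j y where pq: "p = (i, x)" "q = (j, y)" by fastforce
  show ?thesis
  proof (cases "i = j")
    case True
    have "(x - y) mod v = h \<longleftrightarrow> (y - x) mod v = h" using mod_h[of "y - x"] by simp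
    then show ?thesis using True by (simp add: pq col_def Let_def add.commute)
  next
    case False
    then have "(if i < j then y - x else x - y) = (if j < i then x - y else y - x)" by auto
    then show ?thesis using False rr_sym[of i j] by (simp add: pq col_def Let_def add.commute)
  qed
qed

lemma col_turn: "col (shift v 1 p) (shift v 1 q) = turn (col p q)"
proof -
  obtain i x j y where pq: "p = (i, x)" "q = (j, y)" by fastforce
  have d: "((x + 1) mod v - (y + 1) mod v) mod v = (x - y) mod v" "((y + 1) mod v - (x + 1) mod v) mod v = (y - x) mod v"
    by (simp_all add: mod_diff_eq)
  have s: "((x + 1) mod v + (y + 1) mod v) mod v = ((x + y) mod v + 2) mod v"
    by (metis (no_types, lifting) mod_add_eq mod_add_left_eq add.assoc add.commute one_add_one)
  show ?thesis by (auto simp: pq col_def Let_def shift_def turn_def d s)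
qed

lemma col_in: "p \<in> grid u v \<Longrightarrow> q \<in> grid u v \<Longrightarrow> p \<noteq> q \<Longrightarrow> col p q \<in> colours"
proof -
  assume pq: "p \<in> grid u v" "q \<in> grid u v" "p \<noteq> q"
  obtain i x j y where eq: "p = (i, x)" "q = (j, y)" by fastforce
  have "round_robin u i j \<in> {0..<u - 1}" if "i \<noteq> j"
    using rr pq that unfolding one_factorization_def eq grid_def by simp
  then show ?thesis using v_pos by (auto simp: eq col_def Let_def colours_def)
qed

lemma col_unique:
  assumes p: "p \<in> grid u v" and c: "c \<in> colours"
  shows "\<exists>!q. q \<in> grid u v \<and> q \<noteq> p \<and> col p q = c"
proof -
  obtain i x where ix: "p = (i, x)" "0 \<le> i" "i < u" "0 \<le> x" "x < v" using p by (auto simp: grid_def)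
  have partner: "\<exists>!j. j \<in> {0..<u} \<and> j \<noteq> i \<and> round_robin u i j = k" if "k \<in> {0..<u - 1}" for k
    using rr that ix unfolding one_factorization_def by simp
  have md: "(y - x) mod v = d mod v \<longleftrightarrow> y = (x + d) mod v" if "0 \<le> y" "y < v" for y d
  proof -
    have "(y - x) mod v = d mod v \<longleftrightarrow> y mod v = (x + d) mod v" by (simp add: mod_eq_dvd_iff algebra_simps)
    then show ?thesis using that by simp
  qed
  have md': "(x - y) mod v = d mod v \<longleftrightarrow> y = (x - d) mod v" if "0 \<le> y" "y < v" for y d
  proof -
    have "(x - y) mod v = d mod v \<longleftrightarrow> v dvd - (y - (x - d))" by (simp add: mod_eq_dvd_iff algebra_simps)
    also have "\<dots> \<longleftrightarrow> y mod v = (x - d) mod v" by (simp only: dvd_minus_iff mod_eq_dvd_iff)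
    finally show ?thesis using that by simp
  qed
  have hm: "h mod v = h" "h \<noteq> 0" using v h by simp_all
  consider (sum) s where "c = Sum s" "0 \<le> s" "s < v" | (opp) "c = Opp"
    | (diff) k d where "c = Diff k d" "k \<in> {0..<u - 1}" "0 \<le> d" "d < v" "\<not> (k = 0 \<and> (d = 0 \<or> d = h))"
    using c by (auto simp: colours_def)
  then show ?thesis
  proof cases
    case opp
    let ?q = "(i, (x + h) mod v)"
    have iff: "q \<in> grid u v \<and> q \<noteq> p \<and> col p q = c \<longleftrightarrow> q = ?q" for q
    proof -
      obtain j y where q: "q = (j, y)" by fastforce
      show ?thesis
      proof (cases "j = i \<and> 0 \<le> y \<and> y < v")
        case True
        have "(x - y) mod v = h \<longleftrightarrow> y = (x + h) mod v"
          using md[of y h] True mod_h[of "y - x"] hm by simp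
        moreover have "y \<noteq> x" if "y = (x + h) mod v"
          using that md[of y h] True hm by auto
        ultimately show ?thesis using True ix by (auto simp: q opp col_def Let_def grid_def)
      next
        case False
        then have "q \<noteq> ?q" using v_pos q by auto
        moreover have "\<not> (q \<in> grid u v \<and> col p q = c)"
          using False ix by (auto simp: q opp col_def Let_def grid_def split: if_splits)
        ultimately show ?thesis by blast
      qed
    qed
    show ?thesis unfolding iff by simp
  next
    case (diff k d)
    obtain j where j: "j \<in> {0..<u}" "j \<noteq> i" "round_robin u i j = k"
      and uj: "\<And>j'. j' \<in> {0..<u} \<Longrightarrow> j' \<noteq> i \<Longrightarrow> round_robin u i j' = k \<Longrightarrow> j' = j"
      using partner[OF diff(2)] unfolding Ex1_def by blast
    define y where "y = (if i < j then x + d else x - d) mod v"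
    have y: "0 \<le> y" "y < v" using v_pos by (simp_all add: y_def)
    have dm: "d mod v = d" using diff by simp
    have yd: "(if i < j then y' - x else x - y') mod v = d \<longleftrightarrow> y' = y" if "0 \<le> y'" "y' < v" for y'
      using md[OF that, of d] md'[OF that, of d] dm by (simp add: y_def)
    have iff: "q \<in> grid u v \<and> q \<noteq> p \<and> col p q = c \<longleftrightarrow> q = (j, y)" for q
    proof
      assume q: "q \<in> grid u v \<and> q \<noteq> p \<and> col p q = c"
      obtain j' y' where q': "q = (j', y')" by fastforce
      have r: "j' \<in> {0..<u}" "0 \<le> y'" "y' < v" using q q' by (auto simp: grid_def)
      have "i \<noteq> j'" "round_robin u i j' = k" "(if i < j' then y' - x else x - y') mod v = d"
        using q q' ix diff(1) by (auto simp: col_def Let_def split: if_splits)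
      moreover have "j' = j" using uj[OF r(1)] calculation by auto
      ultimately show "q = (j, y)" using yd[OF r(2,3)] q' by simp
    next
      assume q: "q = (j, y)"
      have "col p q = c" using yd[OF y] diff(1,5) j(2,3) ix(1) q by (auto simp: col_def Let_def)
      then show "q \<in> grid u v \<and> q \<noteq> p \<and> col p q = c" using q j ix y by (auto simp: grid_def)
    qed
    show ?thesis unfolding iff by simp
  next
    case (sum s)
    have "0 \<in> {0..<u - 1}" using u by simp
    then obtain j where j: "j \<in> {0..<u}" "j \<noteq> i" "round_robin u i j = 0"
      and uj: "\<And>j'. j' \<in> {0..<u} \<Longrightarrow> j' \<noteq> i \<Longrightarrow> round_robin u i j' = 0 \<Longrightarrow> j' = j"
      using partner unfolding Ex1_def by blast
    define y where "y = (s - x) mod v"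
    have y: "0 \<le> y" "y < v" using v_pos by (simp_all add: y_def)
    have ys: "(x + y') mod v = s \<longleftrightarrow> y' = y" if "0 \<le> y'" "y' < v" for y'
    proof -
      have "(x + y') mod v = s mod v \<longleftrightarrow> y' mod v = (s - x) mod v" by (simp add: mod_eq_dvd_iff algebra_simps)
      then show ?thesis using that sum by (simp add: y_def)
    qed
    have d0: "(y' - x) mod v = 0 \<longleftrightarrow> y' = x" "(x - y') mod v = 0 \<longleftrightarrow> y' = x"
      "(x - y') mod v = h \<longleftrightarrow> (y' - x) mod v = h" if "0 \<le> y'" "y' < v" for y'
      using md[OF that, of 0] md'[OF that, of 0] mod_h[of "y' - x"] ix by simp_all
    \<comment> \<open>The partner leaves the row exactly if the prescribed sum leads back to the
      point itself or to its opposite.\<close>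
    define j0 where "j0 = (if y = x \<or> (y - x) mod v = h then j else i)"
    have iff: "q \<in> grid u v \<and> q \<noteq> p \<and> col p q = c \<longleftrightarrow> q = (j0, y)" for q
    proof
      assume q: "q \<in> grid u v \<and> q \<noteq> p \<and> col p q = c"
      obtain j' y' where q': "q = (j', y')" by fastforce
      have r: "j' \<in> {0..<u}" "0 \<le> y'" "y' < v" using q q' by (auto simp: grid_def)
      have "(x + y') mod v = s" using q q' ix sum(1) by (auto simp: col_def Let_def split: if_splits)
      then have y': "y' = y" using ys[OF r(2,3)] by simp
      have "j' = j0"
      proof (cases "j' = i")
        case True
        have "y \<noteq> x" using q q' y' True ix by auto
        moreover have "(x - y) mod v \<noteq> h" using q q' y' True ix sum(1) by (auto simp: col_def Let_def split: if_splits)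
        ultimately show ?thesis using True d0[OF y] by (simp add: j0_def)
      next
        case False
        have "round_robin u i j' = 0 \<and> ((if i < j' then y - x else x - y) mod v = 0 \<or> (if i < j' then y - x else x - y) mod v = h)"
          using q q' y' False ix sum(1) by (auto simp: col_def Let_def split: if_splits)
        then show ?thesis using uj[OF r(1) False] d0[OF y] by (auto simp: j0_def split: if_splits)
      qed
      then show "q = (j0, y)" using q' y' by simp
    next
      assume q: "q = (j0, y)"
      have sy: "(x + y) mod v = s" using ys[OF y] by simp
      have "q \<in> grid u v" using q j ix y by (auto simp: grid_def j0_def)
      moreover have "q \<noteq> p" using q j ix by (auto simp: j0_def)
      moreover have "col p q = c"
      proof (cases "y = x \<or> (y - x) mod v = h")
        case True
        then have "j0 = j" by (simp add: j0_def)
        moreover have "(if i < j then y - x else x - y) mod v = 0 \<or> (if i < j then y - x else x - y) mod v = h"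
          using True d0[OF y] by auto
        ultimately show ?thesis using q j sy sum(1) ix(1) by (simp add: col_def Let_def)
      next
        case False
        then have "j0 = i" by (simp add: j0_def)
        moreover have "(x - y) mod v \<noteq> h" using False d0[OF y] by simp
        ultimately show ?thesis using q sy sum(1) ix(1) by (simp add: col_def Let_def)
      qed
      ultimately show "q \<in> grid u v \<and> q \<noteq> p \<and> col p q = c" by simp
    qed
    show ?thesis unfolding iff by simp
  qed
qed

lemma one_factorization_col: "one_factorization (grid u v) colours col"
  unfolding one_factorization_def using col_in col_sym col_unique by blast

lemma perm_in: "c \<in> colours \<Longrightarrow> perm c \<in> colours"
proof (cases "v = 2")
  case True
  assume "c \<in> colours"
  then show ?thesis using True unfolding perm_def colours_def by auto
next
  case False
  assume c: "c \<in> colours"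
  have "h \<noteq> 1" "1 < v" "0 < u - 1" using False v h u by auto
  then have D: "Diff 0 1 \<in> colours" "Opp \<in> colours" unfolding colours_def by auto
  show ?thesis
  proof (cases c)
    case (Sum s)
    then show ?thesis using False v_pos unfolding perm_def colours_def by simp
  qed (use D c False in \<open>auto simp: perm_def\<close>)
qed

text \<open>The shift by one carries the even pair of a mixed block to the odd columns with its
  colour \<open>c\<close> unchanged, and the odd pair to the even columns with colour
  \<open>turn (perm c)\<close>. The image is again a mixed block by this identity.\<close>

lemma perm_turn_perm: "c \<in> colours \<Longrightarrow> perm (turn (perm c)) = c"
proof (cases "v = 2")
  case True
  assume c: "c \<in> colours"
  show ?thesis using True c unfolding perm_def turn_def colours_def by auto
next
  case False
  assume c: "c \<in> colours"
  have "h \<noteq> 1" "1 < v" "0 < u - 1" using False v h u by auto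
  moreover have "(((s - 1) mod v + 2) mod v - 1) mod v = s" if "0 \<le> s" "s < v" for s
  proof -
    have "(((s - 1) mod v + 2) mod v - 1) mod v = (s - 1 + 2 - 1) mod v"
      by (simp only: mod_diff_left_eq mod_add_left_eq)
    then show ?thesis using that by simp
  qed
  ultimately show ?thesis using False c by (auto simp: perm_def turn_def colours_def split: if_splits)
qed

lemma turn_in: "c \<in> colours \<Longrightarrow> turn c \<in> colours"
  using v_pos by (auto simp: turn_def colours_def)

lemma perm_bij: "bij_betw perm colours colours"
proof (rule bij_betwI[where g = "\<lambda>c. turn (perm c)"])
  show "perm \<in> colours \<rightarrow> colours" "(\<lambda>c. turn (perm c)) \<in> colours \<rightarrow> colours"
    using perm_in turn_in by auto
  have "inj_on (\<lambda>c. perm (turn c)) (perm ` colours)"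
    by (rule inj_on_inverseI[where g = perm]) (auto simp: perm_turn_perm)
  have inj: "inj_on perm colours"
    by (rule inj_on_inverseI[where g = "\<lambda>c. perm (turn c)"]) (simp add: perm_turn_perm)
  show "perm (turn (perm c)) = c" if "c \<in> colours" for c by (rule perm_turn_perm[OF that])
  show "turn (perm (perm c)) = c" if "c \<in> colours" for c
    using inj_onD[OF inj, of "turn (perm (perm c))" c] perm_turn_perm[OF perm_in[OF that]] perm_in turn_in that by blast
qed

lemma perm_Opp: "perm Opp \<noteq> Opp" by (simp add: perm_def)

text \<open>The old grid is placed on the even and on the odd columns. The new shift of order two
  acts on each half as the old one, so every old fixed block yields two. A mixed block could be
  fixed only if both its pairs were opposite, which \<open>perm_Opp\<close> excludes.\<close>

theorem cyclic_sqs_double: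
  assumes B: "cyclic_sqs u v B"
  shows "\<exists>B'. cyclic_sqs u (2 * v) B'"
proof -
  define e0 :: "int \<times> int \<Rightarrow> int \<times> int" where "e0 p = (fst p, 2 * snd p)" for p
  define e1 :: "int \<times> int \<Rightarrow> int \<times> int" where "e1 p = (fst p, 2 * snd p + 1)" for p
  let ?X = "grid u v"
  have S: "sqs ?X B" and inv: "\<And>b. b \<in> B \<Longrightarrow> shift v 1 ` b \<in> B"
    and fx: "4 * int (card {b \<in> B. shift v h ` b = b}) = u * v"
    using B v by (auto simp: cyclic_sqs_def)
  have inj: "inj e0" "inj e1" by (auto simp: inj_def e0_def e1_def prod_eq_iff)
  have ne: "e0 p \<noteq> e1 q" for p q by (auto simp: e0_def e1_def) presburger
  define M where "M = {{e0 a, e0 b, e1 c, e1 d} | a b c d. a \<in> ?X \<and> b \<in> ?X \<and> c \<in> ?X \<and> d \<in> ?X \<and> a \<noteq> b \<and> c \<noteq> d \<and>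
    col c d = perm (col a b)}"
  define B' where "B' = (`) e0 ` B \<union> (`) e1 ` B \<union> M"
  have "sqs (e0 ` ?X \<union> e1 ` ?X) B'"
    unfolding B'_def M_def
    by (rule sqs_doubling[OF S one_factorization_col perm_bij])
      (use ne ne[symmetric] in \<open>auto intro: inj_on_subset[OF inj(1)] inj_on_subset[OF inj(2)]\<close>)
  moreover have "e0 ` ?X \<union> e1 ` ?X = grid u (2 * v)"
  proof (intro set_eqI iffI)
    fix p assume p: "p \<in> grid u (2 * v)"
    then have "(fst p, snd p div 2) \<in> ?X" by (auto simp: grid_def)
    moreover have "p = e0 (fst p, snd p div 2) \<or> p = e1 (fst p, snd p div 2)"
      by (cases "even (snd p)") (auto simp: e0_def e1_def prod_eq_iff)
    ultimately show "p \<in> e0 ` ?X \<union> e1 ` ?X" by blast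
  qed (auto simp: grid_def e0_def e1_def)
  ultimately have S': "sqs (grid u (2 * v)) B'" by simp
  have g: "shift (2 * v) 1 (e0 p) = e1 p" "shift (2 * v) 1 (e1 p) = e0 (shift v 1 p)" if "p \<in> ?X" for p
  proof -
    show "shift (2 * v) 1 (e0 p) = e1 p" using that by (auto simp: shift_def e0_def e1_def grid_def)
    have "(2 * snd p + 1 + 1) mod (2 * v) = 2 * ((snd p + 1) mod v)"
      using mult_mod_right[of 2 "snd p + 1" v] by (simp add: algebra_simps)
    then show "shift (2 * v) 1 (e1 p) = e0 (shift v 1 p)" by (simp add: shift_def e0_def e1_def)
  qed
  have bX: "b \<subseteq> ?X" if "b \<in> B" for b using sqs_block_subset[OF S that] .
  have inv': "shift (2 * v) 1 ` b \<in> B'" if b: "b \<in> B'" for b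
  proof -
    consider c where "c \<in> B" "b = e0 ` c" | c where "c \<in> B" "b = e1 ` c" | "b \<in> M"
      using b unfolding B'_def by blast
    then show ?thesis
    proof cases
      case 1
      have "shift (2 * v) 1 ` b = e1 ` c" unfolding 1(2) image_image
        using bX[OF 1(1)] g(1) by (intro image_cong) auto
      then show ?thesis using 1(1) by (simp add: B'_def)
    next
      case 2
      have "shift (2 * v) 1 ` b = e0 ` shift v 1 ` c" unfolding 2(2) image_image
        using bX[OF 2(1)] g(2) by (intro image_cong) auto
      then show ?thesis using inv[OF 2(1)] by (simp add: B'_def)
    next
      case 3
      then obtain p q r s where m: "b = {e0 p, e0 q, e1 r, e1 s}" "p \<in> ?X" "q \<in> ?X" "r \<in> ?X" "s \<in> ?X" "p \<noteq> q" "r \<noteq> s"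
        "col r s = perm (col p q)" unfolding M_def by blast
      have "shift (2 * v) 1 ` b = {e0 (shift v 1 r), e0 (shift v 1 s), e1 p, e1 q}"
        using m g by (auto simp: insert_commute)
      moreover have "shift v 1 r \<in> ?X" "shift v 1 s \<in> ?X" using shift_grid[OF v_pos] m by auto
      moreover have "shift v 1 r \<noteq> shift v 1 s" using inj_onD[OF inj_on_shift, of v 1 r s u] m by auto
      moreover have "col p q = perm (col (shift v 1 r) (shift v 1 s))"
        unfolding col_turn m(8) using perm_turn_perm[OF col_in[OF m(2,3,6)]] by simp
      ultimately have "shift (2 * v) 1 ` b \<in> M" unfolding M_def using m(2,3,6) by blast
      then show ?thesis by (simp add: B'_def)
    qed
  qed
  have gv: "shift (2 * v) v (e0 p) = e0 (shift v h p)" "shift (2 * v) v (e1 p) = e1 (shift v h p)" if "p \<in> ?X" for p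
  proof -
    have e: "(2 * snd p + v) mod (2 * v) = 2 * ((snd p + h) mod v)"
      using mult_mod_right[of 2 "snd p + h" v] v by (simp add: algebra_simps)
    have "(2 * snd p + 1 + v) mod (2 * v) = 2 * ((snd p + h) mod v) + 1"
    proof -
      have "(2 * snd p + 1 + v) mod (2 * v) = ((2 * snd p + v) mod (2 * v) + 1) mod (2 * v)"
        by (subst mod_add_left_eq) (simp add: algebra_simps)
      also have "\<dots> = (2 * ((snd p + h) mod v) + 1) mod (2 * v)" by (simp only: e)
      also have "\<dots> = 2 * ((snd p + h) mod v) + 1"
        using pos_mod_bound[OF v_pos, of "snd p + h"] pos_mod_sign[OF v_pos, of "snd p + h"]
        by (intro mod_pos_pos_trivial) linarith+
      finally show ?thesis .
    qed
    then show "shift (2 * v) v (e0 p) = e0 (shift v h p)" "shift (2 * v) v (e1 p) = e1 (shift v h p)"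
      using e by (simp_all add: shift_def e0_def e1_def)
  qed
  have fixed: "{b \<in> B'. shift (2 * v) v ` b = b} = (`) e0 ` {b \<in> B. shift v h ` b = b} \<union> (`) e1 ` {b \<in> B. shift v h ` b = b}"
    (is "?L = ?R")
  proof (intro set_eqI iffI)
    fix b assume b: "b \<in> ?L"
    then consider c where "c \<in> B" "b = e0 ` c" | c where "c \<in> B" "b = e1 ` c" | "b \<in> M"
      unfolding B'_def by blast
    then show "b \<in> ?R"
    proof cases
      case 1
      have "shift (2 * v) v ` b = e0 ` shift v h ` c" unfolding 1(2) image_image
        using bX[OF 1(1)] gv(1) by (intro image_cong) auto
      then have "shift v h ` c = c" using b 1(2) by (simp add: inj_image_eq_iff[OF inj(1)])
      then show ?thesis using 1 by blast
    next
      case 2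
      have "shift (2 * v) v ` b = e1 ` shift v h ` c" unfolding 2(2) image_image
        using bX[OF 2(1)] gv(2) by (intro image_cong) auto
      then have "shift v h ` c = c" using b 2(2) by (simp add: inj_image_eq_iff[OF inj(2)])
      then show ?thesis using 2 by blast
    next
      case 3
      then obtain p q r s where m: "b = {e0 p, e0 q, e1 r, e1 s}" "p \<in> ?X" "q \<in> ?X" "r \<in> ?X" "s \<in> ?X" "p \<noteq> q" "r \<noteq> s"
        "col r s = perm (col p q)" unfolding M_def by blast
      have sh: "{e0 (shift v h p), e0 (shift v h q), e1 (shift v h r), e1 (shift v h s)} = {e0 p, e0 q, e1 r, e1 s}"
        using b m gv by simp
      have nofix: "shift v h z \<noteq> z" if "z \<in> ?X" for z
      proof
        assume "shift v h z = z"
        then have "(snd z + h) mod v = snd z mod v" using that by (auto simp: shift_def grid_def prod_eq_iff)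
        then have "v dvd h" by (simp add: mod_eq_dvd_iff)
        then show False using v h zdvd_not_zless[of h v] by simp
      qed
      have opp: "col z w = Opp" if "w = shift v h z" "z \<in> ?X" for z w
      proof -
        have "(snd z - (snd z + h) mod v) mod v = (- h) mod v" by (simp add: mod_diff_right_eq)
        also have "\<dots> = h" using mod_h[of h] v h by simp
        finally show ?thesis using that(1) by (cases z) (simp add: col_def Let_def shift_def)
      qed
      \<comment> \<open>The shift preserves the halves and fixes no point, so it must interchange
        the two points of each pair.\<close>
      have "e0 (shift v h p) \<in> {e0 p, e0 q, e1 r, e1 s}" "e1 (shift v h r) \<in> {e0 p, e0 q, e1 r, e1 s}"
        using sh by blast+
      then have sq: "shift v h p = q" "shift v h r = s"
        using ne ne[symmetric] nofix[OF m(2)] nofix[OF m(4)] inj by (auto simp: inj_eq)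
      then have "col p q = Opp" "col r s = Opp"
        using opp[OF sq(1)[symmetric] m(2)] opp[OF sq(2)[symmetric] m(4)] by auto
      then show ?thesis using m(8) perm_Opp by simp
    qed
  next
    fix b assume "b \<in> ?R"
    then obtain c where c: "c \<in> B" "shift v h ` c = c" "b = e0 ` c \<or> b = e1 ` c" by blast
    have "shift (2 * v) v ` e0 ` c = e0 ` shift v h ` c" "shift (2 * v) v ` e1 ` c = e1 ` shift v h ` c"
      unfolding image_image using bX[OF c(1)] gv by (auto intro!: image_cong)
    then have "shift (2 * v) v ` b = b" using c(2,3) by auto
    moreover have "b \<in> B'" using c(1,3) by (auto simp: B'_def)
    ultimately show "b \<in> ?L" by simp
  qed
  define Fx where "Fx = {b \<in> B. shift v h ` b = b}"
  have "finite Fx" using sqs_finite[OF S finite_grid] by (simp add: Fx_def)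
  moreover have "(`) e0 ` Fx \<inter> (`) e1 ` Fx = {}"
  proof -
    have False if "c \<in> B" "e0 ` c = e1 ` c'" for c c'
    proof -
      have "c \<noteq> {}" using quadruple_designD(2)[OF S that(1)] by auto
      then obtain z where "z \<in> c" by blast
      then have "e0 z \<in> e1 ` c'" using that(2) by blast
      then show False using ne by blast
    qed
    then show ?thesis by (auto simp: Fx_def)
  qed
  moreover have "card ((`) e0 ` Fx) = card Fx" "card ((`) e1 ` Fx) = card Fx"
    using inj by (auto intro!: card_image simp: inj_on_def inj_image_eq_iff)
  ultimately have "card ((`) e0 ` Fx \<union> (`) e1 ` Fx) = 2 * card Fx" by (simp add: card_Un_disjoint)
  then have "4 * int (card {b \<in> B'. shift (2 * v) (2 * v div 2) ` b = b}) = u * (2 * v)"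
    using fx by (simp add: fixed Fx_def)
  then show ?thesis using S' inv' unfolding cyclic_sqs_def by blast
qed

end

text \<open>With two columns the shift exchanges the copies and is itself of order two, so an
  involution on the colours keeps the mixed blocks. The reflection
  \<open>c \<mapsto> u - 2 - c\<close> of the \<open>u - 1\<close> colours, an odd number, fixes
  exactly one. Each of the \<open>u div 2\<close> edges of that colour gives a fixed block, the edge
  repeated in both columns; this is a quarter of the \<open>2 * u\<close> points.\<close>

lemma cyclic_sqs_2:
  assumes S: "sqs_order n" and n: "even n" "n \<ge> 2"
  shows "\<exists>B. cyclic_sqs (int n) 2 B"
proof -
  define u where "u = int n"
  have u: "even u" "u \<ge> 2" using n by (auto simp: u_def)
  let ?X = "{0..<u}"
  obtain B where B: "sqs ?X B" using sqs_order_imp_sqs[OF S, of ?X] by (auto simp: u_def)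
  note rr = one_factorization_round_robin[OF u]
  let ?col = "round_robin u" and ?\<pi> = "\<lambda>c. u - 2 - c"
  define e0 e1 :: "int \<Rightarrow> int \<times> int" where "e0 i = (i, 0)" and "e1 i = (i, 1)" for i
  have inj: "inj e0" "inj e1" by (auto simp: inj_def e0_def e1_def)
  have ne: "e0 i \<noteq> e1 j" for i j by (simp add: e0_def e1_def)
  define M where "M = {{e0 a, e0 b, e1 c, e1 d} | a b c d. a \<in> ?X \<and> b \<in> ?X \<and> c \<in> ?X \<and> d \<in> ?X \<and> a \<noteq> b \<and> c \<noteq> d \<and>
    ?col c d = ?\<pi> (?col a b)}"
  define B' where "B' = (`) e0 ` B \<union> (`) e1 ` B \<union> M"
  have bij: "bij_betw ?\<pi> {0..<u - 1} {0..<u - 1}"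
    by (rule bij_betwI[where g = ?\<pi>]) auto
  have "sqs (e0 ` ?X \<union> e1 ` ?X) B'"
    unfolding B'_def M_def
    by (rule sqs_doubling[OF B rr bij])
      (use ne ne[symmetric] in \<open>auto intro: inj_on_subset[OF inj(1)] inj_on_subset[OF inj(2)]\<close>)
  moreover have "e0 ` ?X \<union> e1 ` ?X = grid u 2"
  proof -
    have "{0..<2} = {0, 1::int}" by auto
    then show ?thesis by (auto simp: grid_def e0_def e1_def)
  qed
  ultimately have S': "sqs (grid u 2) B'" by simp
  have g: "shift 2 1 (e0 i) = e1 i" "shift 2 1 (e1 i) = e0 i" for i
    by (simp_all add: shift_def e0_def e1_def)
  have g': "shift 2 1 ` e0 ` c = e1 ` c" "shift 2 1 ` e1 ` c = e0 ` c" for c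
    by (simp_all add: image_image g)
  have inv: "shift 2 1 ` b \<in> B'" if b: "b \<in> B'" for b
  proof -
    consider c where "c \<in> B" "b = e0 ` c" | c where "c \<in> B" "b = e1 ` c" | "b \<in> M" using b unfolding B'_def by blast
    then show ?thesis
    proof cases
      case 3
      then obtain p q r s where m: "b = {e0 p, e0 q, e1 r, e1 s}" "p \<in> ?X" "q \<in> ?X" "r \<in> ?X" "s \<in> ?X" "p \<noteq> q" "r \<noteq> s"
        "?col r s = ?\<pi> (?col p q)" unfolding M_def by blast
      have "shift 2 1 ` b = {e0 r, e0 s, e1 p, e1 q}" using m(1) g by (auto simp: insert_commute)
      moreover have "?col p q = ?\<pi> (?col r s)" using m(8) by simp
      ultimately have "shift 2 1 ` b \<in> M" unfolding M_def using m by blast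
      then show ?thesis by (simp add: B'_def)
    qed (auto simp: B'_def g')
  qed
  define k where "k = (u - 2) div 2"
  have k: "2 * k = u - 2" "k \<in> {0..<u - 1}" using u by (auto simp: k_def)
  define Ed where "Ed = {{a, b} | a b. a \<in> ?X \<and> b \<in> ?X \<and> a \<noteq> b \<and> ?col a b = k}"
  have sym: "?col a b = ?col b a" if "a \<in> ?X" "b \<in> ?X" "a \<noteq> b" for a b
    using rr that unfolding one_factorization_def by blast
  have ex: "\<exists>!b. b \<in> ?X \<and> b \<noteq> a \<and> ?col a b = k" if "a \<in> ?X" for a
    using rr that k(2) unfolding one_factorization_def by blast
  have "{b \<in> B'. shift 2 1 ` b = b} = (\<lambda>e. e0 ` e \<union> e1 ` e) ` Ed"
  proof (intro set_eqI iffI)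
    fix b assume b: "b \<in> {b \<in> B'. shift 2 1 ` b = b}"
    have "b \<in> M"
    proof (rule ccontr)
      assume "b \<notin> M"
      then obtain c where c: "c \<in> B" "b = e0 ` c \<or> b = e1 ` c" using b by (auto simp: B'_def)
      have "e0 ` c = e1 ` c" using b c(2) g'[of c] by auto
      moreover have "c \<noteq> {}" using quadruple_designD(2)[OF B c(1)] by auto
      ultimately show False using ne by blast
    qed
    then obtain p q r s where m: "b = {e0 p, e0 q, e1 r, e1 s}" "p \<in> ?X" "q \<in> ?X" "r \<in> ?X" "s \<in> ?X" "p \<noteq> q" "r \<noteq> s"
      "?col r s = ?\<pi> (?col p q)" unfolding M_def by blast
    have "{e0 r, e0 s, e1 p, e1 q} = {e0 p, e0 q, e1 r, e1 s}" using b m(1) g by (auto simp: insert_commute)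
    then have "e0 r \<in> {e0 p, e0 q, e1 r, e1 s}" "e0 s \<in> {e0 p, e0 q, e1 r, e1 s}" by blast+
    then have "r \<in> {p, q}" "s \<in> {p, q}" using ne inj by (auto simp: inj_eq)
    then have rs: "r = p \<and> s = q \<or> r = q \<and> s = p" using m(7) by auto
    then have "?col r s = ?col p q" using sym[OF m(2,3,6)] by auto
    then have "?col p q = k" using m(8) k(1) by simp
    then have "{p, q} \<in> Ed" using m(2,3,6) unfolding Ed_def by blast
    moreover have "b = e0 ` {p, q} \<union> e1 ` {p, q}" using m(1) rs by auto
    ultimately show "b \<in> (\<lambda>e. e0 ` e \<union> e1 ` e) ` Ed" by blast
  next
    fix b assume "b \<in> (\<lambda>e. e0 ` e \<union> e1 ` e) ` Ed"
    then obtain p q where m: "b = e0 ` {p, q} \<union> e1 ` {p, q}" "p \<in> ?X" "q \<in> ?X" "p \<noteq> q" "?col p q = k"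
      unfolding Ed_def by blast
    have "b = {e0 p, e0 q, e1 p, e1 q}" using m(1) by auto
    moreover have "?col p q = ?\<pi> (?col p q)" using m(5) k(1) by simp
    ultimately have "b \<in> M" unfolding M_def using m(2-4) by blast
    moreover have "shift 2 1 ` b = b" unfolding m(1) image_Un g' by (rule Un_commute)
    ultimately show "b \<in> {b \<in> B'. shift 2 1 ` b = b}" by (simp add: B'_def)
  qed
  moreover have "inj_on (\<lambda>e. e0 ` e \<union> e1 ` e) Ed"
  proof (rule inj_on_inverseI[where g = "(`) fst"])
    fix e show "fst ` (e0 ` e \<union> e1 ` e) = e" by (simp add: image_Un image_image e0_def e1_def)
  qed
  ultimately have "card {b \<in> B'. shift 2 1 ` b = b} = card Ed" by (simp add: card_image)
  moreover have "card ?X = card Ed * 2"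
  proof -
    have un: "\<Union>Ed = ?X"
    proof
      show "\<Union>Ed \<subseteq> ?X" by (auto simp: Ed_def)
      show "?X \<subseteq> \<Union>Ed"
      proof
        fix a assume "a \<in> ?X"
        then obtain b where "b \<in> ?X" "b \<noteq> a" "?col a b = k" using ex by blast
        then have "{a, b} \<in> Ed" using \<open>a \<in> ?X\<close> unfolding Ed_def by blast
        then show "a \<in> \<Union>Ed" by blast
      qed
    qed
    have "finite Ed" using un by (metis finite_UnionD finite_atLeastLessThan_int)
    have disj: "e \<inter> e' = {}" if e: "e \<in> Ed" "e' \<in> Ed" "e \<noteq> e'" for e e'
    proof (rule ccontr)
      assume "e \<inter> e' \<noteq> {}"
      then obtain a where a: "a \<in> e" "a \<in> e'" by blast
      have "\<exists>b. f = {a, b} \<and> b \<in> ?X \<and> b \<noteq> a \<and> ?col a b = k" if "f \<in> Ed" "a \<in> f" for f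
      proof -
        obtain p q where f: "f = {p, q}" "p \<in> ?X" "q \<in> ?X" "p \<noteq> q" "?col p q = k" using \<open>f \<in> Ed\<close> unfolding Ed_def by blast
        have "a = p \<or> a = q" using \<open>a \<in> f\<close> f by simp
        then show ?thesis
        proof
          assume "a = p" then show ?thesis using f by blast
        next
          assume "a = q" then show ?thesis using f sym[OF f(2-4)] by (intro exI[of _ p]) auto
        qed
      qed
      then obtain b b' where "e = {a, b}" "b \<in> ?X \<and> b \<noteq> a \<and> ?col a b = k" "e' = {a, b'}" "b' \<in> ?X \<and> b' \<noteq> a \<and> ?col a b' = k"
        using e(1,2) a by metis
      moreover have "a \<in> ?X" using un e(1) a(1) by blast
      ultimately show False using ex[of a] e(3) by metis
    qed
    have c2: "card e = 2" if "e \<in> Ed" for e using that by (auto simp: Ed_def)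
    have "card (\<Union>Ed) = (\<Sum>e\<in>Ed. card e)"
      by (rule card_Union_disjoint) (auto simp: pairwise_def disjnt_def disj c2 intro!: card_ge_0_finite)
    then show ?thesis using un c2 by simp
  qed
  ultimately have "4 * int (card {b \<in> B'. shift 2 (2 div 2) ` b = b}) = u * 2" by (simp add: u_def)
  then show ?thesis using S' inv unfolding cyclic_sqs_def u_def by auto
qed

theorem cyclic_sqs_power:
  assumes S: "sqs_order k" and k: "even k" "k \<ge> 2" and n: "n \<ge> 1"
  shows "\<exists>B. cyclic_sqs (int k) (2 ^ n) B"
  using n
proof (induction n rule: dec_induct)
  case base
  then show ?case using cyclic_sqs_2[OF S k] by simp
next
  case (step n)
  have "(2::int) ^ n = 2 * 2 ^ (n - 1)" using step.hyps(1) by (cases n) simp_all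
  then interpret cyclic_factorization "int k" "2 ^ n" "2 ^ (n - 1)"
    by unfold_locales (use k in simp_all)
  show ?case using step.IH cyclic_sqs_double by auto
qed

section \<open>Hanani's existence theorem\<close>

lemma sqs_order_weighting_le_2:
  assumes n: "sqs_order n" "n > 0"
    and D: "\<exists>D. quadruple_design (cross_triples (3::int) (weighted {0..<4} 3 g k)) D"
    and gk: "g > 0" "0 \<le> k" "k \<le> 2" and F: "sqs_order (nat (g + k))"
  shows "sqs_order (nat ((int n - 1) * g + k))"
proof -
  obtain D where D: "quadruple_design (cross_triples (3::int) (weighted {0..<4} 3 g k)) D" using D by blast
  have "sqs_order (nat k)" using gk by (intro sqs_order_le_2) simp
  then show ?thesis
    by (rule sqs_order_weighting[OF n D gk(1,2) holed_le_2[OF F less_imp_le[OF gk(1)] gk(2,3)]])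
qed

lemma sqs_order_10: "sqs_order 10"
  using sqs_order_weighting_le_2[OF sqs_order_4 _ cross_design_3_1] sqs_order_4 by simp

lemma mod_mult_2_cases: "(n::nat) mod (a * 2) = n mod a \<or> n mod (a * 2) = a + n mod a"
proof -
  have "x mod 2 < 2" for x :: nat by simp
  from this[of "n div a"] have "n div a mod 2 = 0 \<or> n div a mod 2 = 1" by linarith
  then show ?thesis using mod_mult2_eq[of n a 2] by auto
qed

lemma mod_mult_3_cases:
  "(n::nat) mod (a * 3) = n mod a \<or> n mod (a * 3) = a + n mod a \<or> n mod (a * 3) = a * 2 + n mod a"
proof -
  have "x mod 3 < 3" for x :: nat by simp
  from this[of "n div a"] have "n div a mod 3 = 0 \<or> n div a mod 3 = 1 \<or> n div a mod 3 = 2" by linarith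
  then show ?thesis using mod_mult2_eq[of n a 3] by auto
qed

lemma mod_6_eq_2_or_4: "(k::nat) = 6 * x + 2 \<or> k = 6 * x + 4 \<Longrightarrow> k mod 6 = 2 \<or> k mod 6 = 4"
proof -
  have "(6 * x + 2) mod 6 = 2" "(6 * x + 4) mod 6 = 4" unfolding mod_mult_self4 by simp_all
  then show "k = 6 * x + 2 \<or> k = 6 * x + 4 \<Longrightarrow> k mod 6 = 2 \<or> k mod 6 = 4" by metis
qed

text \<open>The recursions are Hanani's: with \<open>k\<close> for the smaller order,
  \<open>n\<close> is \<open>2 * k\<close>, \<open>3 * k - 2\<close>, \<open>3 * k - 4\<close>,
  \<open>3 * k - 8\<close>, \<open>4 * k - 6\<close> or \<open>12 * k - 10\<close>. In
  \<open>even_half\<close> and \<open>odd_half\<close> the base system is a single block, and a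
  large group with a stem of two or four points carries the smaller system. In \<open>three\<close>,
  \<open>four\<close> and \<open>twelve\<close> the groups have fixed size and the base system
  grows; the last two share the residues modulo 72 that the tripling rules leave over.\<close>

theorem sqs_order_exists: "n mod 6 = 2 \<or> n mod 6 = 4 \<Longrightarrow> sqs_order n"
proof (induction n rule: less_induct)
  case (less n)
  note IH = less.IH and n = less.prems
  have m12: "n mod 12 = 2 \<or> n mod 12 = 10 \<or> n mod 12 = 4 \<or> n mod 12 = 8"
    using n mod_mult_2_cases[of n 6] by auto
  have d4: "n mod 4 = n mod 12 mod 4" by (simp add: mod_mod_cancel)
  have m4: "n mod 4 = 0 \<or> n mod 12 = 2 \<or> n mod 12 = 10"
    using m12 by (elim disjE) (simp_all add: d4)
  have m36: "n mod 36 = 2 \<or> n mod 36 = 14 \<or> n mod 36 = 26" if "n mod 12 = 2"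
    using that mod_mult_3_cases[of n 12] by simp
  have m36': "n mod 36 = 10 \<or> n mod 36 = 22 \<or> n mod 36 = 34" if "n mod 12 = 10"
    using that mod_mult_3_cases[of n 12] by simp
  have m72: "n mod 72 = 2 \<or> n mod 72 = 38" if "n mod 36 = 2"
    using that mod_mult_2_cases[of n 36] by simp
  have m72': "n mod 72 = 14 \<or> n mod 72 = 50" if "n mod 36 = 14"
    using that mod_mult_2_cases[of n 36] by simp
  consider (small) "n \<le> 2 \<or> n = 4" | (double) "n mod 4 = 0" "n > 4"
    | (three) "n mod 36 = 10 \<or> n mod 36 = 22" | (even_half) "n mod 36 = 26" | (odd_half) "n mod 36 = 34"
    | (four) "n mod 72 = 2 \<or> n mod 72 = 50" "n > 2" | (twelve) "n mod 72 = 14 \<or> n mod 72 = 38"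
  proof -
    have s: "n > 4 \<or> n \<le> 2 \<or> n = 4" "n > 2 \<or> n \<le> 2 \<or> n = 4" using n by (cases "n = 3"; auto)+
    from m4 show thesis
    proof (elim disjE)
      assume "n mod 4 = 0"
      then show thesis using s(1) that(1,2) by metis
    next
      assume "n mod 12 = 2"
      from m36[OF this] show thesis
      proof (elim disjE)
        assume "n mod 36 = 2"
        then show thesis using m72 s(2) that(1,6,7) by metis
      next
        assume "n mod 36 = 14"
        then show thesis using m72' s(2) that(1,6,7) by metis
      qed (rule that(4))
    next
      assume "n mod 12 = 10"
      from m36'[OF this] show thesis using that(3,5) by metis
    qed
  qed
  then show ?case
  proof cases
    case small
    then show ?thesis using sqs_order_le_2 sqs_order_4 by auto
  next
    case double
    obtain t where t: "n = 4 * t" using mod_0_imp_dvd[OF double(1)] by (elim dvdE)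
    define k where "k = 2 * t"
    have k: "n = 2 * k" "k < n" "even k" "k \<ge> 2" using double(2) t by (simp_all add: k_def)
    have "n mod 12 = 4 \<or> n mod 12 = 8" using m12 double(1) unfolding d4 by (elim disjE) simp_all
    moreover have "n mod 12 = 2 * (k mod 6)" using mult_mod_right[of 2 k 6] k(1) by simp
    ultimately have "k mod 6 = 2 \<or> k mod 6 = 4" by (elim disjE) simp_all
    then show ?thesis using sqs_order_double[OF IH[OF k(2)] k(3,4)] k(1) by simp
  next
    case three
    define i where "i = n div 36"
    have "n = 36 * i + n mod 36" by (simp add: i_def)
    then have "n = 36 * i + 10 \<or> n = 36 * i + 22" using three by metis
    then have "n + 2 = 3 * (12 * i + 4) \<or> n + 2 = 3 * (12 * i + 8)" by (elim disjE) simp_all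
    then obtain k where k: "n + 2 = 3 * k" "k = 12 * i + 4 \<or> k = 12 * i + 8" by blast
    have km: "k mod 6 = 2 \<or> k mod 6 = 4"
      using k(2) mod_6_eq_2_or_4[of k "2 * i"] mod_6_eq_2_or_4[of k "2 * i + 1"] by (elim disjE) simp_all
    have kn: "k < n" "k > 0" using k by linarith+
    have "nat ((int k - 1) * 3 + 1) = n" using k(1) by simp
    then show ?thesis
      using sqs_order_weighting_le_2[OF IH[OF kn(1) km] kn(2) cross_design_3_1] sqs_order_4 by simp
  next
    case even_half
    define i where "i = n div 36"
    define j where "j = int i"
    have i: "n = 36 * i + 26" using even_half mult_div_mod_eq[of 36 n] by (simp add: i_def)
    then have j: "int n = 36 * j + 26" "j \<ge> 0" by (simp_all add: j_def)
    \<comment> \<open>Taking \<open>q = 2 * j + 1\<close> odd makes the half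
      \<open>3 * q + 1\<close> of the group size even for a stem of two; for the stem of four in the
      next case the half \<open>3 * q + 2\<close> is odd.\<close>
    interpret tripling "12 * j + 8" "2 * j + 1" 2 using j by unfold_locales auto
    have "12 * i + 10 < n" using i by simp
    moreover have "(12 * i + 10) mod 6 = 2 \<or> (12 * i + 10) mod 6 = 4"
      by (rule mod_6_eq_2_or_4[of _ "2 * i + 1"]) simp
    ultimately have "sqs_order (12 * i + 10)" by (rule IH)
    moreover have "12 * i + 10 = nat (12 * j + 8 + 2)" by (simp add: j_def)
    ultimately have F: "sqs_order (nat (12 * j + 8 + 2))" by simp
    have D: "\<exists>D. quadruple_design (cross_triples (3::int) (weighted {0..<4} 3 (12 * j + 8) 2)) D"
      by (rule cross_design_even_half[of "6 * j + 4"]) auto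
    have pos: "12 * j + 8 > 0" using j(2) by linarith
    have "sqs_order (nat ((int 4 - 1) * (12 * j + 8) + 2))"
      by (rule sqs_order_weighting_le_2[OF sqs_order_4 _ D pos _ _ F]) simp_all
    moreover have "nat ((int 4 - 1) * (12 * j + 8) + 2) = n" using j by simp
    ultimately show ?thesis by simp
  next
    case odd_half
    define i where "i = n div 36"
    define j where "j = int i"
    have i: "n = 36 * i + 34" using odd_half mult_div_mod_eq[of 36 n] by (simp add: i_def)
    then have j: "int n = 36 * j + 34" "j \<ge> 0" by (simp_all add: j_def)
    interpret tripling "12 * j + 10" "2 * j + 1" 4 using j by unfold_locales auto
    have "12 * i + 14 < n" using i by simp
    moreover have "(12 * i + 14) mod 6 = 2 \<or> (12 * i + 14) mod 6 = 4"
      by (rule mod_6_eq_2_or_4[of _ "2 * i + 2"]) simp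
    ultimately have "sqs_order (12 * i + 14)" by (rule IH)
    moreover have "12 * i + 14 = nat (12 * j + 10 + 4)" by (simp add: j_def)
    ultimately have "sqs_order (nat (12 * j + 10 + 4))" by simp
    then have F: "\<exists>B. quadruple_design (triples (weighted {0, 1::nat} 0 (12 * j + 10) 4) - triples ({0} \<times> {0..<4})) B"
      by (rule holed_4) (use j(2) in linarith)
    obtain D where D: "quadruple_design (cross_triples (3::int) (weighted {0..<4} 3 (12 * j + 10) 4)) D"
      using cross_design_odd_half[of "6 * j + 5"] by auto
    have pos: "12 * j + 10 > 0" using j(2) by linarith
    have "sqs_order (nat ((int 4 - 1) * (12 * j + 10) + 4))"
      by (rule sqs_order_weighting[OF sqs_order_4 _ D pos _ F]) (simp_all add: sqs_order_4)
    moreover have "nat ((int 4 - 1) * (12 * j + 10) + 4) = n" using j by simp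
    ultimately show ?thesis by simp
  next
    case four
    define i where "i = n div 72"
    have "n = 72 * i + n mod 72" by (simp add: i_def)
    then have "n = 72 * i + 2 \<or> n = 72 * i + 50" using four(1) by metis
    then have "n + 6 = 4 * (18 * i + 2) \<or> n + 6 = 4 * (18 * i + 14)" by (elim disjE) simp_all
    then obtain k where k: "n + 6 = 4 * k" "k = 18 * i + 2 \<or> k = 18 * i + 14" by blast
    have km: "k mod 6 = 2 \<or> k mod 6 = 4"
      using k(2) mod_6_eq_2_or_4[of k "3 * i"] mod_6_eq_2_or_4[of k "3 * i + 2"] by (elim disjE) simp_all
    have kn: "k < n" "k \<ge> 3" using k(1) four(2) by linarith+
    have "4 * (k - 2) + 2 = n" using k(1) kn(2) by simp
    then show ?thesis using sqs_order_4n_minus_6[OF IH[OF kn(1) km] kn(2) sqs_order_10] by simp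
  next
    case twelve
    define i where "i = n div 72"
    have "n = 72 * i + n mod 72" by (simp add: i_def)
    then have "n = 72 * i + 14 \<or> n = 72 * i + 38" using twelve by metis
    then have "n + 10 = 12 * (6 * i + 2) \<or> n + 10 = 12 * (6 * i + 4)" by (elim disjE) simp_all
    then obtain k where k: "n + 10 = 12 * k" "k = 6 * i + 2 \<or> k = 6 * i + 4" by blast
    have km: "k mod 6 = 2 \<or> k mod 6 = 4" by (rule mod_6_eq_2_or_4[OF k(2)])
    have kn: "k < n" "k > 0" using k by linarith+
    have "nat ((int k - 1) * 12 + 2) = n" using k(1) by simp
    then show ?thesis
      using sqs_order_weighting_le_2[OF IH[OF kn(1) km] kn(2) cross_design_12_2] sqs_order_14 by simp
  qed
qed

section \<open>Orbits under the shift and the number of codewords\<close>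

text \<open>The subgroups of a cyclic group of order \<open>2 ^ n\<close> form a chain, so every
  nonzero residue has the element of order two among its multiples. This is where a power of two
  enters: a block fixed by any nontrivial shift is fixed by the shift of order two.\<close>

lemma power_two_dvd_mult:
  "\<not> (2::int) ^ n dvd r \<Longrightarrow> \<exists>t. 2 ^ n dvd r * t - 2 ^ (n - 1)"
proof (induction n)
  case (Suc n)
  show ?case
  proof (cases "2 ^ n dvd r")
    case True
    then obtain c where c: "r = 2 ^ n * c" by (elim dvdE)
    have "odd c"
    proof
      assume "even c"
      then obtain d where "c = 2 * d" by (elim evenE)
      then have "r = 2 ^ Suc n * d" using c by simp
      then show False using Suc.prems by simp
    qed
    then obtain d where "c = 2 * d + 1" by (elim oddE)
    then have "r * 1 - 2 ^ (Suc n - 1) = 2 ^ Suc n * d" using c by (simp add: algebra_simps)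
    then show ?thesis by (metis dvd_triv_left)
  next
    case False
    then obtain t where t: "2 ^ n dvd r * t - 2 ^ (n - 1)" using Suc.IH by blast
    have "n \<noteq> 0" using False by (metis one_dvd power_0)
    then have "(2::int) * 2 ^ (n - 1) = 2 ^ n" by (cases n) auto
    then have e: "2 * (r * t - 2 ^ (n - 1)) = r * (2 * t) - 2 ^ (Suc n - 1)" by (simp add: algebra_simps)
    have "2 ^ Suc n dvd 2 * (r * t - 2 ^ (n - 1))" using mult_dvd_mono[OF dvd_refl t, of 2] by simp
    then show ?thesis unfolding e by blast
  qed
qed simp

lemma sqs_ex1: "sqs X B \<Longrightarrow> T \<in> triples X \<Longrightarrow> \<exists>!b. b \<in> B \<and> T \<subseteq> b"
  by (simp add: quadruple_design_def)

lemma sqs_block_unique: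
  assumes S: "sqs X B" and b: "b \<in> B" "b' \<in> B" and T: "T \<subseteq> b" "T \<subseteq> b'" "card T = 3"
  shows "b = b'"
proof -
  have "T \<in> triples X" using sqs_block_subset[OF S b(1)] T by (simp add: triples_def)
  from sqs_ex1[OF S this] obtain c where "\<And>d. d \<in> B \<Longrightarrow> T \<subseteq> d \<Longrightarrow> d = c" unfolding Ex1_def by blast
  from this[OF b(1) T(1)] this[OF b(2) T(2)] show ?thesis by simp
qed

lemma card_sqs:
  assumes S: "sqs X B" and X: "finite X"
  shows "4 * card B = card X choose 3"
proof -
  have fB: "finite B" by (rule sqs_finite[OF S X])
  have b4: "card b = 4" "finite b" if "b \<in> B" for b
    using quadruple_designD(2)[OF S that] by (auto intro: card_ge_0_finite)
  have sub: "triples b \<subseteq> triples X" if "b \<in> B" for b using S that unfolding quadruple_design_def by blast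
  have "triples X = (\<Union>b\<in>B. triples b)"
  proof
    show "triples X \<subseteq> (\<Union>b\<in>B. triples b)"
    proof
      fix T assume T: "T \<in> triples X"
      from sqs_ex1[OF S T] obtain b where "b \<in> B" "T \<subseteq> b" unfolding Ex1_def by blast
      then show "T \<in> (\<Union>b\<in>B. triples b)" using T by (auto simp: triples_def)
    qed
    show "(\<Union>b\<in>B. triples b) \<subseteq> triples X" using sub by blast
  qed
  moreover have "card (\<Union>b\<in>B. triples b) = (\<Sum>b\<in>B. card (triples b))"
  proof (rule card_UN_disjoint[OF fB])
    show "\<forall>b\<in>B. finite (triples b)" using b4(2) by (auto simp: triples_def)
    show "\<forall>b\<in>B. \<forall>b'\<in>B. b \<noteq> b' \<longrightarrow> triples b \<inter> triples b' = {}"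
    proof (intro ballI impI)
      fix b b' assume bb: "b \<in> B" "b' \<in> B" "b \<noteq> b'"
      show "triples b \<inter> triples b' = {}"
      proof (rule equals0I)
        fix T assume "T \<in> triples b \<inter> triples b'"
        then have "T \<subseteq> b" "T \<subseteq> b'" "card T = 3" by (auto simp: triples_def)
        then show False using sqs_block_unique[OF S bb(1,2)] bb(3) by simp
      qed
    qed
  qed
  moreover have "(4::nat) choose 3 = 4" by (simp add: numeral_eq_Suc)
  then have "card (triples b) = 4" if "b \<in> B" for b
    using n_subsets[OF b4(2)[OF that], of 3] b4(1)[OF that] by (simp add: triples_def)
  ultimately have "card (triples X) = card B * 4" by simp
  then show ?thesis using n_subsets[OF X, of 3] by (simp add: triples_def)
qed

lemma choose_three: "6 * int (w choose 3) = int w * (int w - 1) * (int w - 2)"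
proof (induction w)
  case (Suc w)
  have two: "2 * int (w choose 2) = int w * (int w - 1)"
  proof (induction w)
    case (Suc w)
    have "Suc w choose 2 = w + (w choose 2)" by (simp add: numeral_2_eq_2)
    then show ?case using Suc by (simp add: algebra_simps)
  qed simp
  have "Suc w choose 3 = (w choose 2) + (w choose 3)" by (simp add: numeral_3_eq_3 numeral_2_eq_2)
  then have "6 * int (Suc w choose 3) = 3 * (2 * int (w choose 2)) + 6 * int (w choose 3)" by simp
  then show ?case unfolding two Suc.IH by (simp add: algebra_simps)
qed simp

text \<open>A codeword is chosen from every orbit of blocks that are not fixed by the shift of order two. Every
  nontrivial group of shifts contains that shift, so these orbits have full length.\<close>

theorem cyclic_sqs_imp_OOC:
  assumes B: "cyclic_sqs (int u) (2 ^ n) B" and n: "n \<ge> 1"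
  shows "\<exists>C. is_2D_OOC u (2 ^ n) C \<and> 4 * card C * 2 ^ n + u * 2 ^ n = 4 * card B"
proof -
  define v :: int where "v = 2 ^ n"
  have v: "v > 0" "v = int (2 ^ n)" by (simp_all add: v_def)
  have v2: "v div 2 = 2 ^ (n - 1)" using n by (cases n) (auto simp: v_def)
  let ?X = "grid (int u) v"
  define S where "S r b = shift v r ` b" for r b
  have sq: "sqs ?X B" and inv1: "\<And>b. b \<in> B \<Longrightarrow> S 1 b \<in> B"
    and fx: "4 * int (card {b \<in> B. S (v div 2) b = b}) = int u * v"
    using B by (auto simp: cyclic_sqs_def v_def S_def)
  have fB: "finite B" by (rule sqs_finite[OF sq finite_grid])
  have bX: "b \<subseteq> ?X" if "b \<in> B" for b by (rule sqs_block_subset[OF sq that])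
  have SS: "S r (S s b) = S (r + s) b" for r s b by (simp add: S_def image_image shift_shift)
  have S0: "S 0 b = b" if "b \<in> B" for b
  proof -
    have "S 0 b = id ` b" unfolding S_def using bX[OF that] shift_0 by (intro image_cong) auto
    then show ?thesis by simp
  qed
  have Scong: "S r b = S s b" if "r mod v = s mod v" for r s b
    unfolding S_def by (rule image_cong[OF refl shift_cong[OF that]])
  have SB_nat: "S (int k) b \<in> B" if b: "b \<in> B" for k b
  proof (induction k)
    case 0
    then show ?case using S0[OF b] b by simp
  next
    case (Suc k)
    then show ?case using inv1[OF Suc] by (simp add: SS)
  qed
  have SB: "S r b \<in> B" if "b \<in> B" for r b
    using SB_nat[OF that, of "nat (r mod v)"] Scong[of "r mod v" r b] v(1) by simp
  have mult_nat: "S (r * int k) b = b" if b: "b \<in> B" "S r b = b" for r k b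
  proof (induction k)
    case 0
    then show ?case using S0[OF b(1)] by simp
  next
    case (Suc k)
    have "S (r * int (Suc k)) b = S (r * int k) (S r b)" unfolding SS by (simp add: algebra_simps)
    then show ?case using Suc b(2) by simp
  qed
  have mult: "S (r * t) b = b" if "b \<in> B" "S r b = b" for r t b
  proof -
    have "(r * t) mod v = (r * int (nat (t mod v))) mod v" using v(1) by (simp add: mod_mult_right_eq)
    from Scong[OF this, of b] show ?thesis using mult_nat[OF that, of "nat (t mod v)"] by simp
  qed
  define N where "N = {b \<in> B. S (v div 2) b \<noteq> b}"
  have NB: "b \<in> B" if "b \<in> N" for b using that by (simp add: N_def)
  have free: "v dvd r" if b: "b \<in> N" "S r b = b" for b r
  proof (rule ccontr)
    assume "\<not> v dvd r"
    then obtain t where "v dvd r * t - v div 2" using power_two_dvd_mult[of n r] v2 by (auto simp: v_def)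
    then have "S (r * t) b = S (v div 2) b" by (intro Scong) (simp add: mod_eq_dvd_iff)
    then show False using mult[OF NB[OF b(1)] b(2), of t] b(1) by (simp add: N_def)
  qed
  have NS: "S r b \<in> N" if b: "b \<in> N" for r b
  proof -
    have "S (v div 2) b = b" if "S (v div 2) (S r b) = S r b"
    proof -
      have "S (- r) (S (v div 2) (S r b)) = S (- r) (S r b)" using that by simp
      then show ?thesis unfolding SS using S0[OF NB[OF b]] by simp
    qed
    then show ?thesis using b SB[OF NB[OF b]] by (auto simp: N_def)
  qed
  define orb where "orb b = range (\<lambda>r. S r b)" for b
  have orb_self: "b \<in> orb b" if "b \<in> N" for b
    unfolding orb_def by (rule range_eqI[where x = 0]) (simp add: S0[OF NB[OF that]])
  have orb_N: "orb b \<subseteq> N" if "b \<in> N" for b using NS[OF that] by (auto simp: orb_def)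
  have orb_eq: "orb c = orb b" if cb: "c \<in> orb b" for b c
  proof -
    obtain s where c: "c = S s b" using cb by (auto simp: orb_def)
    have "S r b \<in> orb c" for r
    proof -
      have "S r b = S (r - s) c" by (simp add: c SS)
      then show ?thesis by (simp add: orb_def)
    qed
    moreover have "S r c \<in> orb b" for r by (simp add: c SS orb_def)
    ultimately have "orb b \<subseteq> orb c" "orb c \<subseteq> orb b" unfolding orb_def by blast+
    then show ?thesis by blast
  qed
  have orb_card: "card (orb b) = 2 ^ n" if b: "b \<in> N" for b
  proof -
    have "orb b = (\<lambda>r. S r b) ` {0..<v}"
    proof
      show "orb b \<subseteq> (\<lambda>r. S r b) ` {0..<v}"
      proof
        fix c assume "c \<in> orb b"
        then obtain r where "c = S r b" by (auto simp: orb_def)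
        then have "c = S (r mod v) b" using Scong[of r "r mod v" b] by simp
        then show "c \<in> (\<lambda>r. S r b) ` {0..<v}" using v(1) by simp
      qed
    qed (auto simp: orb_def)
    moreover have "inj_on (\<lambda>r. S r b) {0..<v}"
    proof (rule inj_onI)
      fix r s assume rs: "r \<in> {0..<v}" "s \<in> {0..<v}" "S r b = S s b"
      have "S (- s) (S r b) = S (- s) (S s b)" using rs(3) by simp
      then have "S (r - s) b = b" unfolding SS using S0[OF NB[OF b]] by simp
      then have "r mod v = s mod v" using free[OF b] by (simp add: mod_eq_dvd_iff)
      then show "r = s" using rs by simp
    qed
    ultimately have "card (orb b) = nat v" by (simp add: card_image)
    then show ?thesis using v(2) by simp
  qed
  define R where "R = orb ` N"
  have fN: "finite N" using fB by (simp add: N_def)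
  have UR: "\<Union>R = N" unfolding R_def using orb_self orb_N by blast
  have R_orb: "Q = orb b" if "Q \<in> R" "b \<in> Q" for Q b using that orb_eq by (auto simp: R_def)
  have cN: "2 ^ n * card R = card N"
    unfolding UR[symmetric]
  proof (rule card_partition)
    show "finite R" using fN by (simp add: R_def)
    show "finite (\<Union>R)" using fN UR by simp
    show "card Q = 2 ^ n" if "Q \<in> R" for Q using that orb_card by (auto simp: R_def)
    show "Q \<inter> Q' = {}" if Q: "Q \<in> R" "Q' \<in> R" "Q \<noteq> Q'" for Q Q'
    proof (rule ccontr)
      assume "Q \<inter> Q' \<noteq> {}"
      then obtain b where "b \<in> Q" "b \<in> Q'" by blast
      then show False using R_orb[OF Q(1)] R_orb[OF Q(2)] Q(3) by metis
    qed
  qed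
  define rep where "rep Q = (SOME b. b \<in> Q)" for Q :: "(int \<times> int) set set"
  have rep: "rep Q \<in> Q" if Q: "Q \<in> R" for Q
  proof -
    obtain b where "b \<in> N" "Q = orb b" using Q unfolding R_def by blast
    then have "b \<in> Q" using orb_self by simp
    then show ?thesis unfolding rep_def by (rule someI)
  qed
  have repN: "rep Q \<in> N" if "Q \<in> R" for Q using rep[OF that] UR that by blast
  \<comment> \<open>Representatives of different orbits are not shifts of each other, and a free
    orbit has trivial stabilizer. The conclusion excludes both alternatives of the code condition at
    once.\<close>
  have key: "b = b' \<and> v dvd r" if b: "b \<in> rep ` R" "b' \<in> rep ` R" "S r b = b'" for b b' r
  proof -
    obtain Q Q' where Q: "Q \<in> R" "b = rep Q" "Q' \<in> R" "b' = rep Q'" using b by blast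
    have Qb: "Q = orb b" unfolding Q(2) by (rule R_orb[OF Q(1) rep[OF Q(1)]])
    have "b' \<in> orb b" unfolding orb_def using b(3) by blast
    then have "b' \<in> Q" by (simp only: Qb)
    have "Q = orb b'" by (rule R_orb[OF Q(1) \<open>b' \<in> Q\<close>])
    also have "\<dots> = Q'" unfolding Q(4) by (rule R_orb[OF Q(3) rep[OF Q(3)], symmetric])
    finally have "b = b'" using Q(2,4) by simp
    moreover from this have "S r b = b" using b(3) by simp
    moreover have "b \<in> N" unfolding Q(2) by (rule repN[OF Q(1)])
    ultimately show ?thesis using free by blast
  qed
  have "inj_on rep R"
  proof (rule inj_onI)
    fix Q Q' assume Q: "Q \<in> R" "Q' \<in> R" "rep Q = rep Q'"
    have "Q = orb (rep Q)" by (rule R_orb[OF Q(1) rep[OF Q(1)]])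
    also have "\<dots> = orb (rep Q')" using Q(3) by simp
    also have "\<dots> = Q'" by (rule R_orb[OF Q(2) rep[OF Q(2)], symmetric])
    finally show "Q = Q'" .
  qed
  then have c1: "card (rep ` R) = card R" by (rule card_image)
  define \<iota> :: "int \<times> int \<Rightarrow> nat \<times> nat" where "\<iota> p = (nat (fst p), nat (snd p))" for p
  define \<kappa> :: "nat \<times> nat \<Rightarrow> int \<times> int" where "\<kappa> p = (int (fst p), int (snd p))" for p
  have \<kappa>\<iota>: "\<kappa> (\<iota> p) = p" if "p \<in> ?X" for p using that by (auto simp: \<kappa>_def \<iota>_def grid_def)
  have inj\<iota>: "inj_on \<iota> ?X" by (rule inj_on_inverseI[where g = \<kappa>]) (rule \<kappa>\<iota>)
  have repB: "b \<in> B" if "b \<in> rep ` R" for b using that repN NB by auto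
  have "\<Union>(rep ` R) \<subseteq> ?X" using repB bX by blast
  then have "inj_on ((`) \<iota>) (rep ` R)" by (intro inj_on_image inj_on_subset[OF inj\<iota>])
  then have c2: "card ((`) \<iota> ` rep ` R) = card R" using card_image c1 by fastforce
  let ?C = "(`) \<iota> ` rep ` R"
  have "is_2D_OOC u (2 ^ n) ?C"
    unfolding is_2D_OOC_def
  proof (intro conjI ballI allI impI)
    show "finite ?C" using fN by (simp add: R_def)
  next
    fix A assume "A \<in> ?C"
    then obtain a where a: "a \<in> B" "A = \<iota> ` a" using repB by blast
    show "A \<subseteq> {..<u} \<times> {..<2 ^ n}"
    proof
      fix p assume "p \<in> A"
      then obtain z where z: "z \<in> ?X" "p = \<iota> z" using a bX by blast
      then show "p \<in> {..<u} \<times> {..<2 ^ n}" using v(2) by (auto simp: grid_def \<iota>_def nat_less_iff)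
    qed
    show "card A = 4"
      unfolding a(2) using card_image[OF inj_on_subset[OF inj\<iota> bX[OF a(1)]]] quadruple_designD(2)[OF sq a(1)] by simp
  next
    fix A A' and r :: int
    assume A: "A \<in> ?C" "A' \<in> ?C" and ne: "A \<noteq> A' \<or> \<not> int (2 ^ n) dvd r"
    obtain a a' where a: "a \<in> rep ` R" "A = \<iota> ` a" "a' \<in> rep ` R" "A' = \<iota> ` a'" using A by blast
    let ?Z = "{(i, j). (i, j) \<in> A \<and> (i, nat ((int j + r) mod int (2 ^ n))) \<in> A'}"
    show "card ?Z \<le> 2"
    proof (rule ccontr)
      assume "\<not> card ?Z \<le> 2"
      \<comment> \<open>Three coincidences would give the shifted block and \<open>a'\<close> a
        common triple, so they would be the same block of the system.\<close>
      then obtain T where T: "T \<subseteq> ?Z" "card T = 3" using obtain_subset_with_card_n[of 3 ?Z] by auto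
      have mem: "\<kappa> p \<in> a" "shift v r (\<kappa> p) \<in> a'" if "p \<in> T" for p
      proof -
        obtain i j where p: "p = (i, j)" by fastforce
        have ij: "(i, j) \<in> \<iota> ` a" "(i, nat ((int j + r) mod v)) \<in> \<iota> ` a'"
          using that T(1) a v(2) by (auto simp: p)
        then show "\<kappa> p \<in> a" using \<kappa>\<iota> bX[OF repB[OF a(1)]] by (auto simp: p)
        have "shift v r (\<kappa> p) = \<kappa> (i, nat ((int j + r) mod v))" using v(1) by (simp add: shift_def \<kappa>_def p)
        also have "\<dots> \<in> a'" using ij(2) \<kappa>\<iota> bX[OF repB[OF a(3)]] by auto
        finally show "shift v r (\<kappa> p) \<in> a'" .
      qed
      let ?T = "(\<lambda>p. shift v r (\<kappa> p)) ` T"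
      have "inj_on \<kappa> T" by (auto simp: inj_on_def \<kappa>_def prod_eq_iff)
      moreover have "\<kappa> ` T \<subseteq> ?X" using mem(1) bX[OF repB[OF a(1)]] by blast
      ultimately have "inj_on (shift v r \<circ> \<kappa>) T" by (intro comp_inj_on inj_on_subset[OF inj_on_shift])
      then have "card ?T = 3" using T(2) by (simp add: card_image comp_def)
      moreover have sub: "?T \<subseteq> S r a" "?T \<subseteq> a'" using mem by (auto simp: S_def)
      ultimately have "S r a = a'" using sqs_block_unique[OF sq SB[OF repB[OF a(1)]] repB[OF a(3)] sub] by simp
      from key[OF a(1,3) this] show False using ne unfolding a(2,4) v(2) by blast
    qed
  qed
  moreover have "4 * card ?C * 2 ^ n + u * 2 ^ n = 4 * card B"
  proof -
    define F where "F = {b \<in> B. S (v div 2) b = b}"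
    have "card (N \<union> F) = card N + card F" by (rule card_Un_disjoint) (use fB in \<open>auto simp: N_def F_def\<close>)
    moreover have "B = N \<union> F" by (auto simp: N_def F_def)
    ultimately have "card B = card N + card F" by simp
    moreover have "int (4 * card F) = int (u * 2 ^ n)" using fx v(2) by (simp add: F_def)
    then have "4 * card F = u * 2 ^ n" by (simp only: of_nat_eq_iff)
    moreover have "4 * card ?C * 2 ^ n = 4 * card N" unfolding c2 cN[symmetric] by simp
    ultimately show ?thesis by simp
  qed
  ultimately show ?thesis by blast
qed

theorem theorem9p4:
  fixes u n :: nat
  assumes "u mod 6 = 2 \<or> u mod 6 = 4" and "n \<ge> 1"
  shows "\<exists>C. is_2D_OOC u (2 ^ n) C \<and> int (card C) = J_star u (2 ^ n)"
proof -
  have u: "even u" "u \<ge> 2" using assms(1) by presburger+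
  obtain B where B: "cyclic_sqs (int u) (2 ^ n) B"
    using cyclic_sqs_power[OF sqs_order_exists[OF assms(1)] u assms(2)] by blast
  obtain C where C: "is_2D_OOC u (2 ^ n) C" and cC: "4 * card C * 2 ^ n + u * 2 ^ n = 4 * card B"
    using cyclic_sqs_imp_OOC[OF B assms(2)] by blast
  define w where "w = u * 2 ^ n"
  have "card (grid (int u) (2 ^ n)) = w" by (simp add: grid_def w_def card_cartesian_product nat_power_eq)
  then have "4 * card B = w choose 3" using card_sqs[of "grid (int u) (2 ^ n)" B] B finite_grid by (simp add: cyclic_sqs_def)
  then have "6 * int (4 * card C * 2 ^ n + u * 2 ^ n) = int w * (int w - 1) * (int w - 2)"
    using cC choose_three[of w] by simp
  then have "(2 ^ n :: int) * (24 * int (card C) + 6 * int u) = 2 ^ n * (int u * (int w - 1) * (int w - 2))"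
    by (simp add: w_def algebra_simps)
  then have count: "24 * int (card C) + 6 * int u = int u * ((int w - 1) * (int w - 2))" by simp
  have wm: "(u * 2 ^ k) mod 6 = 2 \<or> (u * 2 ^ k) mod 6 = 4" for k
  proof (induction k)
    case (Suc k)
    have "u * 2 ^ Suc k = 2 * (u * 2 ^ k)" by simp
    then show ?case using Suc by presburger
  qed (use assms in simp)
  define k where "k = u * 2 ^ (n - 1)"
  have k: "w = 2 * k" using assms(2) by (cases n) (simp_all add: w_def k_def)
  have km: "k mod 6 = 2 \<or> k mod 6 = 4" using wm[of "n - 1"] by (simp add: k_def)
  then have w12: "w mod 12 = 4 \<or> w mod 12 = 8" using k by presburger
  \<comment> \<open>As 3 does not divide \<open>w\<close>, either \<open>w\<close> is 1 modulo 3, or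
    it is 2 modulo 3 and its half \<open>k\<close> is 1. This makes the outer floor of
    \<open>N_bound\<close> exact; the inner one is exact since \<open>w\<close> is even.\<close>
  have "3 dvd int w - 1 \<or> 3 dvd int k - 1" using km k by presburger
  then have "3 dvd (int w - 1) * (int k - 1)" by (auto intro: dvd_mult dvd_mult2)
  then obtain M where M: "(int w - 1) * (int k - 1) = 3 * M" by (elim dvdE)
  have "(real w - 1) * real_of_int (int k - 1) = 3 * real_of_int M" using arg_cong[OF M, of real_of_int] by simp
  then have Mr: "(real w - 1) / 3 * real_of_int (int k - 1) = real_of_int M" by (simp add: field_simps)
  have "(real w - 2) / 2 = real_of_int (int k - 1)" using k by (simp add: field_simps)
  then have fl: "\<lfloor>(real w - 2) / 2\<rfloor> = int k - 1" by (simp only: floor_of_int)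
  have N: "N_bound u (2 ^ n) = M" unfolding N_bound_def w_def[symmetric] fl Mr by (rule floor_of_int)
  have e: "int w - 2 = 2 * (int k - 1)" using k by simp
  have six: "6 * M = (int w - 1) * (int w - 2)"
  proof -
    have "6 * M = 2 * ((int w - 1) * (int k - 1))" unfolding M by simp
    also have "\<dots> = (int w - 1) * (int w - 2)" by (simp only: e mult_ac)
    finally show ?thesis .
  qed
  have "24 * int (card C) + 6 * int u = int u * (6 * M)" unfolding six by (rule count)
  then have "6 * (4 * int (card C)) = 6 * (int u * (M - 1))" by (simp add: algebra_simps)
  then have "4 * int (card C) = int u * (M - 1)" by simp
  from arg_cong[OF this, of real_of_int]
  have "4 * real (card C) = real u * real_of_int (M - 1)" by simp
  then have J: "real u / 4 * real_of_int (M - 1) = real_of_int (int (card C))" by (simp add: field_simps)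
  \<comment> \<open>The first clause of \<open>J_star\<close> concerns odd \<open>u\<close> only.
    The second one applies because \<open>w\<close> is 4 or 8 modulo 12 and the number of columns is
    even.\<close>
  have "u mod 12 \<noteq> 7" "u mod 12 \<noteq> 11" using u(1) by presburger+
  then have c1: "\<not> ((u mod 12 = 7 \<or> u mod 12 = 11) \<and> (2::nat) ^ n = 2)" by simp
  have ev: "even ((2::nat) ^ n)" using assms(2) by simp
  have c2: "(u * 2 ^ n) mod 6 = 0 \<and> \<not> in_A u (2 ^ n) \<and> \<not> in_B u (2 ^ n)
      \<or> ((u * 2 ^ n) mod 12 = 4 \<or> (u * 2 ^ n) mod 12 = 8) \<and> even ((2::nat) ^ n)"
    using w12 ev unfolding w_def by blast
  have "J_star u (2 ^ n) = \<lfloor>real u / 4 * real_of_int (M - 1)\<rfloor>"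
    unfolding J_star_def Let_def N by (simp only: c1 c2 if_False if_True)
  then have "int (card C) = J_star u (2 ^ n)" unfolding J by (simp only: floor_of_int)
  then show ?thesis using C by blast
qed

end
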